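(* Let $(\pi:A\to M,\varrho,\alpha)$ be an involution algebroid in a tangent category with negatives. For sections $X,Y\in\Gamma(\pi)$ let $[X,Y]_\alpha\in\Gamma(\pi)$ be the section determined by $$\lambda[X,Y]_\alpha=\bigl(\alpha(X,T(Y)\varrho X)-_pT(X)\varrho Y\bigr)-_{T(\pi)}0X.$$ Then $[-,-]_\alpha$ is a Lie bracket on $\Gamma(\pi)$.
   Context: Conventions: composition is juxtaposition in applicative order ($gf$: first $f$, then $g$); subscripts of natural transformations are omitted; equations may be read on generalised elements. An additive bundle over $M$ is a commutative monoid in the slice category over $M$: an arrow $q:E\to M$, zero $\xi:M\to E$, addition $+_q:E\times_ME\to E$. A morphism is a commuting square $(\phi_1,\phi_0)$ preserving zero and addition. A tangent category is a category with an endofunctor $T$ and natural transformations $p:T\Rightarrow\mathrm{id}$, $0:\mathrm{id}\Rightarrow T$, $+:T\times_{p,p}T\Rightarrow T$, $l:T\Rightarrow T^2$, $c:T^2\Rightarrow T^2$ such that: pullback powers of $p$ exist and are preserved by $T$; each $(p_M,0_M,+_M)$ is an additive bundle; $(l,0):p\Rightarrow T(p)$ and $(c,\mathrm{id}):T(p)\Rightarrow p$ are additive bundle morphisms; $cc=\mathrm{id}$, $T(c)cT(c)=cT(c)c$, $cl=l$, $T(l)l=ll$, $cT(c)l=T(l)c$; and $\mu(a,b)=T(+)(0b,la)$, $T(M)\times_MT(M)\to T^2(M)$, is an equaliser of $T(p)$ and $0pp$. Standing assumptions: negatives (all additive bundles are commutative groups in the slice) and all limits used exist and are preserved by $T$.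 A differential bundle is an additive bundle $q:E\to M$ with a lift $\lambda:E\to T(E)$ such that $(\lambda,0):q\Rightarrow T(q)$ and $(\lambda,\xi):q\Rightarrow p$ are additive bundle morphisms, $T(\lambda)\lambda=l\lambda$, and $\mu(a,b)=T(+_q)(0a,\lambda b)$, $E\times_ME\to T(E)$, is an equaliser of $T(q)$ and $0qp$. A morphism is a commuting square $(\phi_1,\phi_0)$; it is linear if $T(\phi_1)\lambda=\lambda'\phi_1$. $(T(M),p)$ with lift $l$ and $(T(E),T(q))$ with addition $T(+_q)$, zero $T(\xi)$, lift $cT(\lambda)$ are differential bundles. $+_p,-_p$ and $+_{T(q)},-_{T(q)}$ denote the fibrewise operations of $p:T(E)\to E$ and $T(q):T(E)\to T(M)$. Anchored bundle: a differential bundle $\pi:A\to M$ with a linear morphism $\varrho:A\to T(M)$ over $\mathrm{id}_M$. Prolongation: the pullback $P=A\times_{\varrho,T(\pi)}T(A)$ of $\varrho$ and $T(\pi):T(A)\to T(M)$, projections $\pi_0,\pi_1$. It carries two differential bundle structures over $A$: $(P,\pi_0)$ with lift $0\times cT(\lambda)$, and $(P,p\pi_1)$ with lift $\lambda\times l$ (with componentwise operations). Involution algebroid: an anchored bundle with $\alpha:P\to T(A)$ such that $(\alpha,\mathrm{id}):(P,\pi_0)\Rightarrow(T(A),p)$ and $(\alpha,\varrho):(P,p\pi_1)\Rightarrow(T(A),T(\pi))$ are linear bundle morphisms and: $T(\varrho)\alpha=cT(\varrho)\pi_1$; $\alpha(\xi\pi,\lambda)=\lambda$; $\alpha(p\pi_1,\alpha)=\pi_1$;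 $T(\alpha)(\alpha(v,w),x)=cT(\alpha)(\alpha(v,px),cT(\alpha)(w,cx))$ whenever $\varrho v=T(\pi)w$ and $cT^2(\pi)x=T(\varrho)w$. $\Gamma(\pi)$ is the abelian group (under $+_\pi$) of sections $X:M\to A$, $\pi X=\mathrm{id}$. The two arrows $\alpha(X,T(Y)\varrho X)$ and $T(X)\varrho Y$ have the same image under $p$ (namely $X$) and under $T(\pi)$ (namely $\varrho Y$), so the universal property of $\lambda$ gives a unique $[X,Y]_\alpha$ as in the claim. A Lie bracket on an abelian group here means a biadditive operation with $[X,Y]=-[Y,X]$ satisfying the Jacobi identity $[X,[Y,Z]]+[Z,[X,Y]]+[Y,[Z,X]]=0$. *)

theory Defs
  imports "HOL-Algebra.Group"
begin

section \<open>Categories and finite limits\<close>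

text \<open>Composition is applicative: \<open>g \<cdot> f\<close> is first \<open>f\<close>, then \<open>g\<close>. The values of all operations
  outside the carriers \<open>Obj\<close> and \<open>Arr\<close>, and of \<open>Comp\<close> on non-composable pairs, are irrelevant.\<close>

record ('o, 'a) category_data =
  Obj :: "'o set"
  Arr :: "'a set"
  Dom :: "'a \<Rightarrow> 'o"
  Cod :: "'a \<Rightarrow> 'o"
  Idn :: "'o \<Rightarrow> 'a"
  Comp :: "'a \<Rightarrow> 'a \<Rightarrow> 'a" (infixr "\<cdot>\<index>" 70)

definition homset :: "('o, 'a, 'm) category_data_scheme \<Rightarrow> 'o \<Rightarrow> 'o \<Rightarrow> 'a set" where
  "homset C X Y = {f \<in> Arr C. Dom C f = X \<and> Cod C f = Y}"

locale category =
  fixes C :: "('o, 'a, 'm) category_data_scheme" (structure)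
  assumes dom_obj: "f \<in> Arr C \<Longrightarrow> Dom C f \<in> Obj C"
    and cod_obj: "f \<in> Arr C \<Longrightarrow> Cod C f \<in> Obj C"
    and idn_hom: "X \<in> Obj C \<Longrightarrow> Idn C X \<in> homset C X X"
    and comp_hom: "\<lbrakk>f \<in> homset C X Y; g \<in> homset C Y Z\<rbrakk> \<Longrightarrow> g \<cdot> f \<in> homset C X Z"
    and comp_idn_right: "f \<in> Arr C \<Longrightarrow> f \<cdot> Idn C (Dom C f) = f"
    and comp_idn_left: "f \<in> Arr C \<Longrightarrow> Idn C (Cod C f) \<cdot> f = f"
    and comp_assoc: "\<lbrakk>f \<in> homset C W X; g \<in> homset C X Y; h \<in> homset C Y Z\<rbrakk>
      \<Longrightarrow> h \<cdot> (g \<cdot> f) = (h \<cdot> g) \<cdot> f"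

definition is_pullback ::
    "('o, 'a, 'm) category_data_scheme \<Rightarrow> 'a \<Rightarrow> 'a \<Rightarrow> 'a \<Rightarrow> 'a \<Rightarrow> bool" where
  "is_pullback C f g a b \<longleftrightarrow>
     {f, g, a, b} \<subseteq> Arr C \<and> Cod C f = Cod C g \<and> Dom C a = Dom C b
     \<and> Cod C a = Dom C f \<and> Cod C b = Dom C g \<and> f \<cdot>\<^bsub>C\<^esub> a = g \<cdot>\<^bsub>C\<^esub> b
     \<and> (\<forall>X u v. u \<in> homset C X (Dom C f) \<and> v \<in> homset C X (Dom C g) \<and> f \<cdot>\<^bsub>C\<^esub> u = g \<cdot>\<^bsub>C\<^esub> v
          \<longrightarrow> (\<exists>!h. h \<in> homset C X (Dom C a) \<and> a \<cdot>\<^bsub>C\<^esub> h = u \<and> b \<cdot>\<^bsub>C\<^esub> h = v))"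

text \<open>The arrow \<open>(u, v)\<close> into a pullback with projections \<open>a\<close> and \<open>b\<close>. The projections are explicit,
  so that \<open>(u, v)\<close> can also be formed with values in the image under \<open>T\<close> of a pullback,
  whose projections are \<open>T(a)\<close> and \<open>T(b)\<close>.\<close>

definition pair_arr ::
    "('o, 'a, 'm) category_data_scheme \<Rightarrow> 'a \<Rightarrow> 'a \<Rightarrow> 'a \<Rightarrow> 'a \<Rightarrow> 'a" where
  "pair_arr C a b u v =
     (THE h. h \<in> homset C (Dom C u) (Dom C a) \<and> a \<cdot>\<^bsub>C\<^esub> h = u \<and> b \<cdot>\<^bsub>C\<^esub> h = v)"

definition is_equaliser ::
    "('o, 'a, 'm) category_data_scheme \<Rightarrow> 'a \<Rightarrow> 'a \<Rightarrow> 'a \<Rightarrow> bool" where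
  "is_equaliser C f g e \<longleftrightarrow>
     {f, g, e} \<subseteq> Arr C \<and> Dom C f = Dom C g \<and> Cod C f = Cod C g
     \<and> Cod C e = Dom C f \<and> f \<cdot>\<^bsub>C\<^esub> e = g \<cdot>\<^bsub>C\<^esub> e
     \<and> (\<forall>X u. u \<in> homset C X (Dom C f) \<and> f \<cdot>\<^bsub>C\<^esub> u = g \<cdot>\<^bsub>C\<^esub> u
          \<longrightarrow> (\<exists>!h. h \<in> homset C X (Dom C e) \<and> e \<cdot>\<^bsub>C\<^esub> h = u))"

text \<open>The \<open>n\<close>-fold pullback power of \<open>q : E \<rightarrow> M\<close>, with structure map \<open>r\<close> to \<open>M\<close> and
  projections \<open>e i\<close> for \<open>i < n\<close>.\<close>

definition is_pullback_power ::
    "('o, 'a, 'm) category_data_scheme \<Rightarrow> 'a \<Rightarrow> nat \<Rightarrow> 'a \<Rightarrow> (nat \<Rightarrow> 'a) \<Rightarrow> bool" where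
  "is_pullback_power C q n r e \<longleftrightarrow>
     q \<in> Arr C \<and> r \<in> Arr C \<and> Cod C r = Cod C q
     \<and> (\<forall>i<n. e i \<in> homset C (Dom C r) (Dom C q) \<and> q \<cdot>\<^bsub>C\<^esub> e i = r)
     \<and> (\<forall>X s u. s \<in> homset C X (Cod C q)
            \<and> (\<forall>i<n. u i \<in> homset C X (Dom C q) \<and> q \<cdot>\<^bsub>C\<^esub> u i = s)
          \<longrightarrow> (\<exists>!h. h \<in> homset C X (Dom C r) \<and> r \<cdot>\<^bsub>C\<^esub> h = s \<and> (\<forall>i<n. e i \<cdot>\<^bsub>C\<^esub> h = u i)))"


section \<open>Additive bundles\<close>

text \<open>An additive bundle \<open>q : E \<rightarrow> M\<close> comes with a pullback of \<open>q\<close> along itself, given by its two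
  projections \<open>bfst\<close> and \<open>bsnd\<close>; the addition is an arrow from the apex of this pullback to \<open>E\<close>.\<close>

record 'a additive_bundle_data =
  bproj :: 'a
  bzero :: 'a
  bfst :: 'a
  bsnd :: 'a
  badd :: 'a

definition bplus ::
    "('o, 'a, 'm) category_data_scheme \<Rightarrow> ('a, 'b) additive_bundle_data_scheme \<Rightarrow> 'a \<Rightarrow> 'a \<Rightarrow> 'a" where
  "bplus C B u v = badd B \<cdot>\<^bsub>C\<^esub> pair_arr C (bfst B) (bsnd B) u v"

text \<open>Commutative monoids in the slice over \<open>M\<close>, with the monoid laws read on generalised elements.\<close>

locale additive_bundle = category C
  for C :: "('o, 'a, 'm) category_data_scheme" (structure) +
  fixes B :: "('a, 'b) additive_bundle_data_scheme"
  assumes bundle_pullback: "is_pullback C (bproj B) (bproj B) (bfst B) (bsnd B)"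
    and bzero_hom: "bzero B \<in> homset C (Cod C (bproj B)) (Dom C (bproj B))"
    and bproj_bzero: "bproj B \<cdot> bzero B = Idn C (Cod C (bproj B))"
    and badd_hom: "badd B \<in> homset C (Dom C (bfst B)) (Dom C (bproj B))"
    and bproj_badd: "bproj B \<cdot> badd B = bproj B \<cdot> bfst B"
    and bplus_zero: "u \<in> homset C X (Dom C (bproj B))
      \<Longrightarrow> bplus C B u (bzero B \<cdot> bproj B \<cdot> u) = u"
    and bplus_comm: "\<lbrakk>u \<in> homset C X (Dom C (bproj B)); v \<in> homset C X (Dom C (bproj B));
        bproj B \<cdot> u = bproj B \<cdot> v\<rbrakk>
      \<Longrightarrow> bplus C B u v = bplus C B v u"
    and bplus_assoc: "\<lbrakk>u \<in> homset C X (Dom C (bproj B)); v \<in> homset C X (Dom C (bproj B));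
        w \<in> homset C X (Dom C (bproj B)); bproj B \<cdot> u = bproj B \<cdot> v; bproj B \<cdot> v = bproj B \<cdot> w\<rbrakk>
      \<Longrightarrow> bplus C B (bplus C B u v) w = bplus C B u (bplus C B v w)"

definition is_negation ::
    "('o, 'a, 'm) category_data_scheme \<Rightarrow> ('a, 'b) additive_bundle_data_scheme \<Rightarrow> 'a \<Rightarrow> bool" where
  "is_negation C B n \<longleftrightarrow>
     n \<in> homset C (Dom C (bproj B)) (Dom C (bproj B)) \<and> bproj B \<cdot>\<^bsub>C\<^esub> n = bproj B
     \<and> bplus C B (Idn C (Dom C (bproj B))) n = bzero B \<cdot>\<^bsub>C\<^esub> bproj B"

definition bneg ::
    "('o, 'a, 'm) category_data_scheme \<Rightarrow> ('a, 'b) additive_bundle_data_scheme \<Rightarrow> 'a" where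
  "bneg C B = (THE n. is_negation C B n)"

definition bminus ::
    "('o, 'a, 'm) category_data_scheme \<Rightarrow> ('a, 'b) additive_bundle_data_scheme \<Rightarrow> 'a \<Rightarrow> 'a \<Rightarrow> 'a" where
  "bminus C B u v = bplus C B u (bneg C B \<cdot>\<^bsub>C\<^esub> v)"

definition additive_bundle_morphism ::
    "('o, 'a, 'm) category_data_scheme \<Rightarrow> ('a, 'b) additive_bundle_data_scheme
      \<Rightarrow> ('a, 'c) additive_bundle_data_scheme \<Rightarrow> 'a \<Rightarrow> 'a \<Rightarrow> bool" where
  "additive_bundle_morphism C B B' f1 f0 \<longleftrightarrow>
     f1 \<in> homset C (Dom C (bproj B)) (Dom C (bproj B'))
     \<and> f0 \<in> homset C (Cod C (bproj B)) (Cod C (bproj B'))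
     \<and> bproj B' \<cdot>\<^bsub>C\<^esub> f1 = f0 \<cdot>\<^bsub>C\<^esub> bproj B
     \<and> f1 \<cdot>\<^bsub>C\<^esub> bzero B = bzero B' \<cdot>\<^bsub>C\<^esub> f0
     \<and> f1 \<cdot>\<^bsub>C\<^esub> badd B = bplus C B' (f1 \<cdot>\<^bsub>C\<^esub> bfst B) (f1 \<cdot>\<^bsub>C\<^esub> bsnd B)"


section \<open>Tangent categories\<close>

text \<open>\<open>TO\<close> and \<open>TA\<close> are the object and arrow parts of the endofunctor \<open>T\<close>; \<open>tfst M\<close> and \<open>tsnd M\<close>
  are the projections of the pullback of \<open>p\<close> along itself on which \<open>tadd M\<close> is defined.\<close>

record ('o, 'a) tangent_data = "('o, 'a) category_data" +
  TO :: "'o \<Rightarrow> 'o"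
  TA :: "'a \<Rightarrow> 'a"
  tproj :: "'o \<Rightarrow> 'a"
  tzero :: "'o \<Rightarrow> 'a"
  tfst :: "'o \<Rightarrow> 'a"
  tsnd :: "'o \<Rightarrow> 'a"
  tadd :: "'o \<Rightarrow> 'a"
  tlift :: "'o \<Rightarrow> 'a"
  tflip :: "'o \<Rightarrow> 'a"

definition tangent_bundle :: "('o, 'a) tangent_data \<Rightarrow> 'o \<Rightarrow> 'a additive_bundle_data" where
  "tangent_bundle C M =
     \<lparr>bproj = tproj C M, bzero = tzero C M, bfst = tfst C M, bsnd = tsnd C M, badd = tadd C M\<rparr>"

definition T_bundle ::
    "('o, 'a) tangent_data \<Rightarrow> ('a, 'b) additive_bundle_data_scheme \<Rightarrow> 'a additive_bundle_data" where
  "T_bundle C B =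
     \<lparr>bproj = TA C (bproj B), bzero = TA C (bzero B), bfst = TA C (bfst B), bsnd = TA C (bsnd B),
      badd = TA C (badd B)\<rparr>"

text \<open>Preservation by \<open>T\<close> is required of the limits obtained by applying \<open>T\<close> as well, that is,
  limits are preserved by all iterates of \<open>T\<close>.\<close>

definition pullback_preserved :: "('o, 'a) tangent_data \<Rightarrow> 'a \<Rightarrow> 'a \<Rightarrow> 'a \<Rightarrow> 'a \<Rightarrow> bool" where
  "pullback_preserved C f g a b \<longleftrightarrow>
     (\<forall>k. is_pullback C ((TA C ^^ k) f) ((TA C ^^ k) g) ((TA C ^^ k) a) ((TA C ^^ k) b))"

definition equaliser_preserved :: "('o, 'a) tangent_data \<Rightarrow> 'a \<Rightarrow> 'a \<Rightarrow> 'a \<Rightarrow> bool" where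
  "equaliser_preserved C f g e \<longleftrightarrow>
     (\<forall>k. is_equaliser C ((TA C ^^ k) f) ((TA C ^^ k) g) ((TA C ^^ k) e))"

definition pullback_powers_preserved :: "('o, 'a) tangent_data \<Rightarrow> 'a \<Rightarrow> bool" where
  "pullback_powers_preserved C q \<longleftrightarrow>
     (\<forall>n. (\<exists>r e. is_pullback_power C q n r e)
        \<and> (\<forall>r e. is_pullback_power C q n r e \<longrightarrow>
             (\<forall>k. is_pullback_power C ((TA C ^^ k) q) n ((TA C ^^ k) r) (\<lambda>i. (TA C ^^ k) (e i)))))"

text \<open>The arrow \<open>\<mu>(a, b) = T(+)(0b, la)\<close>.\<close>

definition tangent_mu :: "('o, 'a) tangent_data \<Rightarrow> 'o \<Rightarrow> 'a" where
  "tangent_mu C M = bplus C (T_bundle C (tangent_bundle C M))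
     (tzero C (TO C M) \<cdot>\<^bsub>C\<^esub> tsnd C M) (tlift C M \<cdot>\<^bsub>C\<^esub> tfst C M)"

locale tangent_category = category C for C :: "('o, 'a) tangent_data" (structure) +
  assumes TO_obj: "M \<in> Obj C \<Longrightarrow> TO C M \<in> Obj C"
    and TA_hom: "f \<in> homset C M N \<Longrightarrow> TA C f \<in> homset C (TO C M) (TO C N)"
    and TA_idn: "M \<in> Obj C \<Longrightarrow> TA C (Idn C M) = Idn C (TO C M)"
    and TA_comp: "\<lbrakk>f \<in> homset C X Y; g \<in> homset C Y Z\<rbrakk> \<Longrightarrow> TA C (g \<cdot> f) = TA C g \<cdot> TA C f"
    and tproj_hom: "M \<in> Obj C \<Longrightarrow> tproj C M \<in> homset C (TO C M) M"
    and tproj_nat: "f \<in> homset C M N \<Longrightarrow> tproj C N \<cdot> TA C f = f \<cdot> tproj C M"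
    and tzero_hom: "M \<in> Obj C \<Longrightarrow> tzero C M \<in> homset C M (TO C M)"
    and tzero_nat: "f \<in> homset C M N \<Longrightarrow> tzero C N \<cdot> f = TA C f \<cdot> tzero C M"
    and tadd_nat: "f \<in> homset C M N \<Longrightarrow>
      bplus C (tangent_bundle C N) (TA C f \<cdot> tfst C M) (TA C f \<cdot> tsnd C M) = TA C f \<cdot> tadd C M"
    and tlift_hom: "M \<in> Obj C \<Longrightarrow> tlift C M \<in> homset C (TO C M) (TO C (TO C M))"
    and tlift_nat: "f \<in> homset C M N \<Longrightarrow> tlift C N \<cdot> TA C f = TA C (TA C f) \<cdot> tlift C M"
    and tflip_hom: "M \<in> Obj C \<Longrightarrow> tflip C M \<in> homset C (TO C (TO C M)) (TO C (TO C M))"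
    and tflip_nat: "f \<in> homset C M N \<Longrightarrow>
      tflip C N \<cdot> TA C (TA C f) = TA C (TA C f) \<cdot> tflip C M"
    and tangent_powers: "M \<in> Obj C \<Longrightarrow> pullback_powers_preserved C (tproj C M)"
    and tangent_additive: "M \<in> Obj C \<Longrightarrow> additive_bundle C (tangent_bundle C M)"
    and tlift_additive: "M \<in> Obj C \<Longrightarrow>
      additive_bundle_morphism C (tangent_bundle C M) (T_bundle C (tangent_bundle C M))
        (tlift C M) (tzero C M)"
    and tflip_additive: "M \<in> Obj C \<Longrightarrow>
      additive_bundle_morphism C (T_bundle C (tangent_bundle C M)) (tangent_bundle C (TO C M))
        (tflip C M) (Idn C (TO C M))"
    and tflip_tflip: "M \<in> Obj C \<Longrightarrow> tflip C M \<cdot> tflip C M = Idn C (TO C (TO C M))"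
    and tflip_braid: "M \<in> Obj C \<Longrightarrow>
      TA C (tflip C M) \<cdot> tflip C (TO C M) \<cdot> TA C (tflip C M)
        = tflip C (TO C M) \<cdot> TA C (tflip C M) \<cdot> tflip C (TO C M)"
    and tflip_tlift: "M \<in> Obj C \<Longrightarrow> tflip C M \<cdot> tlift C M = tlift C M"
    and tlift_tlift: "M \<in> Obj C \<Longrightarrow>
      TA C (tlift C M) \<cdot> tlift C M = tlift C (TO C M) \<cdot> tlift C M"
    and tflip_T_tflip_tlift: "M \<in> Obj C \<Longrightarrow>
      tflip C (TO C M) \<cdot> TA C (tflip C M) \<cdot> tlift C (TO C M) = TA C (tlift C M) \<cdot> tflip C M"
    and tangent_mu_equaliser: "M \<in> Obj C \<Longrightarrow>
      equaliser_preserved C (TA C (tproj C M)) (tzero C M \<cdot> tproj C M \<cdot> tproj C (TO C M))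
        (tangent_mu C M)"


section \<open>Differential bundles\<close>

record 'a differential_bundle_data = "'a additive_bundle_data" +
  blift :: 'a

text \<open>The arrow \<open>\<mu>(a, b) = T(+\<^sub>q)(0a, \<lambda>b)\<close>; the order of the arguments is opposite to that
  of \<^const>\<open>tangent_mu\<close>.\<close>

definition bundle_mu :: "('o, 'a) tangent_data \<Rightarrow> 'a differential_bundle_data \<Rightarrow> 'a" where
  "bundle_mu C B = bplus C (T_bundle C B)
     (tzero C (Dom C (bproj B)) \<cdot>\<^bsub>C\<^esub> bfst B) (blift B \<cdot>\<^bsub>C\<^esub> bsnd B)"

locale differential_bundle = tangent_category C + additive_bundle C B
  for C :: "('o, 'a) tangent_data" (structure) and B :: "'a differential_bundle_data" +
  assumes bundle_powers: "pullback_powers_preserved C (bproj B)"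
    and blift_hom: "blift B \<in> homset C (Dom C (bproj B)) (TO C (Dom C (bproj B)))"
    and blift_zero_additive:
      "additive_bundle_morphism C B (T_bundle C B) (blift B) (tzero C (Cod C (bproj B)))"
    and blift_bzero_additive:
      "additive_bundle_morphism C B (tangent_bundle C (Dom C (bproj B))) (blift B) (bzero B)"
    and blift_blift: "TA C (blift B) \<cdot> blift B = tlift C (Dom C (bproj B)) \<cdot> blift B"
    and bundle_mu_equaliser:
      "equaliser_preserved C (TA C (bproj B))
         (tzero C (Cod C (bproj B)) \<cdot> bproj B \<cdot> tproj C (Dom C (bproj B))) (bundle_mu C B)"

text \<open>A linear morphism \<open>(f1, f0)\<close> from \<open>q\<close> with lift \<open>l\<close> to \<open>q'\<close> with lift \<open>l'\<close>; linearity only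
  involves the projections and the lifts of the two differential bundles.\<close>

definition linear_bundle_morphism ::
    "('o, 'a) tangent_data \<Rightarrow> 'a \<Rightarrow> 'a \<Rightarrow> 'a \<Rightarrow> 'a \<Rightarrow> 'a \<Rightarrow> 'a \<Rightarrow> bool" where
  "linear_bundle_morphism C q l q' l' f1 f0 \<longleftrightarrow>
     f1 \<in> homset C (Dom C q) (Dom C q') \<and> f0 \<in> homset C (Cod C q) (Cod C q')
     \<and> q' \<cdot>\<^bsub>C\<^esub> f1 = f0 \<cdot>\<^bsub>C\<^esub> q \<and> TA C f1 \<cdot>\<^bsub>C\<^esub> l = l' \<cdot>\<^bsub>C\<^esub> f1"

text \<open>Negatives: the additive bundles of the theory, namely the tangent bundles and the differential
  bundles, are commutative groups in the slice.\<close>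

locale tangent_category_with_negatives = tangent_category C
  for C :: "('o, 'a) tangent_data" (structure) +
  assumes tangent_negatives: "M \<in> Obj C \<Longrightarrow> \<exists>n. is_negation C (tangent_bundle C M) n"
    and bundle_negatives: "differential_bundle C B \<Longrightarrow> \<exists>n. is_negation C B n"


section \<open>Involution algebroids\<close>

locale anchored_bundle = differential_bundle C A
  for C :: "('o, 'a) tangent_data" (structure) and A :: "'a differential_bundle_data" +
  fixes \<rho> :: 'a
  assumes anchor_linear:
    "linear_bundle_morphism C (bproj A) (blift A)
       (tproj C (Cod C (bproj A))) (tlift C (Cod C (bproj A))) \<rho> (Idn C (Cod C (bproj A)))"

text \<open>The prolongation \<open>P\<close> is given by its projections \<open>\<pi>0 : P \<rightarrow> A\<close> and \<open>\<pi>1 : P \<rightarrow> T(A)\<close>. Its two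
  lifts \<open>P \<rightarrow> T(P)\<close> are \<open>0 \<times> cT(\<lambda>)\<close> over \<open>\<pi>0\<close> and \<open>\<lambda> \<times> l\<close> over \<open>p\<pi>1\<close>.\<close>

definition prol_lift0 ::
    "('o, 'a) tangent_data \<Rightarrow> 'a differential_bundle_data \<Rightarrow> 'a \<Rightarrow> 'a \<Rightarrow> 'a" where
  "prol_lift0 C A \<pi>0 \<pi>1 = pair_arr C (TA C \<pi>0) (TA C \<pi>1)
     (tzero C (Dom C (bproj A)) \<cdot>\<^bsub>C\<^esub> \<pi>0)
     (tflip C (Dom C (bproj A)) \<cdot>\<^bsub>C\<^esub> TA C (blift A) \<cdot>\<^bsub>C\<^esub> \<pi>1)"

definition prol_lift1 ::
    "('o, 'a) tangent_data \<Rightarrow> 'a differential_bundle_data \<Rightarrow> 'a \<Rightarrow> 'a \<Rightarrow> 'a" where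
  "prol_lift1 C A \<pi>0 \<pi>1 = pair_arr C (TA C \<pi>0) (TA C \<pi>1)
     (blift A \<cdot>\<^bsub>C\<^esub> \<pi>0) (tlift C (Dom C (bproj A)) \<cdot>\<^bsub>C\<^esub> \<pi>1)"

locale involution_algebroid = anchored_bundle C A \<rho>
  for C :: "('o, 'a) tangent_data" (structure) and A :: "'a differential_bundle_data" and \<rho> :: 'a +
  fixes \<pi>0 \<pi>1 \<alpha> :: 'a
  assumes prolongation: "pullback_preserved C \<rho> (TA C (bproj A)) \<pi>0 \<pi>1"
    and involution_hom: "\<alpha> \<in> homset C (Dom C \<pi>0) (TO C (Dom C (bproj A)))"
    and involution_linear0:
      "linear_bundle_morphism C \<pi>0 (prol_lift0 C A \<pi>0 \<pi>1)
         (tproj C (Dom C (bproj A))) (tlift C (Dom C (bproj A))) \<alpha> (Idn C (Dom C (bproj A)))"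
    and involution_linear1:
      "linear_bundle_morphism C (tproj C (Dom C (bproj A)) \<cdot> \<pi>1) (prol_lift1 C A \<pi>0 \<pi>1)
         (TA C (bproj A)) (tflip C (Dom C (bproj A)) \<cdot> TA C (blift A)) \<alpha> \<rho>"
    and involution_anchor: "TA C \<rho> \<cdot> \<alpha> = tflip C (Cod C (bproj A)) \<cdot> TA C \<rho> \<cdot> \<pi>1"
    and involution_unit: "\<alpha> \<cdot> pair_arr C \<pi>0 \<pi>1 (bzero A \<cdot> bproj A) (blift A) = blift A"
    and involution_involutive:
      "\<alpha> \<cdot> pair_arr C \<pi>0 \<pi>1 (tproj C (Dom C (bproj A)) \<cdot> \<pi>1) \<alpha> = \<pi>1"
    and involution_flip:
      "\<lbrakk>v \<in> homset C X (Dom C (bproj A)); w \<in> homset C X (TO C (Dom C (bproj A)));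
        x \<in> homset C X (TO C (TO C (Dom C (bproj A))));
        \<rho> \<cdot> v = TA C (bproj A) \<cdot> w;
        tflip C (Cod C (bproj A)) \<cdot> TA C (TA C (bproj A)) \<cdot> x = TA C \<rho> \<cdot> w\<rbrakk> \<Longrightarrow>
       TA C \<alpha> \<cdot> pair_arr C (TA C \<pi>0) (TA C \<pi>1) (\<alpha> \<cdot> pair_arr C \<pi>0 \<pi>1 v w) x
       = tflip C (Dom C (bproj A)) \<cdot> TA C \<alpha> \<cdot> pair_arr C (TA C \<pi>0) (TA C \<pi>1)
           (\<alpha> \<cdot> pair_arr C \<pi>0 \<pi>1 v (tproj C (TO C (Dom C (bproj A))) \<cdot> x))
           (tflip C (Dom C (bproj A)) \<cdot> TA C \<alpha> \<cdot> pair_arr C (TA C \<pi>0) (TA C \<pi>1)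
              w (tflip C (Dom C (bproj A)) \<cdot> x))"


section \<open>Sections and the bracket\<close>

definition bundle_sections ::
    "('o, 'a, 'm) category_data_scheme \<Rightarrow> ('a, 'b) additive_bundle_data_scheme \<Rightarrow> 'a set" where
  "bundle_sections C B =
     {X \<in> homset C (Cod C (bproj B)) (Dom C (bproj B)). bproj B \<cdot>\<^bsub>C\<^esub> X = Idn C (Cod C (bproj B))}"

text \<open>The abelian group of sections, written multiplicatively as is usual for \<^const>\<open>comm_group\<close>:
  its operation is the fibrewise addition and its unit is the zero section.\<close>

definition section_group ::
    "('o, 'a, 'm) category_data_scheme \<Rightarrow> ('a, 'b) additive_bundle_data_scheme \<Rightarrow> 'a monoid" where
  "section_group C B =
     \<lparr>carrier = bundle_sections C B, mult = bplus C B, one = bzero B\<rparr>"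

definition bracket_difference ::
    "('o, 'a) tangent_data \<Rightarrow> 'a differential_bundle_data \<Rightarrow> 'a \<Rightarrow> 'a \<Rightarrow> 'a \<Rightarrow> 'a \<Rightarrow> 'a \<Rightarrow> 'a \<Rightarrow> 'a" where
  "bracket_difference C A \<rho> \<pi>0 \<pi>1 \<alpha> X Y =
     bminus C (T_bundle C A)
       (bminus C (tangent_bundle C (Dom C (bproj A)))
          (\<alpha> \<cdot>\<^bsub>C\<^esub> pair_arr C \<pi>0 \<pi>1 X (TA C Y \<cdot>\<^bsub>C\<^esub> \<rho> \<cdot>\<^bsub>C\<^esub> X))
          (TA C X \<cdot>\<^bsub>C\<^esub> \<rho> \<cdot>\<^bsub>C\<^esub> Y))
       (tzero C (Dom C (bproj A)) \<cdot>\<^bsub>C\<^esub> X)"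

definition algebroid_bracket ::
    "('o, 'a) tangent_data \<Rightarrow> 'a differential_bundle_data \<Rightarrow> 'a \<Rightarrow> 'a \<Rightarrow> 'a \<Rightarrow> 'a \<Rightarrow> 'a \<Rightarrow> 'a \<Rightarrow> 'a" where
  "algebroid_bracket C A \<rho> \<pi>0 \<pi>1 \<alpha> X Y =
     (THE Z. Z \<in> bundle_sections C A
        \<and> blift A \<cdot>\<^bsub>C\<^esub> Z = bracket_difference C A \<rho> \<pi>0 \<pi>1 \<alpha> X Y)"

locale lie_bracket = comm_group G for G (structure) +
  fixes br :: "'a \<Rightarrow> 'a \<Rightarrow> 'a"
  assumes bracket_closed: "\<lbrakk>x \<in> carrier G; y \<in> carrier G\<rbrakk> \<Longrightarrow> br x y \<in> carrier G"
    and bracket_add_left: "\<lbrakk>x \<in> carrier G; y \<in> carrier G; z \<in> carrier G\<rbrakk>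
      \<Longrightarrow> br (x \<otimes> y) z = br x z \<otimes> br y z"
    and bracket_add_right: "\<lbrakk>x \<in> carrier G; y \<in> carrier G; z \<in> carrier G\<rbrakk>
      \<Longrightarrow> br x (y \<otimes> z) = br x y \<otimes> br x z"
    and bracket_antisym: "\<lbrakk>x \<in> carrier G; y \<in> carrier G\<rbrakk> \<Longrightarrow> br x y = inv (br y x)"
    and bracket_jacobi: "\<lbrakk>x \<in> carrier G; y \<in> carrier G; z \<in> carrier G\<rbrakk>
      \<Longrightarrow> br x (br y z) \<otimes> br z (br x y) \<otimes> br y (br z x) = \<one>"

end

theory Submission
  imports Defs
begin

text \<open>
  The proof treats sections as infinitesimal flows and obtains the Lie identities from the way these
  flows compose. Write \<open>T\<close> for the tangent functor, \<open>\<lambda>\<close> for the lift of \<open>A\<close>, and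
  \<open>\<mu>(a, b) = T(+)(0a, \<lambda>b)\<close>.

  Every section \<open>X\<close> has a \<^emph>\<open>complete lift\<close> \<open>X\<^sup>c(a) = \<alpha>(a, T(X)\<rho>a)\<close>, a linear vector field on \<open>A\<close>.
  In terms of it the definition of the bracket becomes
  \<open>Y\<^sup>c X = T(X)\<rho>Y +\<^sub>p \<mu>(X, [X, Y])\<close> (\<open>bracket_eq\<close>), and existence and uniqueness of the bracket are
  the universal property of \<open>\<mu>\<close>. Since \<open>\<alpha>\<close> is linear for both bundle structures of the prolongation and lifts
  are monic, \<open>\<alpha>\<close> is additive for both (\<open>al_plus0\<close>, \<open>al_plus1\<close>). This gives biadditivity of the bracket.
  Antisymmetry follows by applying the involution law \<open>\<alpha>(p\<pi>\<^sub>1, \<alpha>) = \<pi>\<^sub>1\<close> to the pair \<open>(X, T(Y)\<rho>X)\<close>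
  (\<open>bracket_antisymmetric\<close>).

  For the Jacobi identity, a vector field \<open>V\<close> on an object \<open>E\<close> acts on \<open>T\<^sup>2(E)\<close> by two maps: the
  inner flow, which is \<open>T\<close> of the translation \<open>v \<mapsto> v +\<^sub>p V p v\<close> of \<open>T(E)\<close>, and its conjugate by
  \<open>c\<close>, the outer flow. They play the role of the flows \<open>1 + \<epsilon>\<^sub>1 V\<close> and
  \<open>1 + \<epsilon>\<^sub>2 V\<close>. An inner flow of \<open>V\<close> and an outer flow of \<open>W\<close> commute up to a core flow
  \<open>1 + \<epsilon>\<^sub>1\<epsilon>\<^sub>2 U\<close>, where \<open>U\<close> measures the failure of \<open>T(V)W = c T(W)V\<close>
  (\<open>inner_outer\<close>). Similarly a flow of \<open>V\<close> and \<open>T\<^sup>2(f)\<close>, for an endomorphism \<open>f\<close> of \<open>E\<close>, commute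
  up to a flow of the field by which \<open>f\<close> fails to preserve \<open>V\<close>. Rewriting the composite of an inner flow, an
  outer flow and \<open>T\<^sup>2(f)\<close> in the two possible ways and cancelling yields an identity between the correction
  terms, as for the commutators of three elements of a group (\<open>vector_field_jacobi\<close>).

  The identity is used on \<open>E = A\<close> for the complete lifts of \<open>X\<close> and \<open>Y\<close> and for
  the translation \<open>a \<mapsto> a + Z\<pi>a\<close>, which is the flow at time one of the vertical lift of \<open>Z\<close>.
  The correction terms are then complete and vertical lifts of brackets: \<open>has_commutator_complete_lift\<close> (this
  is the flip equation for \<open>\<alpha>\<close>), \<open>has_commutator_vertical_lift\<close> and \<open>has_defect_complete_lift\<close>.
  The result is \<open>[[Z, X], Y] + [Z, [Y, X]] = [[Z, Y], X]\<close> (\<open>bracket_leibniz\<close>), which with antisymmetry is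
  the Jacobi identity.\<close>

context category
begin

section \<open>Generalised elements\<close>

text \<open>\<open>el u Y\<close>: the arrow \<open>u\<close> is a generalised element of \<open>Y\<close>, at the stage \<open>Dom C u\<close>. Unlike
  membership in a hom-set, this judgement does not mention the stage, so that the typing rules below
  are conditional rewrite rules without extra variables. Equations between arrows are proved in the
  form \<open>f \<cdot> u = g \<cdot> u\<close> with composites bracketed to the right.\<close>

definition el :: "'a \<Rightarrow> 'o \<Rightarrow> bool" where
  "el u Y \<longleftrightarrow> u \<in> Arr C \<and> Cod C u = Y"

text \<open>The fibrewise sum of two generalised elements in the additive bundle \<open>B\<close>.\<close>

abbreviation fibre_plus :: "'a \<Rightarrow> ('a, 'b) additive_bundle_data_scheme \<Rightarrow> 'a \<Rightarrow> 'a"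
    ("(_ +[_] _)" [66, 0, 65] 65) where
  "u +[B] v \<equiv> bplus C B u v"

text \<open>Total object and base object of a bundle.\<close>

abbreviation (input) "tot B \<equiv> Dom C (bproj B)"

abbreviation (input) "base B \<equiv> Cod C (bproj B)"

lemma el_arr: "u \<in> Arr C \<Longrightarrow> el u (Cod C u)"
  by (simp add: el_def)

lemma homset_iff: "u \<in> homset C X Y \<longleftrightarrow> el u Y \<and> Dom C u = X"
  by (auto simp: homset_def el_def)

lemma el_comp [simp]: "\<lbrakk>f \<in> Arr C; Cod C f = Y; el u (Dom C f)\<rbrakk> \<Longrightarrow> el (f \<cdot> u) Y"
  and dom_comp [simp]: "\<lbrakk>f \<in> Arr C; el u (Dom C f)\<rbrakk> \<Longrightarrow> Dom C (f \<cdot> u) = Dom C u"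
  and arr_comp [simp]: "\<lbrakk>f \<in> Arr C; el u (Dom C f)\<rbrakk> \<Longrightarrow> f \<cdot> u \<in> Arr C"
  and cod_comp [simp]: "\<lbrakk>f \<in> Arr C; el u (Dom C f)\<rbrakk> \<Longrightarrow> Cod C (f \<cdot> u) = Cod C f"
  using comp_hom[of u "Dom C u" "Dom C f" f "Cod C f"] by (auto simp: homset_def el_def)

lemma comp_comp [simp]:
  "\<lbrakk>f \<in> Arr C; g \<in> Arr C; Dom C g = Cod C f; el u (Dom C f)\<rbrakk> \<Longrightarrow> (g \<cdot> f) \<cdot> u = g \<cdot> (f \<cdot> u)"
  using comp_assoc[of u "Dom C u" "Dom C f" f "Cod C f" g "Cod C g"]
  by (auto simp: homset_def el_def)

lemma idn_arr [simp]: "X \<in> Obj C \<Longrightarrow> Idn C X \<in> Arr C"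
  and idn_dom [simp]: "X \<in> Obj C \<Longrightarrow> Dom C (Idn C X) = X"
  and idn_cod [simp]: "X \<in> Obj C \<Longrightarrow> Cod C (Idn C X) = X"
  and idn_el [simp]: "X \<in> Obj C \<Longrightarrow> el (Idn C X) X"
  using idn_hom[of X] by (auto simp: homset_def el_def)

lemma idn_comp [simp]: "el u X \<Longrightarrow> Idn C X \<cdot> u = u"
  using comp_idn_left by (auto simp: el_def)

lemma comp_idn [simp]: "\<lbrakk>u \<in> Arr C; Dom C u = X\<rbrakk> \<Longrightarrow> u \<cdot> Idn C X = u"
  using comp_idn_right by auto

lemma el_obj: "el u Y \<Longrightarrow> Y \<in> Obj C" and el_dom_obj: "el u Y \<Longrightarrow> Dom C u \<in> Obj C"
  using cod_obj dom_obj by (auto simp: el_def)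

text \<open>A commuting square of arrows, applied to a generalised element.\<close>

lemma comp_square:
  assumes "f \<cdot> a = g \<cdot> b" "f \<in> Arr C" "a \<in> Arr C" "g \<in> Arr C" "b \<in> Arr C"
    "Cod C a = Dom C f" "Cod C b = Dom C g" "el u (Dom C a)" "el u (Dom C b)"
  shows "f \<cdot> (a \<cdot> u) = g \<cdot> (b \<cdot> u)"
  using comp_comp[of a f u] comp_comp[of b g u] assms by metis

section \<open>Pullbacks\<close>

lemma pullback_pair:
  assumes "is_pullback C f g a b" "el u (Dom C f)" "el v (Dom C g)" "Dom C u = Dom C v"
    "f \<cdot> u = g \<cdot> v"
  shows pair_el: "el (pair_arr C a b u v) (Dom C a)"
    and pair_dom: "Dom C (pair_arr C a b u v) = Dom C u"
    and pair_fst: "a \<cdot> pair_arr C a b u v = u"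
    and pair_snd: "b \<cdot> pair_arr C a b u v = v"
proof -
  have "u \<in> homset C (Dom C u) (Dom C f) \<and> v \<in> homset C (Dom C u) (Dom C g) \<and> f \<cdot> u = g \<cdot> v"
    using assms(2-5) by (simp add: homset_iff)
  then have "\<exists>!h. h \<in> homset C (Dom C u) (Dom C a) \<and> a \<cdot> h = u \<and> b \<cdot> h = v"
    using assms(1) unfolding is_pullback_def by blast
  from theI'[OF this, folded pair_arr_def]
  show "el (pair_arr C a b u v) (Dom C a)" "Dom C (pair_arr C a b u v) = Dom C u"
    "a \<cdot> pair_arr C a b u v = u" "b \<cdot> pair_arr C a b u v = v"
    by (simp_all add: homset_iff)
qed

lemma pullback_eqI:
  assumes "is_pullback C f g a b" "el h (Dom C a)" "el k (Dom C a)" "Dom C h = Dom C k"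
    "a \<cdot> h = a \<cdot> k" "b \<cdot> h = b \<cdot> k"
  shows "h = k"
proof -
  note pb = assms(1)[unfolded is_pullback_def]
  have ty: "f \<in> Arr C" "g \<in> Arr C" "a \<in> Arr C" "b \<in> Arr C" "Cod C a = Dom C f"
    "Cod C b = Dom C g" "Dom C a = Dom C b" "f \<cdot> a = g \<cdot> b"
    using pb by auto
  have sq: "f \<cdot> (a \<cdot> h) = g \<cdot> (b \<cdot> h)"
    by (rule comp_square) (use assms(2) ty in simp_all)
  have "a \<cdot> h \<in> homset C (Dom C h) (Dom C f) \<and> b \<cdot> h \<in> homset C (Dom C h) (Dom C g)
      \<and> f \<cdot> (a \<cdot> h) = g \<cdot> (b \<cdot> h)"
    using assms(2) ty sq by (simp add: homset_iff)
  then have "\<exists>!x. x \<in> homset C (Dom C h) (Dom C a) \<and> a \<cdot> x = a \<cdot> h \<and> b \<cdot> x = b \<cdot> h"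
    using pb by blast
  then show ?thesis
    using assms(2-6) unfolding homset_iff by metis
qed

lemma pullback_arr:
  assumes "is_pullback C f g a b"
  shows "f \<in> Arr C" "g \<in> Arr C" "a \<in> Arr C" "b \<in> Arr C" "Cod C a = Dom C f"
    "Cod C b = Dom C g" "Dom C b = Dom C a" "f \<cdot> a = g \<cdot> b" "Cod C f = Cod C g"
  using assms[unfolded is_pullback_def] by auto

lemma pullback_square:
  assumes "is_pullback C f g a b" "el h (Dom C a)"
  shows "f \<cdot> (a \<cdot> h) = g \<cdot> (b \<cdot> h)"
proof -
  note ty = pullback_arr[OF assms(1)]
  show ?thesis by (rule comp_square) (use assms(2) ty in simp_all)
qed

lemma pair_comp:
  assumes "is_pullback C f g a b" "el u (Dom C f)" "el v (Dom C g)" "Dom C u = Dom C v"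
    "f \<cdot> u = g \<cdot> v" "el t (Dom C u)"
  shows "pair_arr C a b u v \<cdot> t = pair_arr C a b (u \<cdot> t) (v \<cdot> t)"
proof -
  note ty = pullback_arr[OF assms(1)]
  note p = pullback_pair[OF assms(1-5)]
  have uv: "u \<in> Arr C" "v \<in> Arr C" "Cod C u = Dom C f" "Cod C v = Dom C g"
    using assms(2,3) by (auto simp: el_def)
  have pa: "pair_arr C a b u v \<in> Arr C" "Cod C (pair_arr C a b u v) = Dom C a"
    using p(1) by (auto simp: el_def)
  have sq: "f \<cdot> (u \<cdot> t) = g \<cdot> (v \<cdot> t)"
    by (rule comp_square) (use uv ty assms in simp_all)
  have q: "el (u \<cdot> t) (Dom C f)" "el (v \<cdot> t) (Dom C g)" "Dom C (u \<cdot> t) = Dom C (v \<cdot> t)"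
    using uv assms by auto
  note r = pullback_pair[OF assms(1) q sq]
  have "a \<cdot> (pair_arr C a b u v \<cdot> t) = (a \<cdot> pair_arr C a b u v) \<cdot> t"
    "b \<cdot> (pair_arr C a b u v \<cdot> t) = (b \<cdot> pair_arr C a b u v) \<cdot> t"
    using ty(1-7) pa p(2) assms(6) by simp_all
  then have eq: "a \<cdot> (pair_arr C a b u v \<cdot> t) = u \<cdot> t" "b \<cdot> (pair_arr C a b u v \<cdot> t) = v \<cdot> t"
    using p by simp_all
  show ?thesis
    by (rule pullback_eqI[OF assms(1)]) (use pa p r eq uv assms(6) in auto)
qed

section \<open>Additive bundles\<close>

lemma bundle_arr:
  assumes "additive_bundle C B"
  shows "bproj B \<in> Arr C" "bzero B \<in> Arr C" "badd B \<in> Arr C" "bfst B \<in> Arr C" "bsnd B \<in> Arr C"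
    "Dom C (bzero B) = base B" "Cod C (bzero B) = tot B"
    "Dom C (badd B) = Dom C (bfst B)" "Cod C (badd B) = tot B"
    "Dom C (bsnd B) = Dom C (bfst B)" "Cod C (bfst B) = tot B"
    "Cod C (bsnd B) = tot B"
    "tot B \<in> Obj C" "base B \<in> Obj C" "Dom C (bfst B) \<in> Obj C"
proof -
  interpret additive_bundle C B by fact
  show "bproj B \<in> Arr C" "bzero B \<in> Arr C" "badd B \<in> Arr C" "bfst B \<in> Arr C" "bsnd B \<in> Arr C"
    "Dom C (bzero B) = base B" "Cod C (bzero B) = tot B"
    "Dom C (badd B) = Dom C (bfst B)" "Cod C (badd B) = tot B"
    "Dom C (bsnd B) = Dom C (bfst B)" "Cod C (bfst B) = tot B"
    "Cod C (bsnd B) = tot B"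
    using pullback_arr[OF bundle_pullback] bzero_hom badd_hom by (auto simp: homset_def)
  then show  "tot B \<in> Obj C" "base B \<in> Obj C" "Dom C (bfst B) \<in> Obj C"
    using dom_obj cod_obj by auto
qed

lemma bundle_pair:
  assumes "additive_bundle C B" "el u (tot B)" "el v (tot B)"
    "Dom C u = Dom C v" "bproj B \<cdot> u = bproj B \<cdot> v"
  shows "el (pair_arr C (bfst B) (bsnd B) u v) (Dom C (bfst B))"
    and "Dom C (pair_arr C (bfst B) (bsnd B) u v) = Dom C u"
    and "bfst B \<cdot> pair_arr C (bfst B) (bsnd B) u v = u"
    and "bsnd B \<cdot> pair_arr C (bfst B) (bsnd B) u v = v"
  using pullback_pair[OF additive_bundle.bundle_pullback[OF assms(1)] assms(2-5)] by simp_all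

text \<open>The operations of an additive bundle, read on generalised elements at the same stage and in the
  same fibre.\<close>

lemma plus_el_dom:
  assumes "additive_bundle C B" "el u (tot B)" "el v (tot B)"
    "Dom C u = Dom C v" "bproj B \<cdot> u = bproj B \<cdot> v"
  shows plus_el: "el (u +[B] v) (tot B)" and plus_dom: "Dom C (u +[B] v) = Dom C u"
    and proj_plus: "bproj B \<cdot> (u +[B] v) = bproj B \<cdot> u"
proof -
  interpret additive_bundle C B by fact
  note b = bundle_arr[OF assms(1)] and p = bundle_pair[OF assms]
  show "el (u +[B] v) (tot B)" "Dom C (u +[B] v) = Dom C u"
    using b p by (simp_all add: bplus_def)
  have "bproj B \<cdot> (u +[B] v) = (bproj B \<cdot> badd B) \<cdot> pair_arr C (bfst B) (bsnd B) u v"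
    using b p by (simp add: bplus_def)
  also have "\<dots> = bproj B \<cdot> u" unfolding bproj_badd using b p by simp
  finally show "bproj B \<cdot> (u +[B] v) = bproj B \<cdot> u" .
qed

lemma plus_comp:
  assumes "additive_bundle C B" "el u (tot B)" "el v (tot B)"
    "Dom C u = Dom C v" "bproj B \<cdot> u = bproj B \<cdot> v" "el t (Dom C u)"
  shows "(u +[B] v) \<cdot> t = u \<cdot> t +[B] v \<cdot> t"
proof -
  note b = bundle_arr[OF assms(1)] and p = bundle_pair[OF assms(1-5)]
  have "pair_arr C (bfst B) (bsnd B) u v \<in> Arr C" "Cod C (pair_arr C (bfst B) (bsnd B) u v) = Dom C (bfst B)"
    using p(1) by (auto simp: el_def)
  then show ?thesis
    using b p assms(6) pair_comp[OF additive_bundle.bundle_pullback[OF assms(1)] assms(2-6)]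
    by (simp add: bplus_def)
qed

lemma plus_commute:
  assumes "additive_bundle C B" "el u (tot B)" "el v (tot B)"
    "Dom C u = Dom C v" "bproj B \<cdot> u = bproj B \<cdot> v"
  shows "u +[B] v = v +[B] u"
  using additive_bundle.bplus_comm[OF assms(1), of u "Dom C u" v] assms(2-5) by (simp add: homset_iff)

lemma plus_assoc:
  assumes "additive_bundle C B" "el u (tot B)" "el v (tot B)"
    "el w (tot B)" "Dom C u = Dom C v" "Dom C v = Dom C w"
    "bproj B \<cdot> u = bproj B \<cdot> v" "bproj B \<cdot> v = bproj B \<cdot> w"
  shows "(u +[B] v) +[B] w = u +[B] (v +[B] w)"
  using additive_bundle.bplus_assoc[OF assms(1), of u "Dom C u" v w] assms(2-) by (simp add: homset_iff)

lemma plus_zero: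
  assumes "additive_bundle C B" "el u (tot B)" "bproj B \<cdot> u = m"
  shows "u +[B] (bzero B \<cdot> m) = u"
  using additive_bundle.bplus_zero[OF assms(1), of u "Dom C u"] assms(2,3) by (auto simp: homset_iff)

lemma proj_zero:
  assumes "additive_bundle C B" "el m (base B)"
  shows "bproj B \<cdot> (bzero B \<cdot> m) = m"
proof -
  note b = bundle_arr[OF assms(1)]
  have "bproj B \<cdot> (bzero B \<cdot> m) = (bproj B \<cdot> bzero B) \<cdot> m" using b assms(2) by simp
  then show ?thesis using assms by (simp add: additive_bundle.bproj_bzero)
qed

lemma zero_plus:
  assumes "additive_bundle C B" "el u (tot B)" "bproj B \<cdot> u = m"
  shows "(bzero B \<cdot> m) +[B] u = u"
proof -
  note b = bundle_arr[OF assms(1)]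
  have m: "el m (base B)" "Dom C m = Dom C u" using assms b by auto
  show ?thesis
    using plus_commute[OF assms(1), of "bzero B \<cdot> m" u] plus_zero[OF assms] assms b m
    by (simp add: proj_zero)
qed

lemma plus_negation:
  assumes "additive_bundle C B" "is_negation C B n" "el u (tot B)"
  shows "el (n \<cdot> u) (tot B)" "Dom C (n \<cdot> u) = Dom C u" "bproj B \<cdot> (n \<cdot> u) = bproj B \<cdot> u"
    "u +[B] (n \<cdot> u) = bzero B \<cdot> (bproj B \<cdot> u)"
proof -
  note b = bundle_arr[OF assms(1)]
  have n: "n \<in> Arr C" "Dom C n = tot B" "Cod C n = tot B"
    "bproj B \<cdot> n = bproj B" "Idn C (tot B) +[B] n = bzero B \<cdot> bproj B"
    using assms(2) by (auto simp: is_negation_def homset_def)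
  show 1: "el (n \<cdot> u) (tot B)" "Dom C (n \<cdot> u) = Dom C u"
    using n assms by auto
  have "bproj B \<cdot> (n \<cdot> u) = (bproj B \<cdot> n) \<cdot> u" using n(1-3) b assms(3) by simp
  then show 2: "bproj B \<cdot> (n \<cdot> u) = bproj B \<cdot> u" by (simp add: n)
  have "u +[B] (n \<cdot> u) = (Idn C (tot B) +[B] n) \<cdot> u"
    using plus_comp[OF assms(1), of "Idn C (tot B)" n u] el_arr[OF n(1)] n(1-4) b assms(3)
    by simp
  also have "\<dots> = bzero B \<cdot> (bproj B \<cdot> u)" unfolding n(5) using b assms(3) by simp
  finally show "u +[B] (n \<cdot> u) = bzero B \<cdot> (bproj B \<cdot> u)" .
qed

lemma plus_cancel:
  assumes B: "additive_bundle C B" "\<exists>n. is_negation C B n"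
    and uvw: "el u (tot B)" "el v (tot B)" "el w (tot B)"
      "Dom C u = Dom C w" "Dom C v = Dom C w" "bproj B \<cdot> u = bproj B \<cdot> w" "bproj B \<cdot> v = bproj B \<cdot> w"
    and eq: "u +[B] w = v +[B] w"
  shows "u = v"
proof -
  obtain n where n: "is_negation C B n" using B by blast
  note w = plus_negation[OF B(1) n uvw(3)]
  have *: "(x +[B] w) +[B] (n \<cdot> w) = x"
    if "el x (tot B)" "Dom C x = Dom C w" "bproj B \<cdot> x = bproj B \<cdot> w" for x
  proof -
    have "(x +[B] w) +[B] (n \<cdot> w) = x +[B] (w +[B] (n \<cdot> w))"
      by (rule plus_assoc[OF B(1)]) (use that w uvw(3) in simp_all)
    also have "\<dots> = x" unfolding w(4) by (rule plus_zero[OF B(1)]) (use that in simp_all)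
    finally show ?thesis .
  qed
  have "u = (u +[B] w) +[B] (n \<cdot> w)" by (rule *[symmetric]) (use uvw in simp_all)
  also have "\<dots> = v" unfolding eq by (rule *) (use uvw in simp_all)
  finally show ?thesis .
qed

lemma negation_unique:
  assumes "additive_bundle C B" "is_negation C B n"
  shows "bneg C B = n"
  unfolding bneg_def
proof (rule the_equality)
  show "is_negation C B n" by fact
  fix m assume m: "is_negation C B m"
  let ?i = "Idn C (tot B)"
  note b = bundle_arr[OF assms(1)]
  have i: "el ?i (tot B)" using b by simp
  have mn: "el m (tot B)" "el n (tot B)" "Dom C m = tot B"
     "Dom C n = tot B" "bproj B \<cdot> m = bproj B" "bproj B \<cdot> n = bproj B"
     "?i +[B] m = bzero B \<cdot> bproj B" "?i +[B] n = bzero B \<cdot> bproj B"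
    using m assms(2) by (auto simp: is_negation_def homset_iff)
  have p: "bproj B \<cdot> ?i = bproj B" using b by simp
  have "m +[B] ?i = n +[B] ?i"
    using plus_commute[OF assms(1), of m ?i] plus_commute[OF assms(1), of n ?i] b p mn i by simp
  then show "m = n"
    using plus_cancel[OF assms(1) _ mn(1,2) i] assms(2) mn p b by auto
qed

lemma minus_plus:
  assumes "additive_bundle C B" "\<exists>n. is_negation C B n" "el u (tot B)" "el v (tot B)"
    "Dom C u = Dom C v" "bproj B \<cdot> u = bproj B \<cdot> v"
  shows "el (bminus C B u v) (tot B)" "Dom C (bminus C B u v) = Dom C u"
    "bproj B \<cdot> bminus C B u v = bproj B \<cdot> u" "bminus C B u v +[B] v = u"
proof -
  obtain n where n: "is_negation C B n" using assms by blast
  note b = bundle_arr[OF assms(1)]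
  have eq: "bminus C B u v = u +[B] (n \<cdot> v)"
    using negation_unique[OF assms(1) n] by (simp add: bminus_def)
  note v = plus_negation[OF assms(1) n assms(4)]
  note x = plus_el_dom[OF assms(1), of u "n \<cdot> v"]
  show "el (bminus C B u v) (tot B)" "Dom C (bminus C B u v) = Dom C u"
    "bproj B \<cdot> bminus C B u v = bproj B \<cdot> u"
    using x v assms unfolding eq by auto
  show "bminus C B u v +[B] v = u"
    unfolding eq using plus_assoc[OF assms(1), of u "n \<cdot> v" v] v assms b
     plus_commute[OF assms(1), of v "n \<cdot> v"] plus_zero[OF assms(1), of u] by simp
qed

section \<open>Pullback powers\<close>

text \<open>The part of the data of an additive bundle that is needed to form sums; it is available for
  the image of a bundle under \<open>T\<close> before the monoid laws are known there.\<close>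

definition plus_typed :: "('a, 'b) additive_bundle_data_scheme \<Rightarrow> bool" where
  "plus_typed B \<longleftrightarrow> is_pullback C (bproj B) (bproj B) (bfst B) (bsnd B)
     \<and> badd B \<in> Arr C \<and> Dom C (badd B) = Dom C (bfst B) \<and> Cod C (badd B) = tot B"

lemma plus_typed_comp:
  assumes "plus_typed B" "el u (tot B)" "el v (tot B)"
    "Dom C u = Dom C v" "bproj B \<cdot> u = bproj B \<cdot> v" "el t (Dom C u)"
  shows "(u +[B] v) \<cdot> t = u \<cdot> t +[B] v \<cdot> t"
proof -
  have pb: "is_pullback C (bproj B) (bproj B) (bfst B) (bsnd B)" and
    b: "badd B \<in> Arr C" "Dom C (badd B) = Dom C (bfst B)" "Cod C (badd B) = tot B"
    using assms(1) by (auto simp: plus_typed_def)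
  note p = pullback_pair[OF pb assms(2-5)]
  have "pair_arr C (bfst B) (bsnd B) u v \<in> Arr C" "Cod C (pair_arr C (bfst B) (bsnd B) u v) = Dom C (bfst B)"
    using p(1) by (auto simp: el_def)
  then show ?thesis
    using b p assms(6) pair_comp[OF pb assms(2-6)]
    by (simp add: bplus_def)
qed

lemma plus_typed_el:
  assumes "plus_typed B" "el u (tot B)" "el v (tot B)"
    "Dom C u = Dom C v" "bproj B \<cdot> u = bproj B \<cdot> v"
  shows "el (u +[B] v) (tot B)" "Dom C (u +[B] v) = Dom C u"
proof -
  have pb: "is_pullback C (bproj B) (bproj B) (bfst B) (bsnd B)" and
    b: "badd B \<in> Arr C" "Dom C (badd B) = Dom C (bfst B)" "Cod C (badd B) = tot B"
    using assms(1) by (auto simp: plus_typed_def)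
  note p = pullback_pair[OF pb assms(2-5)]
  show "el (u +[B] v) (tot B)" "Dom C (u +[B] v) = Dom C u"
    using b p by (simp_all add: bplus_def)
qed

text \<open>Pullbacks of an arrow along itself are its second pullback powers, so that preservation of pullback
  powers by \<open>T\<close> implies preservation of the chosen pullback on which an addition is defined.\<close>

lemma pullback_power2:
  assumes "is_pullback C q q a b"
  shows "is_pullback_power C q 2 (q \<cdot> a) (\<lambda>i. if i = 0 then a else b)"
proof -
  note t = pullback_arr[OF assms]
  have a: "el a (Dom C q)" "el b (Dom C q)" using t by (auto simp: el_def)
  have all2: "(\<forall>i<2. P i) \<longleftrightarrow> P 0 \<and> P 1" for P :: "nat \<Rightarrow> bool"
    by (auto simp: less_2_cases_iff)
  have "\<exists>!h. h \<in> homset C X (Dom C (q \<cdot> a)) \<and> (q \<cdot> a) \<cdot> h = s \<and> a \<cdot> h = u 0 \<and> b \<cdot> h = u 1"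
    if s: "s \<in> homset C X (Cod C q)"
      and u: "u 0 \<in> homset C X (Dom C q)" "q \<cdot> u 0 = s" "u 1 \<in> homset C X (Dom C q)" "q \<cdot> u 1 = s"
    for X s and u :: "nat \<Rightarrow> 'a"
  proof -
    have u': "el (u 0) (Dom C q)" "el (u 1) (Dom C q)" "Dom C (u 0) = X" "Dom C (u 1) = X"
      "Dom C (u 0) = Dom C (u 1)" "q \<cdot> u 0 = q \<cdot> u 1"
      using u by (auto simp: homset_iff)
    note p = pullback_pair[OF assms u'(1,2,5,6)]
    show ?thesis
    proof (rule ex1I[of _ "pair_arr C a b (u 0) (u 1)"])
      show "pair_arr C a b (u 0) (u 1) \<in> homset C X (Dom C (q \<cdot> a)) \<and> (q \<cdot> a) \<cdot> pair_arr C a b (u 0) (u 1) = s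
         \<and> a \<cdot> pair_arr C a b (u 0) (u 1) = u 0 \<and> b \<cdot> pair_arr C a b (u 0) (u 1) = u 1"
        using t(1-7) a p u' u by (simp add: homset_iff)
    next
      fix h assume "h \<in> homset C X (Dom C (q \<cdot> a)) \<and> (q \<cdot> a) \<cdot> h = s \<and> a \<cdot> h = u 0 \<and> b \<cdot> h = u 1"
      then have h: "el h (Dom C a)" "Dom C h = X" "a \<cdot> h = u 0" "b \<cdot> h = u 1"
        using t(1-7) a by (auto simp: homset_iff)
      show "h = pair_arr C a b (u 0) (u 1)"
        by (rule pullback_eqI[OF assms]) (use h p u' in simp_all)
    qed
  qed
  note ex1 = this
  show ?thesis
    unfolding is_pullback_power_def all2
  proof (intro conjI allI impI)
    show "q \<in> Arr C" "q \<cdot> a \<in> Arr C" "Cod C (q \<cdot> a) = Cod C q" using t(1-7) a by simp_all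
    show "(if (0::nat) = 0 then a else b) \<in> homset C (Dom C (q \<cdot> a)) (Dom C q)"
      "(if (1::nat) = 0 then a else b) \<in> homset C (Dom C (q \<cdot> a)) (Dom C q)"
      "q \<cdot> (if (0::nat) = 0 then a else b) = q \<cdot> a"
      "q \<cdot> (if (1::nat) = 0 then a else b) = q \<cdot> a"
      using t a by (simp_all add: homset_iff)
  next
    fix X s u
    assume "s \<in> homset C X (Cod C q)
      \<and> (u (0::nat) \<in> homset C X (Dom C q) \<and> q \<cdot> u 0 = s) \<and> u 1 \<in> homset C X (Dom C q) \<and> q \<cdot> u 1 = s"
    then show "\<exists>!h. h \<in> homset C X (Dom C (q \<cdot> a)) \<and> (q \<cdot> a) \<cdot> h = s
      \<and> (if (0::nat) = 0 then a else b) \<cdot> h = u 0 \<and> (if (1::nat) = 0 then a else b) \<cdot> h = u 1"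
      using ex1[of s X u] by simp
  qed
qed

lemma power2_pullback:
  assumes "is_pullback_power C q 2 r e"
  shows "is_pullback C q q (e 0) (e 1)"
proof -
  have all2: "(\<forall>i<2. P i) \<longleftrightarrow> P 0 \<and> P 1" for P :: "nat \<Rightarrow> bool"
    by (auto simp: less_2_cases_iff)
  note pw = assms[unfolded is_pullback_power_def all2]
  have t: "q \<in> Arr C" "r \<in> Arr C" "Cod C r = Cod C q" "el (e 0) (Dom C q)" "el (e 1) (Dom C q)"
    "Dom C (e 0) = Dom C r" "Dom C (e 1) = Dom C r" "q \<cdot> e 0 = r" "q \<cdot> e 1 = r"
    using pw by (auto simp: homset_iff)
  have e: "e 0 \<in> Arr C" "e 1 \<in> Arr C" "Cod C (e 0) = Dom C q" "Cod C (e 1) = Dom C q"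
    using t by (auto simp: el_def)
  have "\<exists>!h. h \<in> homset C X (Dom C (e 0)) \<and> e 0 \<cdot> h = u \<and> e 1 \<cdot> h = v"
    if uv: "u \<in> homset C X (Dom C q)" "v \<in> homset C X (Dom C q)" "q \<cdot> u = q \<cdot> v" for X u v
  proof -
    let ?w = "\<lambda>i::nat. if i = 0 then u else v"
    have "\<exists>!h. h \<in> homset C X (Dom C r) \<and> r \<cdot> h = q \<cdot> u \<and> e 0 \<cdot> h = ?w 0 \<and> e 1 \<cdot> h = ?w 1"
      using pw[THEN conjunct2, THEN conjunct2, THEN conjunct2, THEN conjunct2,
          THEN spec[of _ X], THEN spec[of _ "q \<cdot> u"], THEN spec[of _ ?w]] uv t(1)
      by (simp add: homset_iff)
    moreover have "r \<cdot> h = q \<cdot> u" if "h \<in> homset C X (Dom C r)" "e 0 \<cdot> h = u" for h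
      using that comp_comp[of "e 0" q h] t(1,3,6,8) e by (auto simp: homset_iff)
    ultimately have "\<exists>!h. h \<in> homset C X (Dom C r) \<and> e 0 \<cdot> h = u \<and> e 1 \<cdot> h = v"
      by (simp only: simp_thms if_True if_False one_neq_zero) metis
    then show ?thesis unfolding t(6) .
  qed
  then show ?thesis
    unfolding is_pullback_def using t e by auto
qed

end

context tangent_category
begin

section \<open>The tangent functor\<close>

text \<open>The action of the tangent functor on arrows.\<close>

abbreviation "T \<equiv> TA C"

lemma TO_Obj [simp]: "M \<in> Obj C \<Longrightarrow> TO C M \<in> Obj C"
  by (rule TO_obj)

lemma TA_arr [simp]: "f \<in> Arr C \<Longrightarrow> T f \<in> Arr C"
  and TA_dom [simp]: "f \<in> Arr C \<Longrightarrow> Dom C (T f) = TO C (Dom C f)"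
  and TA_cod [simp]: "f \<in> Arr C \<Longrightarrow> Cod C (T f) = TO C (Cod C f)"
  using TA_hom[of f "Dom C f" "Cod C f"] by (auto simp: homset_def)

lemma TA_el [simp]: "el f Y \<Longrightarrow> el (T f) (TO C Y)"
  by (auto simp: el_def)

lemma TA_Comp [simp]: "\<lbrakk>f \<in> Arr C; el u (Dom C f)\<rbrakk> \<Longrightarrow> T (f \<cdot> u) = T f \<cdot> T u"
  using TA_comp[of u "Dom C u" "Dom C f" f "Cod C f"] by (auto simp: homset_def el_def)

lemma TA_cong:
  assumes "f \<cdot> u = g \<cdot> v" "f \<in> Arr C" "g \<in> Arr C" "el u (Dom C f)" "el v (Dom C g)"
  shows "T f \<cdot> T u = T g \<cdot> T v"
  using assms TA_Comp by metis

lemma TA_eq: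
  assumes "f \<cdot> u = v" "f \<in> Arr C" "el u (Dom C f)"
  shows "T f \<cdot> T u = T v"
  using assms TA_Comp by metis

lemma TA_Idn [simp]: "M \<in> Obj C \<Longrightarrow> T (Idn C M) = Idn C (TO C M)"
  by (rule TA_idn)

lemma TA_square:
  assumes "f \<cdot> a = g \<cdot> b" "f \<in> Arr C" "a \<in> Arr C" "g \<in> Arr C" "b \<in> Arr C"
    "Cod C a = Dom C f" "Cod C b = Dom C g" "el u (TO C (Dom C a))" "Dom C b = Dom C a"
  shows "T f \<cdot> (T a \<cdot> u) = T g \<cdot> (T b \<cdot> u)"
proof (rule comp_square)
  have "T (f \<cdot> a) = T (g \<cdot> b)" using assms(1) by simp
  then show "T f \<cdot> T a = T g \<cdot> T b"
    using assms(2-) el_arr[OF assms(3)] el_arr[OF assms(5)] by simp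
qed (use assms in simp_all)

section \<open>Bundles closed under the tangent functor\<close>

lemma bundle_power_pullback_preserved:
  assumes "pullback_powers_preserved C q" "is_pullback C q q a b"
  shows "pullback_preserved C q q a b"
  unfolding pullback_preserved_def
proof
  fix k
  have "is_pullback_power C ((T ^^ k) q) 2 ((T ^^ k) (q \<cdot> a)) (\<lambda>i. (T ^^ k) (if i = 0 then a else b))"
    using assms(1) pullback_power2[OF assms(2)] unfolding pullback_powers_preserved_def by blast
  from power2_pullback[OF this]
  show "is_pullback C ((T ^^ k) q) ((T ^^ k) q) ((T ^^ k) a) ((T ^^ k) b)" by simp
qed

lemma pullback_preserved_T:
  "pullback_preserved C f g a b \<Longrightarrow> pullback_preserved C (T f) (T g) (T a) (T b)"
  unfolding pullback_preserved_def
proof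
  fix k assume "\<forall>k. is_pullback C ((T ^^ k) f) ((T ^^ k) g) ((T ^^ k) a) ((T ^^ k) b)"
  from this[THEN spec[of _ "Suc k"]]
  show "is_pullback C ((T ^^ k) (T f)) ((T ^^ k) (T g)) ((T ^^ k) (T a)) ((T ^^ k) (T b))"
    by (simp add: funpow_swap1)
qed

lemma pullback_preserved_0: "pullback_preserved C f g a b \<Longrightarrow> is_pullback C f g a b"
  unfolding pullback_preserved_def by (drule spec[of _ 0]) simp

lemma T_bundle_simps [simp]:
  "bproj (T_bundle C B) = T (bproj B)" "bzero (T_bundle C B) = T (bzero B)"
  "bfst (T_bundle C B) = T (bfst B)" "bsnd (T_bundle C B) = T (bsnd B)"
  "badd (T_bundle C B) = T (badd B)"
  by (simp_all add: T_bundle_def)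

lemma tangent_bundle_simps [simp]:
  "bproj (tangent_bundle C M) = tproj C M" "bzero (tangent_bundle C M) = tzero C M"
  "bfst (tangent_bundle C M) = tfst C M" "bsnd (tangent_bundle C M) = tsnd C M"
  "badd (tangent_bundle C M) = tadd C M"
  by (simp_all add: tangent_bundle_def)

text \<open>Additive bundles with negation whose addition pullback and some third pullback power are preserved
  by all iterates of \<open>T\<close>. The third power is the universal case of the associativity law, which is therefore
  inherited by \<open>T(B)\<close>. In the presence of negatives the class contains all tangent
  bundles and differential bundles; it is closed
  under \<open>T\<close> (\<open>stable_bundle_T\<close>).\<close>

definition stable_bundle :: "('a, 'b) additive_bundle_data_scheme \<Rightarrow> bool" where
  "stable_bundle B \<longleftrightarrow> additive_bundle C B
     \<and> pullback_preserved C (bproj B) (bproj B) (bfst B) (bsnd B)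
     \<and> (\<exists>r e. \<forall>k. is_pullback_power C ((T ^^ k) (bproj B)) 3 ((T ^^ k) r) (\<lambda>i. (T ^^ k) (e i)))
     \<and> (\<exists>n. is_negation C B n)"

lemma stable_bundleI:
  assumes "additive_bundle C B" "pullback_powers_preserved C (bproj B)" "\<exists>n. is_negation C B n"
  shows "stable_bundle B"
  unfolding stable_bundle_def
proof (intro conjI)
  show "pullback_preserved C (bproj B) (bproj B) (bfst B) (bsnd B)"
    by (rule bundle_power_pullback_preserved[OF assms(2) additive_bundle.bundle_pullback[OF assms(1)]])
  show "\<exists>r e. \<forall>k. is_pullback_power C ((T ^^ k) (bproj B)) 3 ((T ^^ k) r) (\<lambda>i. (T ^^ k) (e i))"
    using assms(2) unfolding pullback_powers_preserved_def by blast
qed (use assms in auto)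

lemma stable_additive: "stable_bundle B \<Longrightarrow> additive_bundle C B"
  by (simp add: stable_bundle_def)

lemma stable_pullback_T: "stable_bundle B \<Longrightarrow> is_pullback C (T (bproj B)) (T (bproj B)) (T (bfst B)) (T (bsnd B))"
  unfolding stable_bundle_def by (blast intro: pullback_preserved_0 pullback_preserved_T)

lemma stable_plus_typed_T:
  assumes "stable_bundle B" shows "plus_typed (T_bundle C B)"
  unfolding plus_typed_def using stable_pullback_T[OF assms] bundle_arr[OF stable_additive[OF assms]] by simp

lemma TA_plus:
  assumes "stable_bundle B" "el u (tot B)" "el v (tot B)"
    "Dom C u = Dom C v" "bproj B \<cdot> u = bproj B \<cdot> v"
  shows "T (u +[B] v) = T u +[T_bundle C B] T v"
proof -
  note b = bundle_arr[OF stable_additive[OF assms(1)]] and p = bundle_pair[OF stable_additive[OF assms(1)] assms(2-5)]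
  have ar: "u \<in> Arr C" "v \<in> Arr C" "pair_arr C (bfst B) (bsnd B) u v \<in> Arr C"
    using assms(2,3) p(1) by (auto simp: el_def)
  have sq: "T (bproj B) \<cdot> T u = T (bproj B) \<cdot> T v"
    by (rule TA_cong[OF assms(5)]) (use b assms in simp_all)
  have ty: "el (T u) (Dom C (T (bproj B)))" "el (T v) (Dom C (T (bproj B)))"
    "Dom C (T u) = Dom C (T v)"
    using assms b ar by simp_all
  note p' = pullback_pair[OF stable_pullback_T[OF assms(1)] ty sq]
  let ?p = "pair_arr C (bfst B) (bsnd B) u v"
  have e1: "T (bfst B) \<cdot> T ?p = T u"
    using TA_Comp[of "bfst B" ?p] p(1) b(4) unfolding p(3) by simp
  have e2: "T (bsnd B) \<cdot> T ?p = T v"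
    using TA_Comp[of "bsnd B" ?p] p(1) b(5,10) unfolding p(4) by simp
  have "T ?p = pair_arr C (T (bfst B)) (T (bsnd B)) (T u) (T v)"
  proof (rule pullback_eqI[OF stable_pullback_T[OF assms(1)]])
    show "el (T ?p) (Dom C (T (bfst B)))" using p(1) b(4) by simp
    show "Dom C (T ?p) = Dom C (pair_arr C (T (bfst B)) (T (bsnd B)) (T u) (T v))"
      using p'(2) p(2) ar by simp
  qed (simp_all only: e1 e2 p')
  then show ?thesis using TA_Comp[of "badd B" ?p] b(3,8) p(1) by (simp add: bplus_def)
qed

text \<open>Each law holds for the projections of the universal pullback, and all elements of \<open>T(B)\<close> factor
  through the image of that pullback under \<open>T\<close>.\<close>

lemma stable_T_additive:
  assumes B: "stable_bundle B"
  shows "additive_bundle C (T_bundle C B)"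
proof -
  note ab = stable_additive[OF B]
  interpret additive_bundle C B by (rule ab)
  note b = bundle_arr[OF ab] and pt = stable_plus_typed_T[OF B]
  note pc = plus_typed_comp[OF pt, simplified] and pe = plus_typed_el[OF pt, simplified]
  let ?q = "bproj B"
  have fs: "el (bfst B) (Dom C ?q)" "el (bsnd B) (Dom C ?q)"
    using b by (auto simp: el_def)
  have sq: "?q \<cdot> bfst B = ?q \<cdot> bsnd B" by (rule pullback_arr(8)[OF bundle_pullback])
  have Tsq: "T ?q \<cdot> T (bfst B) = T ?q \<cdot> T (bsnd B)"
    using arg_cong[OF sq, of "T"] b fs by simp
  show ?thesis
  proof (unfold_locales, goal_cases)
    case 1 show ?case using stable_pullback_T[OF B] by simp
  next
    case 2 show ?case using TA_hom[OF bzero_hom] b by simp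
  next
    case 3
    have "T (?q \<cdot> bzero B) = T (Idn C (Cod C ?q))" using bproj_bzero by simp
    then show ?case using b el_arr[of "bzero B"] by simp
  next
    case 4 show ?case using TA_hom[OF badd_hom] b by simp
  next
    case 5
    have "T (?q \<cdot> badd B) = T (?q \<cdot> bfst B)" using bproj_badd by simp
    then show ?case using b fs el_arr[of "badd B"] by simp
  next
    case (6 u X)
    let ?i = "Idn C (Dom C ?q)"
    have u: "el u (TO C (Dom C ?q))" using 6 b by (simp add: homset_iff)
    have "?i +[B] (bzero B \<cdot> ?q) = ?i"
      using plus_zero[OF ab, of ?i "?q"] b by simp
    then have "T (?i +[B] (bzero B \<cdot> ?q)) = Idn C (TO C (Dom C ?q))" using b by simp
    moreover have q: "el ?q (Cod C ?q)" by (rule el_arr) (use b in simp)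
    ultimately have eq: "Idn C (TO C (Dom C ?q)) +[T_bundle C B] (T (bzero B) \<cdot> T ?q) = Idn C (TO C (Dom C ?q))"
      using TA_plus[OF B, of ?i "bzero B \<cdot> ?q"] b proj_zero[OF ab q] by simp
    have pz: "T ?q \<cdot> (T (bzero B) \<cdot> T ?q) = T ?q"
      using arg_cong[OF proj_zero[OF ab q], of "T"] b q by simp
    have "(Idn C (TO C (Dom C ?q)) +[T_bundle C B] (T (bzero B) \<cdot> T ?q)) \<cdot> u
       = u +[T_bundle C B] (T (bzero B) \<cdot> (T ?q \<cdot> u))"
      using pc[of "Idn C (TO C (Dom C ?q))" "T (bzero B) \<cdot> T ?q" u] u b q TA_el[OF q] pz by simp
    then show ?case unfolding eq using u by simp
  next
    case (7 u X v)
    have uv: "el u (TO C (Dom C ?q))" "el v (TO C (Dom C ?q))" "Dom C u = Dom C v" "T ?q \<cdot> u = T ?q \<cdot> v"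
      using 7 b by (simp_all add: homset_iff)
    note p = pullback_pair[OF stable_pullback_T[OF B], of u v]
    let ?h = "pair_arr C (T (bfst B)) (T (bsnd B)) u v"
    have h: "el ?h (TO C (Dom C (bfst B)))" "T (bfst B) \<cdot> ?h = u" "T (bsnd B) \<cdot> ?h = v"
      using p uv b by simp_all
    have "T (bfst B +[B] bsnd B) = T (bsnd B +[B] bfst B)"
      using plus_commute[OF ab, of "bfst B" "bsnd B"] fs sq b by simp
    then have "T (bfst B) +[T_bundle C B] T (bsnd B) = T (bsnd B) +[T_bundle C B] T (bfst B)"
      using TA_plus[OF B, of "bfst B" "bsnd B"] TA_plus[OF B, of "bsnd B" "bfst B"] fs sq b by simp
    then have "(T (bfst B) +[T_bundle C B] T (bsnd B)) \<cdot> ?h = (T (bsnd B) +[T_bundle C B] T (bfst B)) \<cdot> ?h"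
      by simp
    then show ?case
      using pc[of "T (bfst B)" "T (bsnd B)" ?h] pc[of "T (bsnd B)" "T (bfst B)" ?h] fs Tsq b h
       TA_el[OF fs(1)] TA_el[OF fs(2)] by simp
  next
    case (8 u X v w)
    have uvw: "el u (TO C (Dom C ?q))" "el v (TO C (Dom C ?q))" "el w (TO C (Dom C ?q))"
      "Dom C u = X" "Dom C v = X" "Dom C w = X" "T ?q \<cdot> u = T ?q \<cdot> v" "T ?q \<cdot> v = T ?q \<cdot> w"
      using 8 b by (simp_all add: homset_iff)
    obtain r e where pw: "\<And>k. is_pullback_power C ((T ^^ k) ?q) 3 ((T ^^ k) r) (\<lambda>i. (T ^^ k) (e i))"
      using B unfolding stable_bundle_def by blast
    have all3: "(\<forall>i<3. P i) \<longleftrightarrow> P 0 \<and> P 1 \<and> P 2" for P :: "nat \<Rightarrow> bool"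
      by (auto simp: numeral_3_eq_3 less_Suc_eq numeral_2_eq_2)
    note pw0 = pw[of 0, simplified, unfolded is_pullback_power_def all3]
    note pw1 = pw[of 1, simplified, unfolded is_pullback_power_def all3]
    have e: "el (e 0) (Dom C ?q)" "el (e 1) (Dom C ?q)" "el (e 2) (Dom C ?q)"
      "Dom C (e 0) = Dom C r" "Dom C (e 1) = Dom C r" "Dom C (e 2) = Dom C r"
      "?q \<cdot> e 0 = r" "?q \<cdot> e 1 = r" "?q \<cdot> e 2 = r" "r \<in> Arr C"
      using pw0 by (auto simp: homset_iff)
    have ea: "e 0 \<in> Arr C" "e 1 \<in> Arr C" "e 2 \<in> Arr C"
      using e by (auto simp: el_def)
    let ?w = "\<lambda>i::nat. if i = 0 then u else if i = 1 then v else w"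
    obtain h where h: "h \<in> homset C X (Dom C (T r))" "T (e 0) \<cdot> h = u" "T (e 1) \<cdot> h = v" "T (e 2) \<cdot> h = w"
      using pw1[THEN conjunct2, THEN conjunct2, THEN conjunct2, THEN conjunct2,
          THEN spec[of _ X], THEN spec[of _ "T ?q \<cdot> w"], THEN spec[of _ ?w]] uvw b
      by (auto simp: homset_iff)
    have hh: "el h (TO C (Dom C r))" using h(1) e(10) by (simp add: homset_iff)
    have Te: "T ?q \<cdot> T (e 0) = T r" "T ?q \<cdot> T (e 1) = T r" "T ?q \<cdot> T (e 2) = T r"
      using TA_eq[OF e(7)] TA_eq[OF e(8)] TA_eq[OF e(9)] e(1-3) b(1) by simp_all
    note tp = TA_plus[OF B]
    note pl = plus_el_dom[OF ab]
    let ?T = "T_bundle C B"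
    have s01: "el (e 0 +[B] e 1) (Dom C ?q)" "Dom C (e 0 +[B] e 1) = Dom C r"
        "?q \<cdot> (e 0 +[B] e 1) = r" "T (e 0 +[B] e 1) = T (e 0) +[?T] T (e 1)"
      using pl[of "e 0" "e 1", OF e(1,2)] tp[of "e 0" "e 1", OF e(1,2)] by (simp_all only: e)
    have s12: "el (e 1 +[B] e 2) (Dom C ?q)" "Dom C (e 1 +[B] e 2) = Dom C r"
        "?q \<cdot> (e 1 +[B] e 2) = r" "T (e 1 +[B] e 2) = T (e 1) +[?T] T (e 2)"
      using pl[of "e 1" "e 2", OF e(2,3)] tp[of "e 1" "e 2", OF e(2,3)] by (simp_all only: e)
    have l: "T ((e 0 +[B] e 1) +[B] e 2) = (T (e 0) +[?T] T (e 1)) +[?T] T (e 2)"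
      using tp[OF s01(1) e(3)] by (simp only: s01 e)
    have r: "T (e 0 +[B] (e 1 +[B] e 2)) = T (e 0) +[?T] (T (e 1) +[?T] T (e 2))"
      using tp[OF e(1) s12(1)] by (simp only: s12 e)
    have "(e 0 +[B] e 1) +[B] e 2 = e 0 +[B] (e 1 +[B] e 2)"
      by (rule plus_assoc[OF ab e(1-3)]) (simp_all only: e)
    then have as: "(T (e 0) +[?T] T (e 1)) +[?T] T (e 2) = T (e 0) +[?T] (T (e 1) +[?T] T (e 2))"
      using l r by simp
    have Tel: "el (T (e 0)) (TO C (Dom C ?q))" "el (T (e 1)) (TO C (Dom C ?q))" "el (T (e 2)) (TO C (Dom C ?q))"
      using e TA_el by simp_all
    have TD: "Dom C (T (e 0)) = TO C (Dom C r)" "Dom C (T (e 1)) = TO C (Dom C r)" "Dom C (T (e 2)) = TO C (Dom C r)"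
      using ea by (simp_all only: TA_dom e)
    have TP: "T ?q \<cdot> (T (e 0) +[?T] T (e 1)) = T r" "T ?q \<cdot> (T (e 1) +[?T] T (e 2)) = T r"
      using TA_eq[OF s01(3) b(1) s01(1)] TA_eq[OF s12(3) b(1) s12(1)] by (simp_all only: s01 s12)
    have q': "Dom C (T ?q) = TO C (Dom C ?q)" using b(1) by simp
    note pc' = pc[unfolded q'] and pe' = pe[unfolded q']
    have T01: "el (T (e 0) +[?T] T (e 1)) (TO C (Dom C ?q))" "Dom C (T (e 0) +[?T] T (e 1)) = TO C (Dom C r)"
      using pe'[OF Tel(1,2)] by (simp_all only: TD Te)
    have T12: "el (T (e 1) +[?T] T (e 2)) (TO C (Dom C ?q))" "Dom C (T (e 1) +[?T] T (e 2)) = TO C (Dom C r)"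
      using pe'[OF Tel(2,3)] by (simp_all only: TD Te)
    have "((T (e 0) +[?T] T (e 1)) +[?T] T (e 2)) \<cdot> h = (u +[?T] v) +[?T] w"
      using pc'[OF T01(1) Tel(3), of h] pc'[OF Tel(1,2), of h] hh by (simp only: TD Te TP T01 h)
    moreover have "(T (e 0) +[?T] (T (e 1) +[?T] T (e 2))) \<cdot> h = u +[?T] (v +[?T] w)"
      using pc'[OF Tel(1) T12(1), of h] pc'[OF Tel(2,3), of h] hh by (simp only: TD Te TP T12 h)
    ultimately show ?case using as by simp
  qed
qed

lemma stable_bundle_T [simp]:
  assumes B: "stable_bundle B"
  shows "stable_bundle (T_bundle C B)"
  unfolding stable_bundle_def
proof (intro conjI)
  note ab = stable_additive[OF B]
  note b = bundle_arr[OF ab]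
  show "additive_bundle C (T_bundle C B)" by (rule stable_T_additive[OF B])
  show "pullback_preserved C (bproj (T_bundle C B)) (bproj (T_bundle C B)) (bfst (T_bundle C B)) (bsnd (T_bundle C B))"
    using B by (simp add: stable_bundle_def pullback_preserved_T)
  obtain r e where pw: "\<And>k. is_pullback_power C ((T ^^ k) (bproj B)) 3 ((T ^^ k) r) (\<lambda>i. (T ^^ k) (e i))"
    using B unfolding stable_bundle_def by blast
  have "is_pullback_power C ((T ^^ k) (bproj (T_bundle C B))) 3 ((T ^^ k) (T r)) (\<lambda>i. (T ^^ k) (T (e i)))" for k
    using pw[of "Suc k"] by (simp add: funpow_swap1)
  then show "\<exists>r e. \<forall>k. is_pullback_power C ((T ^^ k) (bproj (T_bundle C B))) 3 ((T ^^ k) r) (\<lambda>i. (T ^^ k) (e i))"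
    by (intro exI[of _ "T r"] exI[of _ "\<lambda>i. T (e i)"] allI)
  obtain n where n: "is_negation C B n" using B stable_bundle_def by blast
  let ?i = "Idn C (tot B)"
  have nn: "n \<in> Arr C" "Dom C n = tot B" "Cod C n = tot B"
    "bproj B \<cdot> n = bproj B" "?i +[B] n = bzero B \<cdot> bproj B" "el n (tot B)"
    using n by (auto simp: is_negation_def homset_def el_def)
  have q: "el (bproj B) (base B)" by (rule el_arr) (use b in simp)
  have "T (?i +[B] n) = T (bzero B) \<cdot> T (bproj B)"
    using nn(5) b q by simp
  moreover have "T (bproj B) \<cdot> T n = T (bproj B)"
    by (rule TA_eq[OF nn(4)]) (use nn b in simp_all)
  ultimately have "is_negation C (T_bundle C B) (T n)"
    using TA_plus[OF B, of ?i n] nn(1-4,6) b by (simp add: is_negation_def homset_iff)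
  then show "\<exists>n. is_negation C (T_bundle C B) n" by blast
qed

section \<open>The structure maps on generalised elements\<close>

lemma tproj_arr [simp]: "M \<in> Obj C \<Longrightarrow> tproj C M \<in> Arr C"
  "M \<in> Obj C \<Longrightarrow> Dom C (tproj C M) = TO C M" "M \<in> Obj C \<Longrightarrow> Cod C (tproj C M) = M"
  and tzero_arr [simp]: "M \<in> Obj C \<Longrightarrow> tzero C M \<in> Arr C"
  "M \<in> Obj C \<Longrightarrow> Dom C (tzero C M) = M" "M \<in> Obj C \<Longrightarrow> Cod C (tzero C M) = TO C M"
  and tlift_arr [simp]: "M \<in> Obj C \<Longrightarrow> tlift C M \<in> Arr C"
  "M \<in> Obj C \<Longrightarrow> Dom C (tlift C M) = TO C M" "M \<in> Obj C \<Longrightarrow> Cod C (tlift C M) = TO C (TO C M)"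
  and tflip_arr [simp]: "M \<in> Obj C \<Longrightarrow> tflip C M \<in> Arr C"
  "M \<in> Obj C \<Longrightarrow> Dom C (tflip C M) = TO C (TO C M)" "M \<in> Obj C \<Longrightarrow> Cod C (tflip C M) = TO C (TO C M)"
  using tproj_hom[of M] tzero_hom[of M] tlift_hom[of M] tflip_hom[of M] by (auto simp: homset_def)

lemma tstr_el [simp]: "M \<in> Obj C \<Longrightarrow> el (tproj C M) M" "M \<in> Obj C \<Longrightarrow> el (tzero C M) (TO C M)"
  "M \<in> Obj C \<Longrightarrow> el (tlift C M) (TO C (TO C M))" "M \<in> Obj C \<Longrightarrow> el (tflip C M) (TO C (TO C M))"
  by (simp_all add: el_def)

lemma arr_obj [simp]: "f \<in> Arr C \<Longrightarrow> Dom C f \<in> Obj C" "f \<in> Arr C \<Longrightarrow> Cod C f \<in> Obj C"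
  using dom_obj cod_obj by auto

text \<open>The naturality rules are oriented so that \<open>p\<close> moves towards the element, whereas \<open>0\<close>, \<open>l\<close> and \<open>c\<close>
  move away from it.\<close>

lemma tproj_natural [simp]:
  assumes "f \<in> Arr C" "Cod C f = N" "el u (TO C (Dom C f))"
  shows "tproj C N \<cdot> (T f \<cdot> u) = f \<cdot> (tproj C (Dom C f) \<cdot> u)"
  by (rule comp_square[OF tproj_nat[of f "Dom C f" N]]) (use assms in \<open>auto simp: homset_def\<close>)

lemma tzero_natural [simp]:
  assumes "f \<in> Arr C" "Dom C f = M" "el u M"
  shows "T f \<cdot> (tzero C M \<cdot> u) = tzero C (Cod C f) \<cdot> (f \<cdot> u)"
  by (rule comp_square[OF tzero_nat[of f M "Cod C f", symmetric]]) (use assms in \<open>auto simp: homset_def\<close>)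

lemma tlift_natural [simp]:
  assumes "f \<in> Arr C" "Dom C f = M" "el u (TO C M)"
  shows "T (T f) \<cdot> (tlift C M \<cdot> u) = tlift C (Cod C f) \<cdot> (T f \<cdot> u)"
  by (rule comp_square[OF tlift_nat[of f M "Cod C f", symmetric]]) (use assms in \<open>auto simp: homset_def\<close>)

lemma tflip_natural [simp]:
  assumes "f \<in> Arr C" "Dom C f = M" "el u (TO C (TO C M))"
  shows "T (T f) \<cdot> (tflip C M \<cdot> u) = tflip C (Cod C f) \<cdot> (T (T f) \<cdot> u)"
  by (rule comp_square[OF tflip_nat[of f M "Cod C f", symmetric]]) (use assms in \<open>auto simp: homset_def\<close>)

lemma T_tproj_natural [simp]:
  assumes "f \<in> Arr C" "Cod C f = N" "el u (TO C (TO C (Dom C f)))"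
  shows "T (tproj C N) \<cdot> (T (T f) \<cdot> u) = T f \<cdot> (T (tproj C (Dom C f)) \<cdot> u)"
  by (rule TA_square[OF tproj_nat[of f "Dom C f" N]]) (use assms in \<open>auto simp: homset_def\<close>)

lemma comp_eq:
  assumes "g \<cdot> f = h" "f \<in> Arr C" "g \<in> Arr C" "Dom C g = Cod C f" "el u (Dom C f)"
  shows "g \<cdot> (f \<cdot> u) = h \<cdot> u"
  using assms comp_comp[of f g u] by simp

lemma tproj_tzero [simp]:
  assumes "el u M" shows "tproj C M \<cdot> (tzero C M \<cdot> u) = u"
proof -
  have M: "M \<in> Obj C" using assms el_obj by simp
  have "tproj C M \<cdot> (tzero C M \<cdot> u) = Idn C M \<cdot> u"
    by (rule comp_eq) (use additive_bundle.bproj_bzero[OF tangent_additive[OF M]] M assms in simp_all)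
  then show ?thesis using assms by simp
qed

lemma T_tproj_tzero [simp]:
  assumes "M \<in> Obj C" "el u (TO C M)" shows "T (tproj C M) \<cdot> (T (tzero C M) \<cdot> u) = u"
proof -
  have "tproj C M \<cdot> tzero C M = Idn C M"
    using additive_bundle.bproj_bzero[OF tangent_additive[OF assms(1)]] assms by simp
  then have "T (tproj C M) \<cdot> T (tzero C M) = T (Idn C M)"
    by (rule TA_eq) (use assms in simp_all)
  then have "T (tproj C M) \<cdot> (T (tzero C M) \<cdot> u) = T (Idn C M) \<cdot> u"
    by (rule comp_eq) (use assms in simp_all)
  then show ?thesis using assms by simp
qed

lemma flip_flip [simp]:
  assumes "M \<in> Obj C" "el u (TO C (TO C M))" shows "tflip C M \<cdot> (tflip C M \<cdot> u) = u"
  using comp_eq[OF tflip_tflip[OF assms(1)], of u] assms by simp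

lemma flip_lift [simp]:
  assumes "M \<in> Obj C" "el u (TO C M)" shows "tflip C M \<cdot> (tlift C M \<cdot> u) = tlift C M \<cdot> u"
  using comp_eq[OF tflip_tlift[OF assms(1)], of u] assms by simp

lemma tproj_flip [simp]:
  assumes "M \<in> Obj C" "el u (TO C (TO C M))"
  shows "tproj C (TO C M) \<cdot> (tflip C M \<cdot> u) = T (tproj C M) \<cdot> u"
proof -
  have "tproj C (TO C M) \<cdot> tflip C M = T (tproj C M)"
    using tflip_additive[OF assms(1)] assms(1) el_arr[of "T (tproj C M)"]
    by (simp add: additive_bundle_morphism_def)
  from comp_eq[OF this] show ?thesis using assms by simp
qed

lemma T_tproj_flip [simp]:
  assumes "M \<in> Obj C" "el u (TO C (TO C M))"
  shows "T (tproj C M) \<cdot> (tflip C M \<cdot> u) = tproj C (TO C M) \<cdot> u"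
  using tproj_flip[of M "tflip C M \<cdot> u"] assms by simp

text \<open>Together with \<open>cl = l\<close> and \<open>pc = T(p)\<close> this also determines \<open>pl\<close>.\<close>

lemma T_tproj_lift [simp]:
  assumes "M \<in> Obj C" "el u (TO C M)"
  shows "T (tproj C M) \<cdot> (tlift C M \<cdot> u) = tzero C M \<cdot> (tproj C M \<cdot> u)"
proof -
  have "T (tproj C M) \<cdot> tlift C M = tzero C M \<cdot> tproj C M"
    using tlift_additive[OF assms(1)] by (simp add: additive_bundle_morphism_def)
  from comp_square[OF this] show ?thesis using assms by simp
qed

lemma tproj_lift [simp]:
  assumes "M \<in> Obj C" "el u (TO C M)"
  shows "tproj C (TO C M) \<cdot> (tlift C M \<cdot> u) = tzero C M \<cdot> (tproj C M \<cdot> u)"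
proof -
  have "tproj C (TO C M) \<cdot> (tflip C M \<cdot> (tlift C M \<cdot> u)) = tzero C M \<cdot> (tproj C M \<cdot> u)"
    by (subst tproj_flip) (use assms in simp_all)
  then show ?thesis using assms by simp
qed

lemma flip_T_zero [simp]:
  assumes "M \<in> Obj C" "el u (TO C M)"
  shows "tflip C M \<cdot> (T (tzero C M) \<cdot> u) = tzero C (TO C M) \<cdot> u"
proof -
  have "tflip C M \<cdot> T (tzero C M) = tzero C (TO C M)"
    using tflip_additive[OF assms(1)] assms(1) by (simp add: additive_bundle_morphism_def)
  from comp_eq[OF this] show ?thesis using assms by simp
qed

lemma flip_zero [simp]:
  assumes "M \<in> Obj C" "el u (TO C M)"
  shows "tflip C M \<cdot> (tzero C (TO C M) \<cdot> u) = T (tzero C M) \<cdot> u"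
  using flip_flip[of M "T (tzero C M) \<cdot> u"] assms by simp

lemma lift_zero [simp]:
  assumes "M \<in> Obj C" "el u M"
  shows "tlift C M \<cdot> (tzero C M \<cdot> u) = tzero C (TO C M) \<cdot> (tzero C M \<cdot> u)"
proof -
  have "tlift C M \<cdot> tzero C M = T (tzero C M) \<cdot> tzero C M"
    using tlift_additive[OF assms(1)] by (simp add: additive_bundle_morphism_def)
  from comp_square[OF this] show ?thesis using assms by simp
qed

lemma flip_eqD:
  assumes "tflip C M \<cdot> u = tflip C M \<cdot> v" "M \<in> Obj C" "el u (TO C (TO C M))" "el v (TO C (TO C M))"
  shows "u = v"
  using flip_flip[OF assms(2,3)] flip_flip[OF assms(2,4)] unfolding assms(1) by (rule trans[OF sym])

section \<open>Additive operations on generalised elements\<close>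

lemma stable_arr [simp]:
  assumes "stable_bundle B"
  shows "bproj B \<in> Arr C" "bzero B \<in> Arr C" "badd B \<in> Arr C" "bfst B \<in> Arr C" "bsnd B \<in> Arr C"
    "Dom C (bzero B) = base B" "Cod C (bzero B) = tot B"
    "Dom C (badd B) = Dom C (bfst B)" "Cod C (badd B) = tot B"
    "Dom C (bsnd B) = Dom C (bfst B)" "Cod C (bfst B) = tot B"
    "Cod C (bsnd B) = tot B"
  using bundle_arr[OF stable_additive[OF assms]] by simp_all

lemma fibre_plus_el [simp]:
  "\<lbrakk>stable_bundle B; tot B = E; el u E; el v E; Dom C u = Dom C v; bproj B \<cdot> u = bproj B \<cdot> v\<rbrakk>
    \<Longrightarrow> el (u +[B] v) E"
  using plus_el stable_additive by blast

lemma fibre_plus_dom [simp]: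
  "\<lbrakk>stable_bundle B; el u (tot B); el v (tot B); Dom C u = Dom C v; bproj B \<cdot> u = bproj B \<cdot> v\<rbrakk>
    \<Longrightarrow> Dom C (u +[B] v) = Dom C u"
  using plus_dom stable_additive by blast

lemma stable_proj_plus [simp]:
  "\<lbrakk>bproj B = q; stable_bundle B; el u (tot B); el v (tot B); Dom C u = Dom C v;
     bproj B \<cdot> u = bproj B \<cdot> v\<rbrakk> \<Longrightarrow> q \<cdot> (u +[B] v) = q \<cdot> u"
  using proj_plus stable_additive by blast

lemma stable_proj_zero [simp]: "\<lbrakk>stable_bundle B; el m (base B)\<rbrakk> \<Longrightarrow> bproj B \<cdot> (bzero B \<cdot> m) = m"
  by (rule proj_zero[OF stable_additive])

lemma T_stable_proj_zero [simp]: "\<lbrakk>stable_bundle B; el m (TO C (base B))\<rbrakk> \<Longrightarrow> T (bproj B) \<cdot> (T (bzero B) \<cdot> m) = m"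
  using stable_proj_zero[of "T_bundle C B" m] by simp

text \<open>An arrow between total objects preserves sums if it is compatible with the two additions by way of an arrow
  \<open>k\<close> between the addition pullbacks. The components of a natural transformation
  are of this form, with \<open>k\<close> another component.\<close>

lemma plus_natural:
  assumes B: "stable_bundle B" and B': "stable_bundle B'" and f: "f \<in> Arr C" "Dom C f = tot B" "Cod C f = tot B'"
    and k: "k \<in> Arr C" "Dom C k = Dom C (bfst B)" "Cod C k = Dom C (bfst B')"
    and add: "\<And>h. el h (Dom C (bfst B)) \<Longrightarrow> f \<cdot> (badd B \<cdot> h) = badd B' \<cdot> (k \<cdot> h)"
    and fst: "\<And>h. el h (Dom C (bfst B)) \<Longrightarrow> bfst B' \<cdot> (k \<cdot> h) = f \<cdot> (bfst B \<cdot> h)"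
    and snd: "\<And>h. el h (Dom C (bfst B)) \<Longrightarrow> bsnd B' \<cdot> (k \<cdot> h) = f \<cdot> (bsnd B \<cdot> h)"
    and uv: "el u (tot B)" "el v (tot B)" "Dom C u = Dom C v" "bproj B \<cdot> u = bproj B \<cdot> v"
  shows "f \<cdot> (u +[B] v) = f \<cdot> u +[B'] f \<cdot> v"
proof -
  note pb = additive_bundle.bundle_pullback[OF stable_additive[OF B]]
  note pb' = additive_bundle.bundle_pullback[OF stable_additive[OF B']]
  let ?h = "pair_arr C (bfst B) (bsnd B) u v"
  note h = pullback_pair[OF pb uv]
  have e: "el (f \<cdot> u) (tot B')" "el (f \<cdot> v) (tot B')" "Dom C (f \<cdot> u) = Dom C (f \<cdot> v)"
    using f uv by simp_all
  have kh: "el (k \<cdot> ?h) (Dom C (bfst B'))" "Dom C (k \<cdot> ?h) = Dom C u"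
    "bfst B' \<cdot> (k \<cdot> ?h) = f \<cdot> u" "bsnd B' \<cdot> (k \<cdot> ?h) = f \<cdot> v"
    using k h(1,2) fst[OF h(1)] snd[OF h(1)] h(3,4) by simp_all
  have sq: "bproj B' \<cdot> (f \<cdot> u) = bproj B' \<cdot> (f \<cdot> v)"
    using pullback_square[OF pb' kh(1)] kh(3,4) by simp
  note h' = pullback_pair[OF pb' e sq]
  have "k \<cdot> ?h = pair_arr C (bfst B') (bsnd B') (f \<cdot> u) (f \<cdot> v)"
    by (rule pullback_eqI[OF pb' kh(1) h'(1)]) (use kh h'(2-4) f uv in simp_all)
  then show ?thesis using add[OF h(1)] by (simp add: bplus_def)
qed

lemma bundle_morphism_facts:
  assumes "additive_bundle_morphism C B B' f1 f0"
  shows "f1 \<in> Arr C" "Dom C f1 = tot B" "Cod C f1 = tot B'"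
    "f0 \<in> Arr C" "Dom C f0 = base B" "Cod C f0 = base B'"
  using assms by (auto simp: additive_bundle_morphism_def homset_def)

lemma bundle_morphism_proj:
  assumes "additive_bundle_morphism C B B' f1 f0" "stable_bundle B" "stable_bundle B'" "el u (tot B)"
  shows "bproj B' \<cdot> (f1 \<cdot> u) = f0 \<cdot> (bproj B \<cdot> u)"
  by (rule comp_square) (use assms bundle_morphism_facts[OF assms(1)] in \<open>auto simp: additive_bundle_morphism_def\<close>)

lemma bundle_morphism_zero:
  assumes "additive_bundle_morphism C B B' f1 f0" "stable_bundle B" "stable_bundle B'" "el m (base B)"
  shows "f1 \<cdot> (bzero B \<cdot> m) = bzero B' \<cdot> (f0 \<cdot> m)"
  by (rule comp_square) (use assms bundle_morphism_facts[OF assms(1)] in \<open>auto simp: additive_bundle_morphism_def\<close>)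

lemma bundle_morphism_plus:
  assumes f: "additive_bundle_morphism C B B' f1 f0" "stable_bundle B" "stable_bundle B'"
    and uv: "el u (tot B)" "el v (tot B)" "Dom C u = Dom C v" "bproj B \<cdot> u = bproj B \<cdot> v"
  shows "f1 \<cdot> (u +[B] v) = f1 \<cdot> u +[B'] f1 \<cdot> v"
proof -
  note ff = bundle_morphism_facts[OF f(1)]
  note pb = additive_bundle.bundle_pullback[OF stable_additive[OF f(2)]]
  let ?h = "pair_arr C (bfst B) (bsnd B) u v"
  note h = pullback_pair[OF pb uv]
  have fs: "el (bfst B) (tot B)" "el (bsnd B) (tot B)"
    using f(2) by (simp_all add: el_def)
  have sq: "bproj B \<cdot> bfst B = bproj B \<cdot> bsnd B" by (rule pullback_arr(8)[OF pb])
  have sq': "bproj B' \<cdot> (f1 \<cdot> bfst B) = bproj B' \<cdot> (f1 \<cdot> bsnd B)"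
    using bundle_morphism_proj[OF f fs(1)] bundle_morphism_proj[OF f fs(2)] sq by simp
  have "f1 \<cdot> (u +[B] v) = (f1 \<cdot> badd B) \<cdot> ?h" using ff f(2) h by (simp add: bplus_def)
  also have "f1 \<cdot> badd B = (f1 \<cdot> bfst B) +[B'] (f1 \<cdot> bsnd B)"
    using f(1) by (simp add: additive_bundle_morphism_def)
  also have "\<dots> \<cdot> ?h = f1 \<cdot> u +[B'] f1 \<cdot> v"
    using plus_comp[OF stable_additive[OF f(3)], of "f1 \<cdot> bfst B" "f1 \<cdot> bsnd B" ?h] sq' ff f(2) fs h by simp
  finally show ?thesis .
qed

lemma bundle_morphism_T:
  assumes f: "additive_bundle_morphism C B B' f1 f0" "stable_bundle B" "stable_bundle B'"
  shows "additive_bundle_morphism C (T_bundle C B) (T_bundle C B') (T f1) (T f0)"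
proof -
  note ff = bundle_morphism_facts[OF f(1)]
  note pb = additive_bundle.bundle_pullback[OF stable_additive[OF f(2)]]
  have fs: "el (bfst B) (tot B)" "el (bsnd B) (tot B)" "el (badd B) (tot B)"
     "el (bzero B) (tot B)" "el (bproj B) (base B)" "el f1 (tot B')" "el f0 (base B')"
    using f(2) ff by (simp_all add: el_def)
  have sq: "bproj B \<cdot> bfst B = bproj B \<cdot> bsnd B" by (rule pullback_arr(8)[OF pb])
  have sq': "bproj B' \<cdot> (f1 \<cdot> bfst B) = bproj B' \<cdot> (f1 \<cdot> bsnd B)"
    using bundle_morphism_proj[OF f fs(1)] bundle_morphism_proj[OF f fs(2)] sq by simp
  have 1: "T (bproj B') \<cdot> T f1 = T f0 \<cdot> T (bproj B)"
    by (rule TA_cong) (use f ff fs in \<open>auto simp: additive_bundle_morphism_def\<close>)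
  have 2: "T f1 \<cdot> T (bzero B) = T (bzero B') \<cdot> T f0"
    by (rule TA_cong) (use f ff fs in \<open>auto simp: additive_bundle_morphism_def\<close>)
  have "T f1 \<cdot> T (badd B) = T ((f1 \<cdot> bfst B) +[B'] (f1 \<cdot> bsnd B))"
    by (rule TA_eq) (use f ff fs in \<open>auto simp: additive_bundle_morphism_def\<close>)
  also have "\<dots> = T f1 \<cdot> T (bfst B) +[T_bundle C B'] T f1 \<cdot> T (bsnd B)"
    using TA_plus[OF f(3), of "f1 \<cdot> bfst B" "f1 \<cdot> bsnd B"] sq' ff f(2) fs by simp
  finally show ?thesis
    using 1 2 ff f(2,3) by (simp add: additive_bundle_morphism_def homset_def)
qed

end

context tangent_category_with_negatives
begin

lemma stable_tangent_bundle [simp]: "M \<in> Obj C \<Longrightarrow> stable_bundle (tangent_bundle C M)"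
  using stable_bundleI[OF tangent_additive] tangent_powers tangent_negatives by simp

lemma TA_tangent_morphism:
  assumes "f \<in> Arr C"
  shows "additive_bundle_morphism C (tangent_bundle C (Dom C f)) (tangent_bundle C (Cod C f)) (T f) f"
proof -
  have f: "f \<in> homset C (Dom C f) (Cod C f)" using assms by (simp add: homset_def)
  show ?thesis
    using tproj_nat[OF f] tzero_nat[OF f] tadd_nat[OF f] assms
    by (simp add: additive_bundle_morphism_def homset_def)
qed

lemma TA_tplus [simp]:
  assumes "f \<in> Arr C" "Dom C f = M" "el u (TO C M)" "el v (TO C M)" "Dom C u = Dom C v" "tproj C M \<cdot> u = tproj C M \<cdot> v"
  shows "T f \<cdot> (u +[tangent_bundle C M] v) = T f \<cdot> u +[tangent_bundle C (Cod C f)] T f \<cdot> v"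
  using bundle_morphism_plus[OF TA_tangent_morphism[OF assms(1)], of u v] assms by auto

lemma TTA_Ttplus [simp]:
  assumes "f \<in> Arr C" "Dom C f = M" "el u (TO C (TO C M))" "el v (TO C (TO C M))" "Dom C u = Dom C v"
    "T (tproj C M) \<cdot> u = T (tproj C M) \<cdot> v"
  shows "T (T f) \<cdot> (u +[T_bundle C (tangent_bundle C M)] v)
    = T (T f) \<cdot> u +[T_bundle C (tangent_bundle C (Cod C f))] T (T f) \<cdot> v"
  using bundle_morphism_plus[OF bundle_morphism_T[OF TA_tangent_morphism[OF assms(1)]], of u v] assms by auto

lemma flip_Ttplus [simp]:
  assumes "M \<in> Obj C" "el u (TO C (TO C M))" "el v (TO C (TO C M))" "Dom C u = Dom C v"
    "T (tproj C M) \<cdot> u = T (tproj C M) \<cdot> v"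
  shows "tflip C M \<cdot> (u +[T_bundle C (tangent_bundle C M)] v)
    = tflip C M \<cdot> u +[tangent_bundle C (TO C M)] tflip C M \<cdot> v"
  using bundle_morphism_plus[OF tflip_additive[OF assms(1)], of u v] assms by auto

lemma flip_tplus [simp]:
  assumes "M \<in> Obj C" "el u (TO C (TO C M))" "el v (TO C (TO C M))" "Dom C u = Dom C v"
    "tproj C (TO C M) \<cdot> u = tproj C (TO C M) \<cdot> v"
  shows "tflip C M \<cdot> (u +[tangent_bundle C (TO C M)] v)
    = tflip C M \<cdot> u +[T_bundle C (tangent_bundle C M)] tflip C M \<cdot> v"
  by (rule flip_eqD[of M]) (use assms in simp_all)

lemma tproj_Tplus [simp]:
  assumes "stable_bundle B" "tot B = E" "el u (TO C E)" "el v (TO C E)" "Dom C u = Dom C v"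
    "T (bproj B) \<cdot> u = T (bproj B) \<cdot> v"
  shows "tproj C E \<cdot> (u +[T_bundle C B] v) = tproj C E \<cdot> u +[B] tproj C E \<cdot> v"
  by (rule plus_natural[where k = "tproj C (Dom C (bfst B))"]) (use assms in auto)

lemma tzero_plus [simp]:
  assumes "stable_bundle B" "tot B = E" "el u E" "el v E" "Dom C u = Dom C v" "bproj B \<cdot> u = bproj B \<cdot> v"
  shows "tzero C E \<cdot> (u +[B] v) = tzero C E \<cdot> u +[T_bundle C B] tzero C E \<cdot> v"
  by (rule plus_natural[where k = "tzero C (Dom C (bfst B))"]) (use assms in auto)

lemma flip_TTplus [simp]:
  assumes "stable_bundle B" "tot B = E" "el u (TO C (TO C E))" "el v (TO C (TO C E))" "Dom C u = Dom C v"
    "T (T (bproj B)) \<cdot> u = T (T (bproj B)) \<cdot> v"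
  shows "tflip C E \<cdot> (u +[T_bundle C (T_bundle C B)] v) = tflip C E \<cdot> u +[T_bundle C (T_bundle C B)] tflip C E \<cdot> v"
  by (rule plus_natural[where k = "tflip C (Dom C (bfst B))"]) (use assms in auto)

lemma lift_Tplus [simp]:
  assumes "stable_bundle B" "tot B = E" "el u (TO C E)" "el v (TO C E)" "Dom C u = Dom C v"
    "T (bproj B) \<cdot> u = T (bproj B) \<cdot> v"
  shows "tlift C E \<cdot> (u +[T_bundle C B] v) = tlift C E \<cdot> u +[T_bundle C (T_bundle C B)] tlift C E \<cdot> v"
  by (rule plus_natural[where k = "tlift C (Dom C (bfst B))"]) (use assms in auto)

text \<open>On \<open>T(B)\<close> the addition over \<open>p\<close> and the addition obtained by applying \<open>T\<close> satisfy the
  interchange law, because the addition over \<open>p\<close> is natural.\<close>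

lemma interchange:
  assumes B: "stable_bundle B" "tot B = E"
    and el: "el u (TO C E)" "el v (TO C E)" "el u' (TO C E)" "el v' (TO C E)"
    and dom: "Dom C v = Dom C u" "Dom C u' = Dom C u" "Dom C v' = Dom C u"
    and q: "T (bproj B) \<cdot> u = T (bproj B) \<cdot> v" "T (bproj B) \<cdot> u' = T (bproj B) \<cdot> v'"
    and p: "tproj C E \<cdot> u = tproj C E \<cdot> u'" "tproj C E \<cdot> v = tproj C E \<cdot> v'"
  shows "(u +[T_bundle C B] v) +[tangent_bundle C E] (u' +[T_bundle C B] v')
    = (u +[tangent_bundle C E] u') +[T_bundle C B] (v +[tangent_bundle C E] v')"
proof -
  note pb = additive_bundle.bundle_pullback[OF stable_additive[OF B(1)]]
  note pbT = stable_pullback_T[OF B(1)]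
  let ?D = "Dom C (bfst B)" and ?t = "tangent_bundle C E"
  let ?h = "pair_arr C (T (bfst B)) (T (bsnd B)) u v"
  let ?h' = "pair_arr C (T (bfst B)) (T (bsnd B)) u' v'"
  have O: "E \<in> Obj C" "?D \<in> Obj C" using B arr_obj by auto
  have D: "Dom C (T (bproj B)) = TO C E" using B by simp
  note h = pullback_pair[OF pbT, unfolded D, OF el(1,2) dom(1)[symmetric] q(1)]
  have dom': "Dom C u' = Dom C v'" using dom by simp
  note h' = pullback_pair[OF pbT, unfolded D, OF el(3,4) dom' q(2)]
  have hD: "el ?h (TO C ?D)" "el ?h' (TO C ?D)" "Dom C ?h = Dom C ?h'" "Dom C ?h = Dom C u"
    using h(1,2) h'(1,2) B dom by simp_all
  have ph: "tproj C ?D \<cdot> ?h = tproj C ?D \<cdot> ?h'"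
  proof (rule pullback_eqI[OF pb])
    show "bfst B \<cdot> (tproj C ?D \<cdot> ?h) = bfst B \<cdot> (tproj C ?D \<cdot> ?h')"
      using tproj_natural[of "bfst B" E ?h] tproj_natural[of "bfst B" E ?h'] B hD h(3) h'(3) p by simp
    show "bsnd B \<cdot> (tproj C ?D \<cdot> ?h) = bsnd B \<cdot> (tproj C ?D \<cdot> ?h')"
      using tproj_natural[of "bsnd B" E ?h] tproj_natural[of "bsnd B" E ?h'] B hD h(4) h'(4) p by simp
  qed (use O hD in simp_all)
  note s = TA_tplus[OF _ _ hD(1-3) ph]
  let ?s = "?h +[tangent_bundle C ?D] ?h'"
  have se: "el ?s (TO C ?D)" "Dom C ?s = Dom C u" using O hD ph by simp_all
  have s1: "T (bfst B) \<cdot> ?s = u +[?t] u'" using s[of "bfst B"] B h h' by simp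
  have s2: "T (bsnd B) \<cdot> ?s = v +[?t] v'" using s[of "bsnd B"] B h h' by simp
  have U: "el (u +[?t] u') (TO C E)" "el (v +[?t] v') (TO C E)" "Dom C (u +[?t] u') = Dom C (v +[?t] v')"
    "Dom C (u +[?t] u') = Dom C u"
    using O el dom p by simp_all
  have UQ: "T (bproj B) \<cdot> (u +[?t] u') = T (bproj B) \<cdot> (v +[?t] v')"
    using pullback_square[OF pbT, of ?s] se B by (simp only: s1 s2) simp
  note k = pullback_pair[OF pbT, unfolded D, OF U(1-3) UQ]
  have "?s = pair_arr C (T (bfst B)) (T (bsnd B)) (u +[?t] u') (v +[?t] v')"
    by (rule pullback_eqI[OF pbT _ k(1)]) (use se B k U in \<open>simp_all add: s1 s2 del: TA_tplus\<close>)
  then have "(u +[?t] u') +[T_bundle C B] (v +[?t] v') = T (badd B) \<cdot> ?s"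
    by (simp add: bplus_def)
  also have "\<dots> = T (badd B) \<cdot> ?h +[?t] T (badd B) \<cdot> ?h'"
    using s[of "badd B"] B by simp
  finally show ?thesis by (simp add: bplus_def[of C "T_bundle C B"])
qed

section \<open>Fibrewise group laws\<close>

lemma fibre_plus_commute:
  "\<lbrakk>stable_bundle B; el u (tot B); el v (tot B); Dom C u = Dom C v; bproj B \<cdot> u = bproj B \<cdot> v\<rbrakk>
    \<Longrightarrow> u +[B] v = v +[B] u"
  by (rule plus_commute[OF stable_additive])

lemma fibre_plus_assoc:
  "\<lbrakk>stable_bundle B; el u (tot B); el v (tot B); el w (tot B); Dom C u = Dom C v; Dom C v = Dom C w;
     bproj B \<cdot> u = bproj B \<cdot> v; bproj B \<cdot> v = bproj B \<cdot> w\<rbrakk>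
    \<Longrightarrow> (u +[B] v) +[B] w = u +[B] (v +[B] w)"
  by (rule plus_assoc[OF stable_additive])

lemma fibre_plus_swap:
  assumes "stable_bundle B" "el u (tot B)" "el v (tot B)" "el w (tot B)" "Dom C u = Dom C v" "Dom C v = Dom C w"
     "bproj B \<cdot> u = bproj B \<cdot> v" "bproj B \<cdot> v = bproj B \<cdot> w"
   shows "(u +[B] v) +[B] w = (u +[B] w) +[B] v"
proof -
  have "(u +[B] v) +[B] w = u +[B] (v +[B] w)" by (rule fibre_plus_assoc[OF assms])
  also have "v +[B] w = w +[B] v" by (rule fibre_plus_commute[OF assms(1,3,4,6,8)])
  also have "u +[B] (w +[B] v) = (u +[B] w) +[B] v"
    by (rule fibre_plus_assoc[symmetric]) (use assms in simp_all)
  finally show ?thesis .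
qed

lemma fibre_plus_zero:
  "\<lbrakk>stable_bundle B; bzero B = z; el u (tot B); bproj B \<cdot> u = m\<rbrakk> \<Longrightarrow> u +[B] (z \<cdot> m) = u"
  using plus_zero[OF stable_additive] by blast

lemma fibre_zero_plus:
  "\<lbrakk>stable_bundle B; bzero B = z; el u (tot B); bproj B \<cdot> u = m\<rbrakk> \<Longrightarrow> (z \<cdot> m) +[B] u = u"
  using zero_plus[OF stable_additive] by blast

lemma fibre_plus_comp:
  "\<lbrakk>stable_bundle B; el u (tot B); el v (tot B); Dom C u = Dom C v; bproj B \<cdot> u = bproj B \<cdot> v; el t (Dom C u)\<rbrakk>
    \<Longrightarrow> (u +[B] v) \<cdot> t = u \<cdot> t +[B] v \<cdot> t"
  by (rule plus_comp[OF stable_additive])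

lemma fibre_plus_cancel_right:
  assumes "stable_bundle B" "el u (tot B)" "el v (tot B)" "el w (tot B)"
      "Dom C u = Dom C w" "Dom C v = Dom C w" "bproj B \<cdot> u = bproj B \<cdot> w" "bproj B \<cdot> v = bproj B \<cdot> w"
      "u +[B] w = v +[B] w"
  shows "u = v"
  using plus_cancel[OF stable_additive[OF assms(1)] _ assms(2-9)] assms(1) by (simp add: stable_bundle_def)

lemma fibre_plus_cancel_left:
  assumes "stable_bundle B" "el u (tot B)" "el v (tot B)" "el w (tot B)"
      "Dom C u = Dom C w" "Dom C v = Dom C w" "bproj B \<cdot> u = bproj B \<cdot> w" "bproj B \<cdot> v = bproj B \<cdot> w"
      "w +[B] u = w +[B] v"
  shows "u = v"
proof (rule fibre_plus_cancel_right[OF assms(1-8)])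
  show "u +[B] w = v +[B] w"
    using fibre_plus_commute[OF assms(1,2,4,5,7)] fibre_plus_commute[OF assms(1,3,4,6,8)] assms(9) by simp
qed

lemma fibre_plus_exchange:
  assumes B: "stable_bundle B" and e: "el a (tot B)" "el b (tot B)" "el c (tot B)" "el d (tot B)"
    "Dom C b = Dom C a" "Dom C c = Dom C a" "Dom C d = Dom C a"
    "bproj B \<cdot> b = bproj B \<cdot> a" "bproj B \<cdot> c = bproj B \<cdot> a" "bproj B \<cdot> d = bproj B \<cdot> a"
  shows "(a +[B] b) +[B] (c +[B] d) = (a +[B] c) +[B] (b +[B] d)"
proof -
  have "(a +[B] b) +[B] (c +[B] d) = ((a +[B] b) +[B] c) +[B] d"
    by (rule fibre_plus_assoc[symmetric]) (use B e in simp_all)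
  also have "(a +[B] b) +[B] c = (a +[B] c) +[B] b"
    by (rule fibre_plus_swap) (use B e in simp_all)
  also have "\<dots> +[B] d = (a +[B] c) +[B] (b +[B] d)"
    by (rule fibre_plus_assoc) (use B e in simp_all)
  finally show ?thesis .
qed

section \<open>Lifts\<close>

text \<open>The properties of the lift of a differential bundle that the calculations use: additivity over the two
  structures of \<open>T(B)\<close> and injectivity on generalised elements. Tangent bundles with \<open>l\<close> and differential
  bundles are both instances.\<close>

definition is_lift :: "('a, 'b) additive_bundle_data_scheme \<Rightarrow> 'a \<Rightarrow> bool" where
  "is_lift B lam \<longleftrightarrow> stable_bundle B
     \<and> additive_bundle_morphism C B (T_bundle C B) lam (tzero C (base B))
     \<and> additive_bundle_morphism C B (tangent_bundle C (tot B)) lam (bzero B)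
     \<and> (\<forall>u v. el u (tot B) \<longrightarrow> el v (tot B) \<longrightarrow> Dom C u = Dom C v
          \<longrightarrow> lam \<cdot> u = lam \<cdot> v \<longrightarrow> u = v)"

text \<open>The arrow \<open>\<mu>(a, b) = T(+)(0a, \<lambda>b)\<close> on generalised elements, for a bundle \<open>B\<close> with lift \<open>lam\<close>.\<close>

definition mu :: "('a, 'b) additive_bundle_data_scheme \<Rightarrow> 'a \<Rightarrow> 'a \<Rightarrow> 'a \<Rightarrow> 'a" where
  "mu B lam a b = (tzero C (tot B) \<cdot> a) +[T_bundle C B] (lam \<cdot> b)"

context
  fixes B :: "('a, 'b) additive_bundle_data_scheme" and lam :: 'a
  assumes lift: "is_lift B lam"
begin

lemma lift_stable: "stable_bundle B" and
  lift_TB: "additive_bundle_morphism C B (T_bundle C B) lam (tzero C (base B))" and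
  lift_tb: "additive_bundle_morphism C B (tangent_bundle C (tot B)) lam (bzero B)" and
  lift_inj: "\<And>u v. \<lbrakk>lam \<cdot> u = lam \<cdot> v; el u (tot B); el v (tot B); Dom C u = Dom C v\<rbrakk> \<Longrightarrow> u = v"
  using lift by (auto simp: is_lift_def)

lemma stable_T_t: "stable_bundle (T_bundle C B)" "stable_bundle (tangent_bundle C (tot B))"
  using lift_stable by simp_all

lemma lam_arr: "lam \<in> Arr C" "Dom C lam = tot B" "Cod C lam = TO C (tot B)"
  using bundle_morphism_facts[OF lift_TB] lift_stable by simp_all

lemma T_proj_lam: "el u (tot B) \<Longrightarrow> T (bproj B) \<cdot> (lam \<cdot> u) = tzero C (base B) \<cdot> (bproj B \<cdot> u)"
  using bundle_morphism_proj[OF lift_TB lift_stable stable_T_t(1)] by simp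

lemma proj_lam: "el u (tot B) \<Longrightarrow> tproj C (tot B) \<cdot> (lam \<cdot> u) = bzero B \<cdot> (bproj B \<cdot> u)"
  using bundle_morphism_proj[OF lift_tb lift_stable stable_T_t(2)] by simp

lemma lam_zero: "el m (base B) \<Longrightarrow> lam \<cdot> (bzero B \<cdot> m) = tzero C (tot B) \<cdot> (bzero B \<cdot> m)"
  using bundle_morphism_zero[OF lift_tb lift_stable stable_T_t(2)] by simp

lemma lam_plus_T:
  "\<lbrakk>el u (tot B); el v (tot B); Dom C u = Dom C v; bproj B \<cdot> u = bproj B \<cdot> v\<rbrakk>
    \<Longrightarrow> lam \<cdot> (u +[B] v) = lam \<cdot> u +[T_bundle C B] lam \<cdot> v"
  by (rule bundle_morphism_plus[OF lift_TB lift_stable stable_T_t(1)])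

lemma lam_plus_t:
  "\<lbrakk>el u (tot B); el v (tot B); Dom C u = Dom C v; bproj B \<cdot> u = bproj B \<cdot> v\<rbrakk>
    \<Longrightarrow> lam \<cdot> (u +[B] v) = lam \<cdot> u +[tangent_bundle C (tot B)] lam \<cdot> v"
  by (rule bundle_morphism_plus[OF lift_tb lift_stable stable_T_t(2)])

lemmas lam_simps = lift_stable stable_T_t lam_arr T_proj_lam proj_lam lam_zero

lemma mu_facts:
  assumes "el a (tot B)" "el b (tot B)" "Dom C b = Dom C a" "bproj B \<cdot> a = bproj B \<cdot> b"
  shows mu_el: "el (mu B lam a b) (TO C (tot B))"
    and mu_dom: "Dom C (mu B lam a b) = Dom C a"
    and mu_proj: "tproj C (tot B) \<cdot> mu B lam a b = a"
    and mu_T_proj: "T (bproj B) \<cdot> mu B lam a b = tzero C (base B) \<cdot> (bproj B \<cdot> a)"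
proof -
  show "el (mu B lam a b) (TO C (tot B))" "Dom C (mu B lam a b) = Dom C a"
    "T (bproj B) \<cdot> mu B lam a b = tzero C (base B) \<cdot> (bproj B \<cdot> a)"
    unfolding mu_def using assms by (simp_all add: lam_simps)
  have "tproj C (tot B) \<cdot> mu B lam a b = a +[B] (bzero B \<cdot> (bproj B \<cdot> b))"
    unfolding mu_def using assms by (simp add: lam_simps)
  then show "tproj C (tot B) \<cdot> mu B lam a b = a"
    using fibre_plus_zero[OF lift_stable refl assms(1,4)] by simp
qed

lemma mu_zero:
  assumes "el a (tot B)"
  shows "mu B lam a (bzero B \<cdot> (bproj B \<cdot> a)) = tzero C (tot B) \<cdot> a"
proof -
  have "mu B lam a (bzero B \<cdot> (bproj B \<cdot> a)) =
    (tzero C (tot B) \<cdot> a) +[T_bundle C B] (T (bzero B) \<cdot> (tzero C (base B) \<cdot> (bproj B \<cdot> a)))"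
    unfolding mu_def using assms by (simp add: lam_simps)
  also have "\<dots> = tzero C (tot B) \<cdot> a"
    by (rule fibre_plus_zero) (use assms in \<open>simp_all add: lam_simps\<close>)
  finally show ?thesis .
qed

lemma mu_at_zero:
  assumes "el b (tot B)" "bproj B \<cdot> b = m"
  shows "mu B lam (bzero B \<cdot> m) b = lam \<cdot> b"
proof -
  have m: "el m (base B)" "Dom C m = Dom C b" using assms lift_stable by auto
  have "mu B lam (bzero B \<cdot> m) b = (T (bzero B) \<cdot> (tzero C (base B) \<cdot> m)) +[T_bundle C B] (lam \<cdot> b)"
    unfolding mu_def using m by (simp add: lam_simps)
  also have "\<dots> = lam \<cdot> b"
    by (rule fibre_zero_plus) (use assms in \<open>simp_all add: lam_simps\<close>)
  finally show ?thesis .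
qed

lemma mu_plus:
  assumes "el a (tot B)" "el b (tot B)" "el b' (tot B)" "Dom C b = Dom C a" "Dom C b' = Dom C a"
    "bproj B \<cdot> a = bproj B \<cdot> b" "bproj B \<cdot> b' = bproj B \<cdot> b"
  shows "mu B lam a (b +[B] b') = mu B lam a b +[tangent_bundle C (tot B)] mu B lam a b'"
proof -
  let ?t = "tangent_bundle C (tot B)" and ?z = "tzero C (tot B) \<cdot> a"
  have "mu B lam a b +[?t] mu B lam a b' = (?z +[?t] ?z) +[T_bundle C B] (lam \<cdot> b +[?t] lam \<cdot> b')"
    unfolding mu_def by (rule interchange) (use assms in \<open>simp_all add: lam_simps\<close>)
  also have "?z +[?t] ?z = ?z"
    by (rule fibre_plus_zero) (use assms in \<open>simp_all add: lam_simps\<close>)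
  also have "lam \<cdot> b +[?t] lam \<cdot> b' = lam \<cdot> (b +[B] b')"
    by (rule lam_plus_t[symmetric]) (use assms in simp_all)
  finally show ?thesis unfolding mu_def by simp
qed

lemma mu_plus_plus:
  assumes "el a (tot B)" "el a' (tot B)" "el b (tot B)" "el b' (tot B)"
    "Dom C a' = Dom C a" "Dom C b = Dom C a" "Dom C b' = Dom C a"
    "bproj B \<cdot> a' = bproj B \<cdot> a" "bproj B \<cdot> b = bproj B \<cdot> a" "bproj B \<cdot> b' = bproj B \<cdot> a"
  shows "mu B lam (a +[B] a') (b +[B] b') = mu B lam a b +[T_bundle C B] mu B lam a' b'"
proof -
  let ?T = "T_bundle C B" and ?z = "tzero C (tot B)"
  have "mu B lam a b +[?T] mu B lam a' b' = (?z \<cdot> a +[?T] ?z \<cdot> a') +[?T] (lam \<cdot> b +[?T] lam \<cdot> b')"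
    unfolding mu_def by (rule fibre_plus_exchange) (use assms in \<open>simp_all add: lam_simps\<close>)
  also have "\<dots> = mu B lam (a +[B] a') (b +[B] b')"
    unfolding mu_def using lam_plus_T[of b b'] assms by (simp add: lam_simps)
  finally show ?thesis by simp
qed

lemma mu_inj:
  assumes "mu B lam a b = mu B lam a b'"
    "el a (tot B)" "el b (tot B)" "el b' (tot B)" "Dom C b = Dom C a" "Dom C b' = Dom C a"
    "bproj B \<cdot> b = bproj B \<cdot> a" "bproj B \<cdot> b' = bproj B \<cdot> a"
  shows "b = b'"
proof (rule lift_inj)
  show "lam \<cdot> b = lam \<cdot> b'"
    by (rule fibre_plus_cancel_left[OF stable_T_t(1), of _ _ "tzero C (tot B) \<cdot> a"])
      (use assms in \<open>simp_all add: lam_simps mu_def\<close>)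
qed (use assms in simp_all)

text \<open>A summand \<open>\<mu>(s, b)\<close> inside a sum for \<open>T(q)\<close> can be pulled out of it; its base point becomes
  the base point of the whole sum. This is the main computational rule below.\<close>

lemma plus_mu_shift:
  assumes "el t (TO C (tot B))" "el s (TO C (tot B))" "el b (tot B)"
    "Dom C s = Dom C t" "Dom C b = Dom C t" "T (bproj B) \<cdot> t = T (bproj B) \<cdot> s"
    and p: "tproj C (tot B) \<cdot> t = t0" "tproj C (tot B) \<cdot> s = s0" "bproj B \<cdot> b = bproj B \<cdot> s0"
  shows "t +[T_bundle C B] (s +[tangent_bundle C (tot B)] mu B lam s0 b)
    = (t +[T_bundle C B] s) +[tangent_bundle C (tot B)] mu B lam (t0 +[B] s0) b"
proof -
  let ?T = "T_bundle C B" and ?t = "tangent_bundle C (tot B)" and ?z = "tzero C (tot B)"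
  have e: "el t0 (tot B)" "el s0 (tot B)" "Dom C t0 = Dom C t" "Dom C s0 = Dom C t"
    using p(1,2) assms(1,2,4) lift_stable by auto
  have q: "bproj B \<cdot> t0 = bproj B \<cdot> s0"
  proof -
    have "bproj B \<cdot> t0 = tproj C (base B) \<cdot> (T (bproj B) \<cdot> t)"
      using p(1) assms(1) by (simp add: lam_simps)
    also have "\<dots> = bproj B \<cdot> s0" unfolding assms(6) using p(2) assms(2) by (simp add: lam_simps)
    finally show ?thesis .
  qed
  have qt: "T (bproj B) \<cdot> mu B lam s0 b = tzero C (base B) \<cdot> (bproj B \<cdot> s0)"
    by (rule mu_T_proj) (use e assms in simp_all)
  note m = mu_el[of s0 b] mu_dom[of s0 b] mu_proj[of s0 b]
  have "t = t +[?t] ?z \<cdot> t0"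
    by (rule fibre_plus_zero[symmetric]) (use assms in \<open>simp_all add: lam_simps\<close>)
  then have "t +[?T] (s +[?t] mu B lam s0 b) = (t +[?t] ?z \<cdot> t0) +[?T] (s +[?t] mu B lam s0 b)"
    by simp
  also have "\<dots> = (t +[?T] s) +[?t] (?z \<cdot> t0 +[?T] mu B lam s0 b)"
    by (rule interchange[symmetric]) (use assms e q m qt in \<open>simp_all add: lam_simps\<close>)
  also have "?z \<cdot> t0 +[?T] mu B lam s0 b = (?z \<cdot> t0 +[?T] ?z \<cdot> s0) +[?T] lam \<cdot> b"
    unfolding mu_def by (rule fibre_plus_assoc[symmetric]) (use e q assms in \<open>simp_all add: lam_simps\<close>)
  also have "\<dots> = mu B lam (t0 +[B] s0) b"
    unfolding mu_def using e q by (simp add: lam_simps)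
  finally show ?thesis .
qed

lemma plus_lam_shift:
  assumes "el t (TO C (tot B))" "el b (tot B)" "Dom C b = Dom C t"
    "T (bproj B) \<cdot> t = m"
    and p: "tproj C (tot B) \<cdot> t = t0" "bproj B \<cdot> b = bproj B \<cdot> t0"
  shows "t +[T_bundle C B] (T (bzero B) \<cdot> m +[tangent_bundle C (tot B)] lam \<cdot> b)
    = t +[tangent_bundle C (tot B)] mu B lam t0 b"
proof -
  let ?T = "T_bundle C B" and ?t = "tangent_bundle C (tot B)"
  have e: "el t0 (tot B)" "Dom C t0 = Dom C t" "el m (TO C (base B))" "Dom C m = Dom C t"
    using p assms(1,4) lift_stable by auto
  have pm: "tproj C (base B) \<cdot> m = bproj B \<cdot> t0"
    using tproj_natural[of "bproj B" "base B" t] assms lift_stable by simp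
  let ?s = "T (bzero B) \<cdot> m" and ?r = "bzero B \<cdot> (bproj B \<cdot> t0)"
  have "t +[?T] (?s +[?t] mu B lam ?r b) = (t +[?T] ?s) +[?t] mu B lam (t0 +[B] ?r) b"
    by (rule plus_mu_shift[where t = t and s = ?s and b = b and ?t0.0 = t0 and ?s0.0 = ?r]) (use e assms pm in \<open>simp_all add: lam_simps\<close>)
  moreover have "mu B lam ?r b = lam \<cdot> b"
    by (rule mu_at_zero) (use assms in simp_all)
  moreover have "t +[?T] ?s = t"
    by (rule fibre_plus_zero) (use assms in \<open>simp_all add: lam_simps\<close>)
  moreover have "t0 +[B] ?r = t0"
    by (rule fibre_plus_zero) (use e in \<open>simp_all add: lam_simps\<close>)
  ultimately show ?thesis by simp
qed

end

lemma equaliser_eqI: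
  assumes eq: "is_equaliser C f g e" and "el h (Dom C e)" "el k (Dom C e)" "Dom C h = Dom C k" "e \<cdot> h = e \<cdot> k"
  shows "h = k"
proof -
  note d = eq[unfolded is_equaliser_def]
  have ty: "f \<in> Arr C" "g \<in> Arr C" "e \<in> Arr C" "Dom C f = Dom C g" "Cod C e = Dom C f" "f \<cdot> e = g \<cdot> e"
    using d by auto
  have "f \<cdot> (e \<cdot> h) = g \<cdot> (e \<cdot> h)" by (rule comp_square) (use ty assms in simp_all)
  then have "e \<cdot> h \<in> homset C (Dom C h) (Dom C f) \<and> f \<cdot> (e \<cdot> h) = g \<cdot> (e \<cdot> h)"
    using assms(2) ty by (simp add: homset_iff)
  then have "\<exists>!x. x \<in> homset C (Dom C h) (Dom C e) \<and> e \<cdot> x = e \<cdot> h" using d by blast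
  then show ?thesis using assms(2-5) unfolding homset_iff by metis
qed

lemma pullback_sym:
  assumes "is_pullback C f g a b" shows "is_pullback C g f b a"
proof -
  have "\<exists>!h. h \<in> homset C X (Dom C b) \<and> b \<cdot> h = u \<and> a \<cdot> h = v"
    if "u \<in> homset C X (Dom C g)" "v \<in> homset C X (Dom C f)" "g \<cdot> u = f \<cdot> v" for X u v
  proof -
    have "\<exists>!h. h \<in> homset C X (Dom C a) \<and> a \<cdot> h = v \<and> b \<cdot> h = u"
      using assms that unfolding is_pullback_def by metis
    moreover have "Dom C a = Dom C b" using assms unfolding is_pullback_def by blast
    ultimately show ?thesis by (simp add: conj_commute)
  qed
  then show ?thesis using assms unfolding is_pullback_def by auto
qed

text \<open>\<open>T(\<lambda>)\<close> is monic if the image under \<open>T\<close> of \<open>\<mu>\<close> is. The two projections \<open>x\<close>, \<open>y\<close> are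
  left open, because the definitions of \<open>\<mu>\<close> for the tangent bundle and for a differential bundle take
  their arguments in opposite orders.\<close>

lemma T_lift_injective:
  assumes B: "stable_bundle B"
    and lam: "additive_bundle_morphism C B (T_bundle C B) lam (tzero C (base B))"
      "additive_bundle_morphism C B (tangent_bundle C (tot B)) lam (bzero B)"
    and pb0: "is_pullback C (bproj B) (bproj B) x y" and pb: "is_pullback C (T (bproj B)) (T (bproj B)) (T x) (T y)"
    and m: "m = (tzero C (tot B) \<cdot> x) +[T_bundle C B] (lam \<cdot> y)"
    and e: "is_equaliser C F G (T m)"
    and eq: "T lam \<cdot> u = T lam \<cdot> v"
    and uv: "el u (TO C (tot B))" "el v (TO C (tot B))" "Dom C u = Dom C v"
  shows "u = v"
proof -
  let ?q = "bproj B" and ?E = "tot B" and ?o = "tzero C (tot B)"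
  have O: "?E \<in> Obj C" "Cod C ?q \<in> Obj C" using B by simp_all
  note ff = bundle_morphism_facts(1-3)[OF lam(1)]
  have lq: "T ?q \<cdot> (lam \<cdot> w) = tzero C (Cod C ?q) \<cdot> (?q \<cdot> w)" if "el w ?E" for w
    using bundle_morphism_proj[OF lam(1) B stable_bundle_T[OF B] that] by simp
  have Tp: "T ?q \<cdot> (T (tproj C ?E) \<cdot> (T lam \<cdot> w)) = T ?q \<cdot> w" if w: "el w (TO C ?E)" for w
  proof -
    have "tproj C ?E \<cdot> lam = bzero B \<cdot> ?q"
      using lam(2) by (simp add: additive_bundle_morphism_def)
    then have "T (tproj C ?E) \<cdot> (T lam \<cdot> w) = T (bzero B) \<cdot> (T ?q \<cdot> w)"
      by (rule TA_square) (use O B ff w in simp_all)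
    then show ?thesis using B w by simp
  qed
  have puv: "T ?q \<cdot> u = T ?q \<cdot> v" using Tp[OF uv(1)] Tp[OF uv(2)] eq by simp
  \<comment> \<open>Since \<open>\<mu>(0, w)\<close> is \<open>\<lambda>w\<close>, it suffices to pair with the zero of the common fibre.\<close>
  let ?z = "T (bzero B) \<cdot> (T ?q \<cdot> v)"
  have D: "Dom C (T ?q) = TO C ?E" using B by simp
  have z: "el ?z (TO C ?E)" "Dom C ?z = Dom C v" "T ?q \<cdot> ?z = T ?q \<cdot> v" using B uv by simp_all
  let ?h = "\<lambda>w. pair_arr C (T x) (T y) ?z w"
  have fs: "x \<in> Arr C" "y \<in> Arr C" "Cod C x = ?E" "Cod C y = ?E" "Dom C y = Dom C x"
    using pullback_arr[OF pb0] by simp_all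
  have fel: "el x ?E" "el y ?E" using fs by (simp_all add: el_def)
  have sq: "?q \<cdot> x = ?q \<cdot> y" by (rule pullback_arr(8)[OF pb0])
  have hw: "el (?h w) (TO C (Dom C x))" "Dom C (?h w) = Dom C v" "T x \<cdot> ?h w = ?z" "T y \<cdot> ?h w = w"
    if w: "el w (TO C ?E)" "Dom C w = Dom C v" "T ?q \<cdot> w = T ?q \<cdot> v" for w
    using pullback_pair[OF pb, unfolded D, OF z(1) w(1)] w z fs by simp_all
  have ty: "el (?o \<cdot> x) (TO C ?E)" "el (lam \<cdot> y) (TO C ?E)"
    "Dom C (?o \<cdot> x) = Dom C x" "Dom C (lam \<cdot> y) = Dom C x"
    "T ?q \<cdot> (?o \<cdot> x) = T ?q \<cdot> (lam \<cdot> y)"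
    using O B fs fel sq ff lq by simp_all
  have me: "el m (TO C ?E)" "Dom C m = Dom C x"
    unfolding m using B O ty by simp_all
  have ma: "m \<in> Arr C" using me(1) by (simp add: el_def)
  have "T m = (T ?o \<cdot> T x) +[T_bundle C (T_bundle C B)] (T lam \<cdot> T y)"
    unfolding m using TA_plus[of "T_bundle C B", OF _ _ _ _] ty B O fs fel ff by simp
  moreover have "T (T ?q) \<cdot> (T ?o \<cdot> T x) = T (T ?q) \<cdot> (T lam \<cdot> T y)"
    using TA_cong[OF ty(5)] ty O B fs fel ff by simp
  ultimately have mh: "T m \<cdot> ?h w = (T ?o \<cdot> ?z) +[T_bundle C (T_bundle C B)] (T lam \<cdot> w)"
    if w: "el w (TO C ?E)" "Dom C w = Dom C v" "T ?q \<cdot> w = T ?q \<cdot> v" for w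
    using fibre_plus_comp[of "T_bundle C (T_bundle C B)" "T ?o \<cdot> T x" "T lam \<cdot> T y" "?h w"]
      hw[OF w] O B ff fs TA_el[OF fel(1)] TA_el[OF fel(2)] by simp
  have "?h u = ?h v"
  proof (rule equaliser_eqI[OF e])
    show "T m \<cdot> ?h u = T m \<cdot> ?h v"
      using mh[OF uv(1,3) puv] mh[OF uv(2) refl refl] eq by simp
  qed (use hw[OF uv(1,3) puv] hw[OF uv(2) refl refl] me ma in simp_all)
  then show ?thesis using hw(4)[OF uv(1,3) puv] hw(4)[OF uv(2) refl refl] by simp
qed

lemma tzero_injective:
  assumes "tzero C M \<cdot> u = tzero C M \<cdot> v" "el u M" "el v M" shows "u = v"
  using tproj_tzero[OF assms(2)] tproj_tzero[OF assms(3)] unfolding assms(1) by (rule trans[OF sym])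

text \<open>Additivity of \<open>l\<close> over \<open>p\<close> is additivity over \<open>T(p)\<close> composed with \<open>c\<close>.\<close>

lemma tlift_additive_t:
  assumes M: "M \<in> Obj C"
  shows "additive_bundle_morphism C (tangent_bundle C M) (tangent_bundle C (TO C M)) (tlift C M) (tzero C M)"
proof -
  let ?B = "tangent_bundle C M"
  have fs: "tfst C M \<in> Arr C" "tsnd C M \<in> Arr C" "tadd C M \<in> Arr C" "Cod C (tfst C M) = TO C M" "Cod C (tsnd C M) = TO C M"
    "Dom C (tsnd C M) = Dom C (tfst C M)" "Dom C (tadd C M) = Dom C (tfst C M)" "Cod C (tadd C M) = TO C M"
    using stable_arr[OF stable_tangent_bundle[OF M]] M by simp_all
  have fel: "el (tfst C M) (TO C M)" "el (tsnd C M) (TO C M)" "el (tadd C M) (TO C M)" using fs by (simp_all add: el_def)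
  have sq: "tproj C M \<cdot> tfst C M = tproj C M \<cdot> tsnd C M"
    using pullback_arr(8)[OF additive_bundle.bundle_pullback[OF tangent_additive[OF M]]] by simp
  have "tflip C M \<cdot> (tlift C M \<cdot> tadd C M) = tflip C M \<cdot> ((tlift C M \<cdot> tfst C M) +[T_bundle C ?B] (tlift C M \<cdot> tsnd C M))"
    using tlift_additive[OF M] by (simp add: additive_bundle_morphism_def)
  then have "tlift C M \<cdot> tadd C M = (tlift C M \<cdot> tfst C M) +[tangent_bundle C (TO C M)] (tlift C M \<cdot> tsnd C M)"
    using M fs fel sq by simp
  moreover have "tproj C (TO C M) \<cdot> tlift C M = tzero C M \<cdot> tproj C M"
    using tproj_lift[of M "Idn C (TO C M)"] M by simp
  moreover have "tlift C M \<cdot> tzero C M = tzero C (TO C M) \<cdot> tzero C M"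
    using lift_zero[of M "Idn C M"] M by simp
  ultimately show ?thesis
    using M by (simp add: additive_bundle_morphism_def homset_def)
qed

lemma T_tlift_injective:
  assumes M: "M \<in> Obj C" and eq: "T (tlift C M) \<cdot> u = T (tlift C M) \<cdot> v"
    and uv: "el u (TO C (TO C M))" "el v (TO C (TO C M))" "Dom C u = Dom C v"
  shows "u = v"
proof -
  have "is_equaliser C ((T ^^ 1) (T (tproj C M))) ((T ^^ 1) (tzero C M \<cdot> tproj C M \<cdot> tproj C (TO C M))) ((T ^^ 1) (tangent_mu C M))"
    using tangent_mu_equaliser[OF M] unfolding equaliser_preserved_def by blast
  then have e: "is_equaliser C (T (T (tproj C M))) (T (tzero C M \<cdot> tproj C M \<cdot> tproj C (TO C M))) (T (tangent_mu C M))" by simp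
  have m: "tangent_mu C M = (tzero C (Dom C (bproj (tangent_bundle C M))) \<cdot> tsnd C M)
     +[T_bundle C (tangent_bundle C M)] (tlift C M \<cdot> tfst C M)"
    using M by (simp add: tangent_mu_def)
  note pb0 = pullback_sym[OF additive_bundle.bundle_pullback[OF tangent_additive[OF M]]]
  note pb = pullback_sym[OF stable_pullback_T[OF stable_tangent_bundle[OF M]]]
  show ?thesis
    by (rule T_lift_injective[OF stable_tangent_bundle[OF M] _ _ pb0[simplified tangent_bundle_simps(3,4)] pb[simplified tangent_bundle_simps(3,4)] m e eq])
      (use M uv tlift_additive[OF M] tlift_additive_t[OF M] in simp_all)
qed

lemma tlift_injective:
  assumes "M \<in> Obj C" "tlift C M \<cdot> u = tlift C M \<cdot> v" "el u (TO C M)" "el v (TO C M)" "Dom C u = Dom C v"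
  shows "u = v"
proof -
  have "tzero C (TO C (TO C M)) \<cdot> (tlift C M \<cdot> u) = tzero C (TO C (TO C M)) \<cdot> (tlift C M \<cdot> v)"
    using assms(2) by simp
  then have "T (tlift C M) \<cdot> (tzero C (TO C M) \<cdot> u) = T (tlift C M) \<cdot> (tzero C (TO C M) \<cdot> v)"
    using assms by simp
  then have "tzero C (TO C M) \<cdot> u = tzero C (TO C M) \<cdot> v"
    by (rule T_tlift_injective[OF assms(1)]) (use assms in simp_all)
  then show ?thesis by (rule tzero_injective) (use assms in simp_all)
qed

lemma tlift_is_lift:
  assumes M: "M \<in> Obj C" shows "is_lift (tangent_bundle C M) (tlift C M)"
  unfolding is_lift_def using M tlift_additive[OF M] tlift_additive_t[OF M] tlift_injective[OF M] by auto

lemma mu_comp: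
  assumes "is_lift B lam" "el a (tot B)" "el b (tot B)" "Dom C b = Dom C a" "bproj B \<cdot> a = bproj B \<cdot> b" "el t (Dom C a)"
  shows "mu B lam a b \<cdot> t = mu B lam (a \<cdot> t) (b \<cdot> t)"
proof -
  note l = lam_simps[OF assms(1)]
  have eq: "mu B lam a b \<cdot> t = (tzero C (tot B) \<cdot> a) \<cdot> t +[T_bundle C B] (lam \<cdot> b) \<cdot> t"
    unfolding mu_def by (rule fibre_plus_comp) (use l assms in simp_all)
  have "a \<in> Arr C" "b \<in> Arr C" "Cod C a = tot B" "Cod C b = tot B" using assms by (simp_all add: el_def)
  then have "(tzero C (tot B) \<cdot> a) \<cdot> t = tzero C (tot B) \<cdot> (a \<cdot> t)" "(lam \<cdot> b) \<cdot> t = lam \<cdot> (b \<cdot> t)"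
    using l assms by simp_all
  then show ?thesis by (subst eq) (simp only: mu_def)
qed

lemma additive_bundle_morphismI:
  assumes B: "stable_bundle B" "stable_bundle B'" and f: "f1 \<in> Arr C" "Dom C f1 = tot B" "Cod C f1 = tot B'"
    "f0 \<in> Arr C" "Dom C f0 = base B" "Cod C f0 = base B'"
    and proj: "\<And>u. el u (tot B) \<Longrightarrow> bproj B' \<cdot> (f1 \<cdot> u) = f0 \<cdot> (bproj B \<cdot> u)"
    and plus: "\<And>u v. \<lbrakk>el u (tot B); el v (tot B); Dom C u = Dom C v; bproj B \<cdot> u = bproj B \<cdot> v\<rbrakk>
      \<Longrightarrow> f1 \<cdot> (u +[B] v) = f1 \<cdot> u +[B'] f1 \<cdot> v"
  shows "additive_bundle_morphism C B B' f1 f0"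
proof -
  note pb = additive_bundle.bundle_pullback[OF stable_additive[OF B(1)]]
  have fs: "el (bfst B) (tot B)" "el (bsnd B) (tot B)" "el (bzero B) (tot B)"
    using B by (simp_all add: el_def)
  have sq: "bproj B \<cdot> bfst B = bproj B \<cdot> bsnd B" by (rule pullback_arr(8)[OF pb])
  have "bproj B' \<cdot> f1 = f0 \<cdot> bproj B"
    using proj[of "Idn C (tot B)"] B f by simp
  moreover have "f1 \<cdot> bzero B = bzero B' \<cdot> f0"
  proof -
    let ?z = "bzero B" and ?z' = "bzero B'"
    have z: "el ?z (tot B)" "bproj B \<cdot> ?z = Idn C (base B)"
      using fs(3) additive_bundle.bproj_bzero[OF stable_additive[OF B(1)]] by simp_all
    have f0: "el f0 (base B')" using f by (simp add: el_def)
    have p: "bproj B' \<cdot> (f1 \<cdot> ?z) = f0" using proj[OF z(1)] z(2) f by simp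
    \<comment> \<open>Zero is preserved because it is the only idempotent of a group.\<close>
    have "?z +[B] ?z = ?z"
      using fibre_plus_zero[OF B(1) refl z] B by simp
    then have "f1 \<cdot> ?z +[B'] f1 \<cdot> ?z = f1 \<cdot> ?z" using plus[OF z(1) z(1)] by simp
    also have "\<dots> = f1 \<cdot> ?z +[B'] (?z' \<cdot> f0)"
      by (rule fibre_plus_zero[symmetric, OF B(2) refl _ p]) (use f z in simp_all)
    finally show ?thesis
      by (rule fibre_plus_cancel_left[OF B(2), rotated -1]) (use f f0 z B p in simp_all)
  qed
  moreover have "f1 \<cdot> badd B = bplus C B' (f1 \<cdot> bfst B) (f1 \<cdot> bsnd B)"
  proof -
    note h = pullback_pair[OF pb fs(1,2) _ sq]
    have d: "Dom C (bfst B) = Dom C (bsnd B)" using B by simp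
    have "pair_arr C (bfst B) (bsnd B) (bfst B) (bsnd B) = Idn C (Dom C (bfst B))"
      by (rule pullback_eqI[OF pb h(1)[OF d]]) (use h(2-4)[OF d] B in simp_all)
    then have "bfst B +[B] bsnd B = badd B" using B by (simp add: bplus_def)
    then show ?thesis using plus[OF fs(1,2) d sq] by simp
  qed
  ultimately show ?thesis using f by (simp add: additive_bundle_morphism_def homset_def)
qed

end

context tangent_category
begin

lemma T_tzero_natural [simp]:
  assumes "f \<in> Arr C" "Dom C f = N" "el u (TO C N)"
  shows "T (T f) \<cdot> (T (tzero C N) \<cdot> u) = T (tzero C (Cod C f)) \<cdot> (T f \<cdot> u)"
  by (rule TA_square[OF tzero_nat[of f N "Cod C f", symmetric]]) (use assms in \<open>auto simp: homset_def\<close>)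

end

context tangent_category_with_negatives
begin

lemma tproj_tzero_idn [simp]: "N \<in> Obj C \<Longrightarrow> tproj C N \<cdot> tzero C N = Idn C N"
  using tproj_tzero[of "Idn C N" N] by simp

lemma stable_proj_zero_idn [simp]: "stable_bundle B \<Longrightarrow> bproj B \<cdot> bzero B = Idn C (base B)"
  using stable_proj_zero[of B "Idn C (base B)"] by simp

lemma T_tproj_TTplus [simp]:
  assumes B: "stable_bundle B" "tot B = F"
    and uv: "el u (TO C (TO C F))" "el v (TO C (TO C F))" "Dom C u = Dom C v"
      "T (T (bproj B)) \<cdot> u = T (T (bproj B)) \<cdot> v"
  shows "T (tproj C F) \<cdot> (u +[T_bundle C (T_bundle C B)] v) = T (tproj C F) \<cdot> u +[T_bundle C B] T (tproj C F) \<cdot> v"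
proof -
  have F: "F \<in> Obj C" using B arr_obj by auto
  have m: "additive_bundle_morphism C (T_bundle C B) B (tproj C F) (tproj C (base B))"
    by (rule additive_bundle_morphismI) (use B F in simp_all)
  show ?thesis using bundle_morphism_plus[OF bundle_morphism_T[OF m], of u v] B F uv by simp
qed

text \<open>The image under \<open>T\<close> of the interchange law, obtained from it by conjugation with \<open>c\<close>.\<close>

lemma T_interchange:
  assumes B: "stable_bundle B" "tot B = F"
    and el: "el u (TO C (TO C F))" "el v (TO C (TO C F))" "el u' (TO C (TO C F))" "el v' (TO C (TO C F))"
    and dom: "Dom C v = Dom C u" "Dom C u' = Dom C u" "Dom C v' = Dom C u"
    and q: "T (T (bproj B)) \<cdot> u = T (T (bproj B)) \<cdot> v" "T (T (bproj B)) \<cdot> u' = T (T (bproj B)) \<cdot> v'"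
    and p: "T (tproj C F) \<cdot> u = T (tproj C F) \<cdot> u'" "T (tproj C F) \<cdot> v = T (tproj C F) \<cdot> v'"
  shows "(u +[T_bundle C (T_bundle C B)] v) +[T_bundle C (tangent_bundle C F)] (u' +[T_bundle C (T_bundle C B)] v')
    = (u +[T_bundle C (tangent_bundle C F)] u') +[T_bundle C (T_bundle C B)] (v +[T_bundle C (tangent_bundle C F)] v')"
proof -
  have F: "F \<in> Obj C" using B arr_obj by auto
  have d: "Dom C (bproj (T_bundle C B)) = TO C F" using B by simp
  note eq = interchange[OF stable_bundle_T[OF B(1)] d, of "tflip C F \<cdot> u" "tflip C F \<cdot> v" "tflip C F \<cdot> u'" "tflip C F \<cdot> v'"]
  show ?thesis
    by (rule flip_eqD[of F]) (use eq B F el dom q p in simp_all)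
qed

section \<open>Flows of vector fields\<close>

context
  fixes E :: 'o
  assumes E [simp]: "E \<in> Obj C"
begin

text \<open>\<open>t1\<close>: the tangent bundle \<open>p : T(E) \<rightarrow> E\<close>; \<open>t2\<close> and \<open>Tt\<close>: the two bundle structures
  \<open>p\<close> and \<open>T(p)\<close> on \<open>T\<^sup>2(E)\<close>.\<close>

abbreviation "t1 \<equiv> tangent_bundle C E"
abbreviation "t2 \<equiv> tangent_bundle C (TO C E)"
abbreviation "Tt \<equiv> T_bundle C (tangent_bundle C E)"
abbreviation "tmu a b \<equiv> mu (tangent_bundle C E) (tlift C E) a b"

text \<open>Sections of \<open>p : T(E) \<rightarrow> E\<close>.\<close>

definition vector_field :: "'a \<Rightarrow> bool" where
  "vector_field V \<longleftrightarrow> V \<in> Arr C \<and> Dom C V = E \<and> Cod C V = TO C E \<and> tproj C E \<cdot> V = Idn C E"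

lemma vf_arr [simp]: "vector_field V \<Longrightarrow> V \<in> Arr C" "vector_field V \<Longrightarrow> Dom C V = E" "vector_field V \<Longrightarrow> Cod C V = TO C E"
  by (simp_all add: vector_field_def)

lemma vf_el: "vector_field V \<Longrightarrow> el V (TO C E)"
  by (simp add: el_def)

lemma vf_idn: "vector_field V \<Longrightarrow> tproj C E \<cdot> V = Idn C E"
  by (unfold vector_field_def) blast

lemma vf_proj [simp]: "vector_field V \<Longrightarrow> el a E \<Longrightarrow> tproj C E \<cdot> (V \<cdot> a) = a"
  using comp_eq[of "tproj C E" V "Idn C E" a] vf_idn[of V] by simp

lemma vf_T_proj [simp]:
  assumes V: "vector_field V" and s: "el s (TO C E)"
  shows "T (tproj C E) \<cdot> (T V \<cdot> s) = s"
proof -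
  have "tproj C E \<cdot> V = Idn C E \<cdot> Idn C E" using vf_idn[OF V] by simp
  then have "T (tproj C E) \<cdot> (T V \<cdot> s) = T (Idn C E) \<cdot> (T (Idn C E) \<cdot> s)"
    by (rule TA_square) (use V s in simp_all)
  then show ?thesis using s by simp
qed

lemma vector_fieldI:
  "\<lbrakk>V \<in> Arr C; Dom C V = E; Cod C V = TO C E; tproj C E \<cdot> V = Idn C E\<rbrakk> \<Longrightarrow> vector_field V"
  by (unfold vector_field_def) blast

lemma tmu_facts [simp]:
  assumes "el a (TO C E)" "el b (TO C E)" "Dom C b = Dom C a" "tproj C E \<cdot> a = tproj C E \<cdot> b"
  shows "el (tmu a b) (TO C (TO C E))" "Dom C (tmu a b) = Dom C a" "tproj C (TO C E) \<cdot> tmu a b = a"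
    "T (tproj C E) \<cdot> tmu a b = tzero C E \<cdot> (tproj C E \<cdot> a)"
  using mu_facts[OF tlift_is_lift[OF E], of a b] assms by simp_all

lemma flip_tmu:
  assumes "el a (TO C E)" "el b (TO C E)" "Dom C b = Dom C a" "tproj C E \<cdot> a = tproj C E \<cdot> b"
  shows "tflip C E \<cdot> tmu a b = T (tzero C E) \<cdot> a +[t2] tlift C E \<cdot> b"
  unfolding mu_def using assms by simp

lemma TT_tmu:
  assumes "f \<in> Arr C" "Dom C f = E" "Cod C f = E" "el a (TO C E)" "el b (TO C E)" "Dom C b = Dom C a" "tproj C E \<cdot> a = tproj C E \<cdot> b"
  shows "T (T f) \<cdot> tmu a b = tmu (T f \<cdot> a) (T f \<cdot> b)"
  unfolding mu_def using assms by simp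

lemmas t_lam_shift = plus_lam_shift[OF tlift_is_lift[OF E], simplified]
lemmas t_mu_shift = plus_mu_shift[OF tlift_is_lift[OF E], simplified]
lemmas t_mu_plus = mu_plus[OF tlift_is_lift[OF E], simplified]

text \<open>The flow of \<open>V\<close> in the inner variable of \<open>T\<^sup>2(E)\<close>, that is, \<open>T\<close> of the map
  \<open>v \<mapsto> v +\<^sub>p V p v\<close>. The flows are defined as operations on generalised elements.\<close>

definition inner_flow :: "'a \<Rightarrow> 'a \<Rightarrow> 'a" where
  "inner_flow V w = w +[Tt] T V \<cdot> (T (tproj C E) \<cdot> w)"

text \<open>The inner flow conjugated by \<open>c\<close>: translation by the vector field \<open>cT(V)\<close> on \<open>T(E)\<close>.\<close>

definition outer_flow :: "'a \<Rightarrow> 'a \<Rightarrow> 'a" where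
  "outer_flow V w = w +[t2] tflip C E \<cdot> (T V \<cdot> (tproj C (TO C E) \<cdot> w))"

text \<open>The flow of \<open>U\<close> in the product of the two variables. It only changes the core of
  \<open>T\<^sup>2(E)\<close>, is invariant under conjugation by \<open>c\<close> and commutes with the other flows.\<close>

definition core_flow :: "'a \<Rightarrow> 'a \<Rightarrow> 'a" where
  "core_flow U w = w +[t2] tmu (tproj C (TO C E) \<cdot> w) (U \<cdot> (tproj C E \<cdot> (tproj C (TO C E) \<cdot> w)))"

lemma inner_facts [simp]:
  assumes "vector_field V" "el w (TO C (TO C E))"
  shows "el (inner_flow V w) (TO C (TO C E))" "Dom C (inner_flow V w) = Dom C w"
    "T (tproj C E) \<cdot> inner_flow V w = T (tproj C E) \<cdot> w"
    "tproj C (TO C E) \<cdot> inner_flow V w = tproj C (TO C E) \<cdot> w +[t1] V \<cdot> (tproj C E \<cdot> (tproj C (TO C E) \<cdot> w))"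
  using assms by (simp_all add: inner_flow_def)

lemma outer_facts [simp]:
  assumes "vector_field V" "el w (TO C (TO C E))"
  shows "el (outer_flow V w) (TO C (TO C E))" "Dom C (outer_flow V w) = Dom C w"
    "tproj C (TO C E) \<cdot> outer_flow V w = tproj C (TO C E) \<cdot> w"
  using assms by (simp_all add: outer_flow_def)

lemma core_facts [simp]:
  assumes "vector_field V" "el w (TO C (TO C E))"
  shows "el (core_flow V w) (TO C (TO C E))" "Dom C (core_flow V w) = Dom C w"
    "tproj C (TO C E) \<cdot> core_flow V w = tproj C (TO C E) \<cdot> w"
  using assms by (simp_all add: core_flow_def)

lemma flip_inner [simp]:
  assumes "vector_field V" "el w (TO C (TO C E))"
  shows "tflip C E \<cdot> inner_flow V w = outer_flow V (tflip C E \<cdot> w)"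
  using assms by (simp add: inner_flow_def outer_flow_def)

lemma flip_outer [simp]:
  assumes "vector_field V" "el w (TO C (TO C E))"
  shows "tflip C E \<cdot> outer_flow V w = inner_flow V (tflip C E \<cdot> w)"
  using assms by (simp add: inner_flow_def outer_flow_def)

lemma flip_core [simp]:
  assumes "vector_field V" "el w (TO C (TO C E))"
  shows "tflip C E \<cdot> core_flow V w = core_flow V (tflip C E \<cdot> w)"
proof -
  let ?P = "tproj C (TO C E)" and ?p = "tproj C E"
  let ?b = "V \<cdot> (?p \<cdot> (?P \<cdot> w))"
  have "tflip C E \<cdot> core_flow V w = tflip C E \<cdot> w +[Tt] (T (tzero C E) \<cdot> (?P \<cdot> w) +[t2] tlift C E \<cdot> ?b)"
    using assms by (simp add: core_flow_def flip_tmu)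
  also have "\<dots> = tflip C E \<cdot> w +[t2] tmu (T ?p \<cdot> w) ?b"
    by (rule t_lam_shift) (use assms in simp_all)
  also have "\<dots> = core_flow V (tflip C E \<cdot> w)" using assms by (simp add: core_flow_def)
  finally show ?thesis .
qed

lemma inner_plus:
  assumes V: "vector_field V" and "el w (TO C (TO C E))" "el y (TO C (TO C E))" "Dom C y = Dom C w"
    "tproj C (TO C E) \<cdot> w = tproj C (TO C E) \<cdot> y"
  shows "inner_flow V (w +[t2] y) = inner_flow V w +[t2] inner_flow V y"
proof -
  have pw: "tproj C E \<cdot> (T (tproj C E) \<cdot> w) = tproj C E \<cdot> (T (tproj C E) \<cdot> y)"
    using assms by simp
  show ?thesis
    unfolding inner_flow_def
    using interchange[of t1 "TO C E" w "T V \<cdot> (T (tproj C E) \<cdot> w)" y "T V \<cdot> (T (tproj C E) \<cdot> y)"] assms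
    by simp
qed

text \<open>\<open>U\<close> measures the failure of \<open>V\<close> and \<open>W\<close> to commute: \<open>T(V)W = c(T(W)V +\<^sub>p \<mu>(W, U))\<close>.\<close>

definition has_commutator :: "'a \<Rightarrow> 'a \<Rightarrow> 'a \<Rightarrow> bool" where
  "has_commutator V W U \<longleftrightarrow> (\<forall>b. el b E \<longrightarrow>
     T V \<cdot> (W \<cdot> b) = tflip C E \<cdot> (T W \<cdot> (V \<cdot> b) +[t2] tmu (W \<cdot> b) (U \<cdot> b)))"

lemma inner_outer:
  assumes V: "vector_field V" "vector_field W" "vector_field U" and R: "has_commutator V W U" and w: "el w (TO C (TO C E))"
  shows "inner_flow V (outer_flow W w) = core_flow U (outer_flow W (inner_flow V w))"
proof -
  let ?P = "tproj C (TO C E)" and ?p = "tproj C E" and ?c = "tflip C E"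
  let ?b = "?p \<cdot> (?P \<cdot> w)"
  let ?y = "?c \<cdot> (T W \<cdot> (?P \<cdot> w))" and ?d = "?c \<cdot> (T W \<cdot> (V \<cdot> ?b))" and ?x = "inner_flow V w"
  have b: "el ?b E" "Dom C ?b = Dom C w" using w by simp_all
  have y: "el ?y (TO C (TO C E))" "Dom C ?y = Dom C w" "?P \<cdot> ?y = ?P \<cdot> w" "T ?p \<cdot> ?y = W \<cdot> ?b"
    using V w by simp_all
  have d: "el ?d (TO C (TO C E))" "Dom C ?d = Dom C w" "?P \<cdot> ?d = V \<cdot> ?b" "T ?p \<cdot> ?d = W \<cdot> ?b"
    using V w by simp_all
  have "inner_flow V (outer_flow W w) = ?x +[t2] inner_flow V ?y"
    unfolding outer_flow_def by (rule inner_plus) (use V w y in simp_all)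
  also have "inner_flow V ?y = ?y +[Tt] T V \<cdot> (W \<cdot> ?b)"
    unfolding inner_flow_def y ..
  also have "T V \<cdot> (W \<cdot> ?b) = ?d +[Tt] (T (tzero C E) \<cdot> (W \<cdot> ?b) +[t2] tlift C E \<cdot> (U \<cdot> ?b))"
    using R[unfolded has_commutator_def, rule_format, OF b(1)] V b by (simp add: flip_tmu)
  also have "\<dots> = ?d +[t2] tmu (V \<cdot> ?b) (U \<cdot> ?b)"
    by (rule t_lam_shift) (use w V in simp_all)
  also have "?y +[Tt] \<dots> = (?y +[Tt] ?d) +[t2] tmu (?P \<cdot> w +[t1] V \<cdot> ?b) (U \<cdot> ?b)"
    by (rule t_mu_shift) (use w V in simp_all)
  also have "?x +[t2] \<dots> = (?x +[t2] (?y +[Tt] ?d)) +[t2] tmu (?P \<cdot> w +[t1] V \<cdot> ?b) (U \<cdot> ?b)"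
    by (rule fibre_plus_assoc[symmetric]) (use V w in simp_all)
  also have "?y +[Tt] ?d = ?c \<cdot> (T W \<cdot> (?P \<cdot> ?x))"
    using V w by simp
  also have "(?x +[t2] ?c \<cdot> (T W \<cdot> (?P \<cdot> ?x))) +[t2] tmu (?P \<cdot> w +[t1] V \<cdot> ?b) (U \<cdot> ?b) = core_flow U (outer_flow W ?x)"
    unfolding core_flow_def using V w b by (simp add: outer_flow_def[of W ?x, symmetric] del: inner_facts(4)) (simp add: V w b)
  finally show ?thesis .
qed

text \<open>The previous lemma conjugated by \<open>c\<close>.\<close>

lemma outer_inner:
  assumes V: "vector_field V" "vector_field W" "vector_field U" and R: "has_commutator V W U" and w: "el w (TO C (TO C E))"
  shows "outer_flow V (inner_flow W w) = core_flow U (inner_flow W (outer_flow V w))"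
proof -
  have "tflip C E \<cdot> inner_flow V (outer_flow W (tflip C E \<cdot> w)) = tflip C E \<cdot> core_flow U (outer_flow W (inner_flow V (tflip C E \<cdot> w)))"
    using inner_outer[OF V R, of "tflip C E \<cdot> w"] w by simp
  then show ?thesis using V w by (simp del: core_facts(3) outer_facts(3) inner_facts(3,4))
qed

lemma core_outer:
  assumes V: "vector_field V" "vector_field U" and w: "el w (TO C (TO C E))"
  shows "core_flow U (outer_flow V w) = outer_flow V (core_flow U w)"
proof -
  let ?P = "tproj C (TO C E)" and ?p = "tproj C E" and ?c = "tflip C E"
  have "core_flow U (outer_flow V w) = outer_flow V w +[t2] tmu (?P \<cdot> w) (U \<cdot> (?p \<cdot> (?P \<cdot> w)))"
    using V w by (simp add: core_flow_def)
  also have "\<dots> = core_flow U w +[t2] ?c \<cdot> (T V \<cdot> (?P \<cdot> w))"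
    unfolding core_flow_def outer_flow_def by (rule fibre_plus_swap) (use V w in simp_all)
  also have "\<dots> = outer_flow V (core_flow U w)" using V w by (simp add: outer_flow_def)
  finally show ?thesis .
qed

lemma core_inner:
  assumes V: "vector_field V" "vector_field U" and w: "el w (TO C (TO C E))"
  shows "core_flow U (inner_flow V w) = inner_flow V (core_flow U w)"
proof -
  have "tflip C E \<cdot> core_flow U (outer_flow V (tflip C E \<cdot> w)) = tflip C E \<cdot> outer_flow V (core_flow U (tflip C E \<cdot> w))"
    using core_outer[OF V, of "tflip C E \<cdot> w"] w by simp
  then show ?thesis using V w by (simp del: core_facts(3) outer_facts(3) inner_facts(3,4))
qed

lemma core_core:
  assumes V: "vector_field V" "vector_field U" and w: "el w (TO C (TO C E))"
  shows "core_flow U (core_flow V w) = core_flow V (core_flow U w)"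
proof -
  let ?P = "tproj C (TO C E)" and ?p = "tproj C E"
  let ?m = "\<lambda>U. tmu (?P \<cdot> w) (U \<cdot> (?p \<cdot> (?P \<cdot> w)))"
  have "core_flow U (core_flow V w) = (w +[t2] ?m V) +[t2] ?m U"
    using V w by (simp add: core_flow_def)
  also have "\<dots> = (w +[t2] ?m U) +[t2] ?m V"
    by (rule fibre_plus_swap) (use V w in simp_all)
  also have "\<dots> = core_flow V (core_flow U w)"
    using V w by (simp add: core_flow_def)
  finally show ?thesis .
qed

lemma core_inj:
  assumes V: "vector_field V" and eq: "core_flow V w = core_flow V w'" and w: "el w (TO C (TO C E))" "el w' (TO C (TO C E))" "Dom C w = Dom C w'"
  shows "w = w'"
proof -
  let ?P = "tproj C (TO C E)" and ?p = "tproj C E"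
  have P: "?P \<cdot> w = ?P \<cdot> w'"
    using core_facts(3)[OF V w(1)] core_facts(3)[OF V w(2)] eq by simp
  show ?thesis
    by (rule fibre_plus_cancel_right[of t2 _ _ "tmu (?P \<cdot> w') (V \<cdot> (?p \<cdot> (?P \<cdot> w')))"])
      (use eq V w P in \<open>simp_all add: core_flow_def\<close>)
qed

text \<open>\<open>U\<close> measures the failure of the endomorphism \<open>f\<close> to preserve \<open>V\<close>:
  \<open>V f = T(f)V +\<^sub>p U f\<close>.\<close>

definition has_defect :: "'a \<Rightarrow> 'a \<Rightarrow> 'a \<Rightarrow> bool" where
  "has_defect V f U \<longleftrightarrow> V \<cdot> f = (T f \<cdot> V) +[t1] (U \<cdot> f)"

context
  fixes f :: 'a
  assumes f [simp]: "f \<in> Arr C" "Dom C f = E" "Cod C f = E"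
begin

lemma f_el: "el f E"
  by (simp add: el_def)

lemma has_defect_el:
  assumes V: "vector_field V" "vector_field U" and S: "has_defect V f U" and a: "el a E"
  shows "V \<cdot> (f \<cdot> a) = T f \<cdot> (V \<cdot> a) +[t1] U \<cdot> (f \<cdot> a)"
proof -
  have "V \<cdot> (f \<cdot> a) = (V \<cdot> f) \<cdot> a" using V a by simp
  also have "\<dots> = (T f \<cdot> V) \<cdot> a +[t1] (U \<cdot> f) \<cdot> a"
    unfolding S[unfolded has_defect_def]
    by (rule fibre_plus_comp) (use V a vf_el[OF V(1)] f_el vf_idn[OF V(1)] in simp_all)
  finally show ?thesis using V a by simp
qed

lemma has_defect_T_el:
  assumes V: "vector_field V" "vector_field U" and S: "has_defect V f U" and s: "el s (TO C E)"
  shows "T V \<cdot> (T f \<cdot> s) = T (T f) \<cdot> (T V \<cdot> s) +[Tt] T U \<cdot> (T f \<cdot> s)"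
proof -
  note vf = vf_el[OF V(1)] vf_el[OF V(2)] f_el
  have q: "tproj C E \<cdot> (T f \<cdot> V) = tproj C E \<cdot> (U \<cdot> f)"
    using V vf vf_idn[OF V(1)] by simp
  have "T V \<cdot> T f = T ((T f \<cdot> V) +[t1] (U \<cdot> f))"
    using S[unfolded has_defect_def] TA_Comp[of V f] V vf by simp
  also have "\<dots> = T (T f) \<cdot> T V +[Tt] T U \<cdot> T f"
    using TA_plus[of t1 "T f \<cdot> V" "U \<cdot> f"] q V vf by simp
  finally have eq: "T V \<cdot> T f = T (T f) \<cdot> T V +[Tt] T U \<cdot> T f" .
  have "T V \<cdot> (T f \<cdot> s) = (T V \<cdot> T f) \<cdot> s" using V s TA_el[OF f_el] by simp
  also have "\<dots> = (T (T f) \<cdot> T V) \<cdot> s +[Tt] (T U \<cdot> T f) \<cdot> s"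
    unfolding eq by (rule fibre_plus_comp) (use V s TA_el[OF f_el] TA_el[OF vf_el[OF V(1)]] TA_cong[OF q] vf in simp_all)
  finally show ?thesis using V s by simp
qed

lemma inner_defect:
  assumes V: "vector_field V" "vector_field U" and S: "has_defect V f U" and w: "el w (TO C (TO C E))"
  shows "inner_flow V (T (T f) \<cdot> w) = inner_flow U (T (T f) \<cdot> inner_flow V w)"
proof -
  let ?F = "T (T f)" and ?s = "T (tproj C E) \<cdot> w"
  have "inner_flow V (?F \<cdot> w) = ?F \<cdot> w +[Tt] T V \<cdot> (T f \<cdot> ?s)"
    using V w by (simp add: inner_flow_def)
  also have "\<dots> = ?F \<cdot> w +[Tt] (?F \<cdot> (T V \<cdot> ?s) +[Tt] T U \<cdot> (T f \<cdot> ?s))"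
    using has_defect_T_el[OF V S, of ?s] w by simp
  also have "\<dots> = (?F \<cdot> w +[Tt] ?F \<cdot> (T V \<cdot> ?s)) +[Tt] T U \<cdot> (T f \<cdot> ?s)"
    by (rule fibre_plus_assoc[symmetric]) (use V w in simp_all)
  also have "\<dots> = inner_flow U (?F \<cdot> inner_flow V w)"
    using V w by (simp add: inner_flow_def)
  finally show ?thesis .
qed

lemma outer_defect:
  assumes V: "vector_field V" "vector_field U" and S: "has_defect V f U" and w: "el w (TO C (TO C E))"
  shows "outer_flow V (T (T f) \<cdot> w) = outer_flow U (T (T f) \<cdot> outer_flow V w)"
proof -
  have "tflip C E \<cdot> inner_flow V (T (T f) \<cdot> (tflip C E \<cdot> w)) = tflip C E \<cdot> inner_flow U (T (T f) \<cdot> inner_flow V (tflip C E \<cdot> w))"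
    using inner_defect[OF V S, of "tflip C E \<cdot> w"] w by simp
  moreover have "tflip C E \<cdot> (T (T f) \<cdot> inner_flow V (tflip C E \<cdot> w)) = T (T f) \<cdot> outer_flow V w"
    using tflip_natural[of f E "inner_flow V (tflip C E \<cdot> w)"] V w by simp
  moreover have "tflip C E \<cdot> (T (T f) \<cdot> (tflip C E \<cdot> w)) = T (T f) \<cdot> w"
    using tflip_natural[of f E "tflip C E \<cdot> w"] w by simp
  ultimately show ?thesis using V w
    by (simp del: tflip_natural core_facts(3) outer_facts(3) inner_facts(3,4))
qed

lemma core_defect:
  assumes V: "vector_field V" "vector_field U" and S: "has_defect V f U" and w: "el w (TO C (TO C E))"
  shows "core_flow V (T (T f) \<cdot> w) = core_flow U (T (T f) \<cdot> core_flow V w)"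
proof -
  let ?F = "T (T f)" and ?P = "tproj C (TO C E)" and ?p = "tproj C E"
  let ?a = "T f \<cdot> (?P \<cdot> w)" and ?b = "?p \<cdot> (?P \<cdot> w)"
  have b: "el ?b E" "Dom C ?b = Dom C w" using w by simp_all
  have "core_flow V (?F \<cdot> w) = ?F \<cdot> w +[t2] tmu ?a (V \<cdot> (f \<cdot> ?b))"
    using V w by (simp add: core_flow_def)
  also have "tmu ?a (V \<cdot> (f \<cdot> ?b)) = tmu ?a (T f \<cdot> (V \<cdot> ?b)) +[t2] tmu ?a (U \<cdot> (f \<cdot> ?b))"
    unfolding has_defect_el[OF V S b(1)] by (rule t_mu_plus) (use V w in simp_all)
  also have "?F \<cdot> w +[t2] \<dots> = (?F \<cdot> w +[t2] tmu ?a (T f \<cdot> (V \<cdot> ?b))) +[t2] tmu ?a (U \<cdot> (f \<cdot> ?b))"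
    by (rule fibre_plus_assoc[symmetric]) (use V w in simp_all)
  also have "\<dots> = core_flow U (?F \<cdot> core_flow V w)"
    using V w by (simp add: core_flow_def TT_tmu)
  finally show ?thesis .
qed

text \<open>The composite of the inner flow of \<open>V\<close>, the outer flow of \<open>W\<close> and
  \<open>T\<^sup>2(f)\<close> is rewritten in two ways as a composite of correction terms with \<open>T\<^sup>2(f)\<close>, the outer
  flow of \<open>W\<close> and the inner flow of \<open>V\<close>, in this order.\<close>

theorem vector_field_jacobi:
  assumes V: "vector_field V" "vector_field W" "vector_field VW" "vector_field U1" "vector_field U2" "vector_field U12"
      "vector_field N1" "vector_field N2"
    and R: "has_commutator V W VW" "has_commutator W U1 N2" "has_commutator V U2 N1"
    and comm: "\<And>w. el w (TO C (TO C E)) \<Longrightarrow> inner_flow U1 (outer_flow U2 w) = outer_flow U2 (inner_flow U1 w)"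
    and S: "has_defect V f U1" "has_defect W f U2" "has_defect VW f U12"
    and a: "el a E"
  shows "N2 \<cdot> (f \<cdot> a) +[t1] U12 \<cdot> (f \<cdot> a) = N1 \<cdot> (f \<cdot> a)"
proof -
  let ?z = "\<lambda>w. T (T f) \<cdot> w" and ?P = "tproj C (TO C E)" and ?p = "tproj C E"
  note [simp del] = inner_facts(3,4) outer_facts(3) core_facts(3) tflip_natural
  note [simp] = V
  \<comment> \<open>Any element over \<open>a\<close> would do; \<open>00a\<close> always exists.\<close>
  define w where "w = tzero C (TO C E) \<cdot> (tzero C E \<cdot> a)"
  have w [simp]: "el w (TO C (TO C E))" "Dom C w = Dom C a" "?P \<cdot> w = tzero C E \<cdot> a" using a by (simp_all add: w_def)
  define g where "g = outer_flow W (inner_flow V w)"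
  have g [simp]: "el g (TO C (TO C E))" "Dom C g = Dom C a" by (simp_all add: g_def)
  define h where "h = outer_flow U2 (inner_flow U1 (?z g))"
  have h [simp]: "el h (TO C (TO C E))" "Dom C h = Dom C a" by (simp_all add: h_def)
  \<comment> \<open>The flows of \<open>V\<close> and \<open>W\<close> are interchanged first, then each passes \<open>T\<^sup>2(f)\<close>.\<close>
  have 1: "inner_flow V (outer_flow W (?z w)) = core_flow VW (core_flow N2 h)"
  proof -
    have "inner_flow V (outer_flow W (?z w)) = core_flow VW (outer_flow W (inner_flow V (?z w)))" by (rule inner_outer) (simp_all add: R)
    also have "inner_flow V (?z w) = inner_flow U1 (?z (inner_flow V w))" by (rule inner_defect) (simp_all add: S)
    also have "outer_flow W (inner_flow U1 (?z (inner_flow V w))) = core_flow N2 (inner_flow U1 (outer_flow W (?z (inner_flow V w))))"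
      by (rule outer_inner) (simp_all add: R)
    also have "outer_flow W (?z (inner_flow V w)) = outer_flow U2 (?z g)"
      unfolding g_def by (rule outer_defect) (simp_all add: S)
    also have "inner_flow U1 (outer_flow U2 (?z g)) = h" unfolding h_def by (rule comm) simp
    finally show ?thesis .
  qed
  \<comment> \<open>Each flow passes \<open>T\<^sup>2(f)\<close> first, then the two are interchanged.\<close>
  have 2: "inner_flow V (outer_flow W (?z w)) = core_flow N1 (outer_flow U2 (inner_flow U1 (?z (core_flow VW g))))"
  proof -
    have "outer_flow W (?z w) = outer_flow U2 (?z (outer_flow W w))" by (rule outer_defect) (simp_all add: S)
    then have "inner_flow V (outer_flow W (?z w)) = inner_flow V (outer_flow U2 (?z (outer_flow W w)))" by simp
    also have "\<dots> = core_flow N1 (outer_flow U2 (inner_flow V (?z (outer_flow W w))))" by (rule inner_outer) (simp_all add: R)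
    also have "inner_flow V (?z (outer_flow W w)) = inner_flow U1 (?z (inner_flow V (outer_flow W w)))" by (rule inner_defect) (simp_all add: S)
    also have "inner_flow V (outer_flow W w) = core_flow VW g" unfolding g_def by (rule inner_outer) (simp_all add: R)
    finally show ?thesis .
  qed
  have "core_flow U12 (outer_flow U2 (inner_flow U1 (?z (core_flow VW g)))) = outer_flow U2 (inner_flow U1 (core_flow U12 (?z (core_flow VW g))))"
    by (simp add: core_outer core_inner)
  also have "core_flow U12 (?z (core_flow VW g)) = core_flow VW (?z g)"
    by (rule core_defect[symmetric]) (simp_all add: S)
  also have "outer_flow U2 (inner_flow U1 (core_flow VW (?z g))) = core_flow VW h"
    unfolding h_def by (simp add: core_outer core_inner)
  finally have 3: "core_flow U12 (outer_flow U2 (inner_flow U1 (?z (core_flow VW g)))) = core_flow VW h" .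
  have "core_flow VW (core_flow U12 (core_flow N2 h)) = core_flow U12 (core_flow VW (core_flow N2 h))" by (rule core_core) simp_all
  also have "\<dots> = core_flow U12 (core_flow N1 (outer_flow U2 (inner_flow U1 (?z (core_flow VW g)))))" using 1 2 by simp
  also have "\<dots> = core_flow N1 (core_flow U12 (outer_flow U2 (inner_flow U1 (?z (core_flow VW g)))))" by (rule core_core) simp_all
  also have "\<dots> = core_flow N1 (core_flow VW h)" unfolding 3 ..
  also have "\<dots> = core_flow VW (core_flow N1 h)" by (rule core_core) simp_all
  finally have eq: "core_flow U12 (core_flow N2 h) = core_flow N1 h" by (rule core_inj[rotated]) simp_all
  have pP: "?p \<cdot> (?P \<cdot> h) = f \<cdot> a"
    unfolding h_def g_def by (simp add: inner_facts(3,4) outer_facts(3) a)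
  let ?m = "\<lambda>U. tmu (?P \<cdot> h) (U \<cdot> (f \<cdot> a))"
  have fa: "el (f \<cdot> a) E" "Dom C (f \<cdot> a) = Dom C a" using a by simp_all
  have "h +[t2] (?m N2 +[t2] ?m U12) = (h +[t2] ?m N2) +[t2] ?m U12"
    by (rule fibre_plus_assoc[symmetric]) (use fa pP in simp_all)
  also have "\<dots> = h +[t2] ?m N1"
    using eq fa pP by (simp add: core_flow_def)
  finally have "?m N2 +[t2] ?m U12 = ?m N1"
    by (rule fibre_plus_cancel_left[rotated -1]) (use fa pP in simp_all)
  moreover have "tmu (?P \<cdot> h) (N2 \<cdot> (f \<cdot> a) +[t1] U12 \<cdot> (f \<cdot> a)) = ?m N2 +[t2] ?m U12"
    by (rule t_mu_plus) (use fa pP in simp_all)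
  ultimately have "tmu (?P \<cdot> h) (N2 \<cdot> (f \<cdot> a) +[t1] U12 \<cdot> (f \<cdot> a)) = ?m N1" by simp
  then show ?thesis
    by (rule mu_inj[OF tlift_is_lift[OF E]]) (use fa pP in simp_all)
qed

end

end

lemma tzero_vector_field: "F \<in> Obj C \<Longrightarrow> vector_field F (tzero C F)"
  by (rule vector_fieldI) simp_all

lemma tmu_tzero:
  assumes "F \<in> Obj C" "el x (TO C F)"
  shows "mu (tangent_bundle C F) (tlift C F) x (tzero C F \<cdot> (tproj C F \<cdot> x)) = tzero C (TO C F) \<cdot> x"
  using mu_zero[OF tlift_is_lift[OF assms(1)], of x] assms by simp

lemma core_tzero:
  assumes F: "F \<in> Obj C" and w: "el w (TO C (TO C F))"
  shows "core_flow F (tzero C F) w = w"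
proof -
  have "core_flow F (tzero C F) w = w +[tangent_bundle C (TO C F)] tzero C (TO C F) \<cdot> (tproj C (TO C F) \<cdot> w)"
    unfolding core_flow_def[OF F] using tmu_tzero[of F "tproj C (TO C F) \<cdot> w"] assms by simp
  also have "\<dots> = w" by (rule fibre_plus_zero) (use assms in simp_all)
  finally show ?thesis .
qed

text \<open>The case \<open>U = 0\<close> of \<open>inner_outer\<close>.\<close>

lemma inner_outer_commute:
  assumes F: "F \<in> Obj C" and V: "vector_field F V" "vector_field F W"
    and c: "\<And>b. el b F \<Longrightarrow> T V \<cdot> (W \<cdot> b) = tflip C F \<cdot> (T W \<cdot> (V \<cdot> b))"
    and w: "el w (TO C (TO C F))"
  shows "inner_flow F V (outer_flow F W w) = outer_flow F W (inner_flow F V w)"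
proof -
  have "has_commutator F V W (tzero C F)"
    unfolding has_commutator_def[OF F]
  proof (intro allI impI)
    fix b assume b: "el b F"
    have Wb: "el (W \<cdot> b) (TO C F)" "tproj C F \<cdot> (W \<cdot> b) = b" using vf_arr[OF F V(2)] vf_proj[OF F V(2) b] b by simp_all
    have y: "el (T W \<cdot> (V \<cdot> b)) (TO C (TO C F))" "tproj C (TO C F) \<cdot> (T W \<cdot> (V \<cdot> b)) = W \<cdot> b"
      using vf_arr[OF F V(2)] vf_arr[OF F V(1)] vf_proj[OF F V(1) b] b F by simp_all
    have "mu (tangent_bundle C F) (tlift C F) (W \<cdot> b) (tzero C F \<cdot> b) = tzero C (TO C F) \<cdot> (W \<cdot> b)"
      using tmu_tzero[OF F Wb(1)] Wb(2) by simp
    moreover have "T W \<cdot> (V \<cdot> b) +[tangent_bundle C (TO C F)] tzero C (TO C F) \<cdot> (W \<cdot> b) = T W \<cdot> (V \<cdot> b)"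
      by (rule fibre_plus_zero) (use F y in simp_all)
    ultimately show "T V \<cdot> (W \<cdot> b) = tflip C F \<cdot> (T W \<cdot> (V \<cdot> b) +[tangent_bundle C (TO C F)] mu (tangent_bundle C F) (tlift C F) (W \<cdot> b) (tzero C F \<cdot> b))"
      using c[OF b] by simp
  qed
  then have "inner_flow F V (outer_flow F W w) = core_flow F (tzero C F) (outer_flow F W (inner_flow F V w))"
    by (rule inner_outer[OF F V tzero_vector_field[OF F] _ w])
  also have "\<dots> = outer_flow F W (inner_flow F V w)"
    by (rule core_tzero[OF F]) (rule outer_facts[OF F V(2) inner_facts(1)[OF F V(1) w]])
  finally show ?thesis .
qed

end

section \<open>Involution algebroids\<close>

locale involution_algebroid_with_negatives =
  tangent_category_with_negatives C + involution_algebroid C A \<rho> \<pi>0 \<pi>1 \<alpha>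
  for C :: "('o, 'a) tangent_data" (structure) and A :: "'a differential_bundle_data"
    and \<rho> \<pi>0 \<pi>1 \<alpha> :: 'a
begin

text \<open>\<open>TB\<close>, \<open>TTB\<close>: the images of the bundle \<open>A\<close> under \<open>T\<close> and \<open>T\<^sup>2\<close>; \<open>tE\<close>: the tangent bundle of the
  total object \<open>E\<close>; \<open>TtE\<close>, \<open>tTE\<close>: the structures \<open>T(p)\<close> and \<open>p\<close> on \<open>T\<^sup>2(E)\<close>.\<close>

abbreviation "pr \<equiv> bproj A"
abbreviation "E \<equiv> Dom C (bproj A)"
abbreviation "M \<equiv> Cod C (bproj A)"
abbreviation "lam \<equiv> blift A"
abbreviation "xi \<equiv> bzero A"
abbreviation "TB \<equiv> T_bundle C A"
abbreviation "TTB \<equiv> T_bundle C (T_bundle C A)"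
abbreviation "tE \<equiv> tangent_bundle C (Dom C (bproj A))"
abbreviation "TtE \<equiv> T_bundle C (tangent_bundle C (Dom C (bproj A)))"
abbreviation "tTE \<equiv> tangent_bundle C (TO C (Dom C (bproj A)))"
abbreviation "m a b \<equiv> mu A (blift A) a b"

lemma differential_bundle_A: "differential_bundle C A"
  by unfold_locales

lemma stable_A [simp]: "stable_bundle A"
proof (rule stable_bundleI)
  show "additive_bundle C A" by unfold_locales
qed (use bundle_powers bundle_negatives[OF differential_bundle_A] in auto)

lemma E_obj: "E \<in> Obj C"
  by simp

lemma lam_arr [simp]: "lam \<in> Arr C" "Dom C lam = E" "Cod C lam = TO C E"
  using blift_hom by (auto simp: homset_def)

lemma pr_el [simp]: "el pr M" "el xi E" "el lam (TO C E)"
  by (simp_all add: el_def)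

lemma T_lam_injective:
  assumes "T lam \<cdot> u = T lam \<cdot> v" "el u (TO C E)" "el v (TO C E)" "Dom C u = Dom C v"
  shows "u = v"
proof -
  have e: "is_equaliser C ((T ^^ 1) (T pr)) ((T ^^ 1) (tzero C M \<cdot> pr \<cdot> tproj C E)) ((T ^^ 1) (bundle_mu C A))"
    using bundle_mu_equaliser unfolding equaliser_preserved_def by blast
  then have e: "is_equaliser C (T (T pr)) (T (tzero C M \<cdot> pr \<cdot> tproj C E)) (T (bundle_mu C A))" by simp
  show ?thesis
    by (rule T_lift_injective[OF stable_A blift_zero_additive blift_bzero_additive bundle_pullback
         stable_pullback_T[OF stable_A] bundle_mu_def e assms])
qed

lemma is_lift_A: "is_lift A lam"
proof -
  have "u = v" if h: "lam \<cdot> u = lam \<cdot> v" "el u E" "el v E" "Dom C u = Dom C v" for u v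
  proof -
    have "tzero C (TO C E) \<cdot> (lam \<cdot> u) = tzero C (TO C E) \<cdot> (lam \<cdot> v)" using h(1) by simp
    then have "T lam \<cdot> (tzero C E \<cdot> u) = T lam \<cdot> (tzero C E \<cdot> v)" using h(2-4) by simp
    then have "tzero C E \<cdot> u = tzero C E \<cdot> v" by (rule T_lam_injective) (use h(2-4) in simp_all)
    then show ?thesis by (rule tzero_injective) (use h(2-4) in simp_all)
  qed
  then show ?thesis
    unfolding is_lift_def using blift_zero_additive blift_bzero_additive by auto
qed

lemmas lam_proj [simp] = proj_lam[OF is_lift_A] T_proj_lam[OF is_lift_A] lam_zero[OF is_lift_A]

lemma T_T_proj_lam [simp]:
  assumes "el s (TO C E)"
  shows "T (T pr) \<cdot> (T lam \<cdot> s) = T (tzero C M) \<cdot> (T pr \<cdot> s)"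
proof -
  have "T pr \<cdot> lam = tzero C M \<cdot> pr"
    using blift_zero_additive by (simp add: additive_bundle_morphism_def)
  then show ?thesis by (rule TA_square) (use assms in simp_all)
qed

lemma T_proj_T_lam [simp]:
  assumes "el s (TO C E)"
  shows "T (tproj C E) \<cdot> (T lam \<cdot> s) = T xi \<cdot> (T pr \<cdot> s)"
proof -
  have "tproj C E \<cdot> lam = xi \<cdot> pr"
    using blift_bzero_additive by (simp add: additive_bundle_morphism_def)
  then show ?thesis by (rule TA_square) (use assms in simp_all)
qed

lemma T_lam_lam [simp]: "el a E \<Longrightarrow> T lam \<cdot> (lam \<cdot> a) = tlift C E \<cdot> (lam \<cdot> a)"
  by (rule comp_square[OF blift_blift]) simp_all

lemma T_lam_Tplus [simp]:
  assumes "el u (TO C E)" "el v (TO C E)" "Dom C u = Dom C v" "T pr \<cdot> u = T pr \<cdot> v"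
  shows "T lam \<cdot> (u +[TB] v) = T lam \<cdot> u +[TtE] T lam \<cdot> v"
  using bundle_morphism_plus[OF bundle_morphism_T[OF blift_bzero_additive], of u v] assms by simp

lemmas m_facts [simp] = mu_facts[OF is_lift_A]

section \<open>The anchor\<close>

lemma rho_arr [simp]: "\<rho> \<in> Arr C" "Dom C \<rho> = E" "Cod C \<rho> = TO C M"
  and rho_proj_eq: "tproj C M \<cdot> \<rho> = pr" and rho_lam_eq: "T \<rho> \<cdot> lam = tlift C M \<cdot> \<rho>"
  using anchor_linear by (auto simp: linear_bundle_morphism_def homset_def)

lemma rho_el [simp]: "el \<rho> (TO C M)"
  by (simp add: el_def)

lemma rho_proj [simp]: "el a E \<Longrightarrow> tproj C M \<cdot> (\<rho> \<cdot> a) = pr \<cdot> a"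
  using comp_eq[OF rho_proj_eq] by simp

lemma T_rho_proj [simp]: "el s (TO C E) \<Longrightarrow> T (tproj C M) \<cdot> (T \<rho> \<cdot> s) = T pr \<cdot> s"
  using comp_eq[OF TA_eq[OF rho_proj_eq]] el_arr[of \<rho>] by simp

lemma T_rho_lam [simp]: "el a E \<Longrightarrow> T \<rho> \<cdot> (lam \<cdot> a) = tlift C M \<cdot> (\<rho> \<cdot> a)"
  by (rule comp_square[OF rho_lam_eq]) simp_all

text \<open>A linear morphism is additive, since the lift \<open>l\<close> is additive and monic.\<close>

lemma rho_plus [simp]:
  assumes "el u E" "el v E" "Dom C u = Dom C v" "pr \<cdot> u = pr \<cdot> v"
  shows "\<rho> \<cdot> (u +[A] v) = \<rho> \<cdot> u +[tangent_bundle C M] \<rho> \<cdot> v"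
proof (rule tlift_injective)
  have s: "el (u +[A] v) E" using assms by simp
  have "tlift C M \<cdot> (\<rho> \<cdot> (u +[A] v)) = T \<rho> \<cdot> (lam \<cdot> (u +[A] v))" using s by simp
  also have "lam \<cdot> (u +[A] v) = lam \<cdot> u +[tE] lam \<cdot> v"
    by (rule lam_plus_t[OF is_lift_A]) (use assms in simp_all)
  also have "T \<rho> \<cdot> \<dots> = tlift C M \<cdot> (\<rho> \<cdot> u) +[tangent_bundle C (TO C M)] tlift C M \<cdot> (\<rho> \<cdot> v)"
    using assms by simp
  also have "\<dots> = tlift C M \<cdot> (\<rho> \<cdot> u +[tangent_bundle C M] \<rho> \<cdot> v)"
    using bundle_morphism_plus[OF tlift_additive_t[of M], of "\<rho> \<cdot> u" "\<rho> \<cdot> v"] assms by simp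
  finally show "tlift C M \<cdot> (\<rho> \<cdot> (u +[A] v)) = tlift C M \<cdot> (\<rho> \<cdot> u +[tangent_bundle C M] \<rho> \<cdot> v)" .
qed (use assms in simp_all)

lemma rho_zero [simp]:
  assumes a: "el a M" shows "\<rho> \<cdot> (xi \<cdot> a) = tzero C M \<cdot> a"
proof -
  have "tlift C M \<cdot> (\<rho> \<cdot> (xi \<cdot> a)) = T \<rho> \<cdot> (lam \<cdot> (xi \<cdot> a))"
    by (rule T_rho_lam[symmetric]) (use a in simp)
  also have "\<dots> = tzero C (TO C M) \<cdot> (\<rho> \<cdot> (xi \<cdot> a))"
    using a by simp
  finally have "tproj C (TO C M) \<cdot> (tlift C M \<cdot> (\<rho> \<cdot> (xi \<cdot> a))) = \<rho> \<cdot> (xi \<cdot> a)" using a by simp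
  then show ?thesis using a by simp
qed

section \<open>The prolongation\<close>

lemma prol_pb: "is_pullback C \<rho> (T pr) \<pi>0 \<pi>1"
  and prol_pb1: "is_pullback C (T \<rho>) (T (T pr)) (T \<pi>0) (T \<pi>1)"
  and prol_pb2: "is_pullback C (T (T \<rho>)) (T (T (T pr))) (T (T \<pi>0)) (T (T \<pi>1))"
  using pullback_preserved_0[OF prolongation] pullback_preserved_0[OF pullback_preserved_T[OF prolongation]]
    pullback_preserved_0[OF pullback_preserved_T[OF pullback_preserved_T[OF prolongation]]]
  by simp_all

lemma prol_arr [simp]: "\<pi>0 \<in> Arr C" "\<pi>1 \<in> Arr C" "Cod C \<pi>0 = E" "Cod C \<pi>1 = TO C E" "Dom C \<pi>1 = Dom C \<pi>0"
  using pullback_arr[OF prol_pb] by simp_all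

lemma prol_square: "\<rho> \<cdot> \<pi>0 = T pr \<cdot> \<pi>1"
  by (rule pullback_arr(8)[OF prol_pb])

lemma prol_el [simp]: "el \<pi>0 E" "el \<pi>1 (TO C E)"
  by (simp_all add: el_def)

lemma alpha_arr [simp]: "\<alpha> \<in> Arr C" "Dom C \<alpha> = Dom C \<pi>0" "Cod C \<alpha> = TO C E"
  using involution_hom by (auto simp: homset_def)

lemma alpha_el [simp]: "el \<alpha> (TO C E)"
  by (simp add: el_def)

text \<open>The arrows into the prolongation and into its image under \<open>T\<close> with given components, and the
  composites of \<open>\<alpha>\<close> and \<open>T(\<alpha>)\<close> with them: \<open>al v w = \<alpha>(v, w)\<close> and \<open>Tal v w = T(\<alpha>)(v, w)\<close>.\<close>

definition prol_pair :: "'a \<Rightarrow> 'a \<Rightarrow> 'a" where "prol_pair v w = pair_arr C \<pi>0 \<pi>1 v w"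
definition T_prol_pair :: "'a \<Rightarrow> 'a \<Rightarrow> 'a" where "T_prol_pair v w = pair_arr C (T \<pi>0) (T \<pi>1) v w"
definition al :: "'a \<Rightarrow> 'a \<Rightarrow> 'a" where "al v w = \<alpha> \<cdot> prol_pair v w"
definition Tal :: "'a \<Rightarrow> 'a \<Rightarrow> 'a" where "Tal v w = T \<alpha> \<cdot> T_prol_pair v w"

lemma prol_pair_facts [simp]:
  assumes "el v E" "el w (TO C E)" "Dom C v = Dom C w" "\<rho> \<cdot> v = T pr \<cdot> w"
  shows "el (prol_pair v w) (Dom C \<pi>0)" "Dom C (prol_pair v w) = Dom C v" "\<pi>0 \<cdot> prol_pair v w = v" "\<pi>1 \<cdot> prol_pair v w = w"
  using pullback_pair[OF prol_pb, of v w] assms by (simp_all add: prol_pair_def)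

lemma prol_pair_eqI:
  assumes "el h (Dom C \<pi>0)" "\<pi>0 \<cdot> h = v" "\<pi>1 \<cdot> h = w"
  shows "h = prol_pair v w"
proof -
  have vw: "el v E" "el w (TO C E)" "Dom C v = Dom C w" "Dom C v = Dom C h"
    using assms by (auto simp flip: assms(2,3))
  have sq: "\<rho> \<cdot> v = T pr \<cdot> w"
    using pullback_square[OF prol_pb assms(1)] unfolding assms(2,3) .
  show ?thesis by (rule pullback_eqI[OF prol_pb assms(1)]) (use vw sq assms(2,3) in simp_all)
qed

lemma T_prol_pair_facts [simp]:
  assumes "el v (TO C E)" "el w (TO C (TO C E))" "Dom C v = Dom C w" "T \<rho> \<cdot> v = T (T pr) \<cdot> w"
  shows "el (T_prol_pair v w) (TO C (Dom C \<pi>0))" "Dom C (T_prol_pair v w) = Dom C v" "T \<pi>0 \<cdot> T_prol_pair v w = v" "T \<pi>1 \<cdot> T_prol_pair v w = w"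
  using pullback_pair[OF prol_pb1, of v w] assms by (simp_all add: T_prol_pair_def)

lemma T_prol_pair_eqI:
  assumes "el h (TO C (Dom C \<pi>0))" "T \<pi>0 \<cdot> h = v" "T \<pi>1 \<cdot> h = w"
  shows "h = T_prol_pair v w"
proof -
  have vw: "el v (TO C E)" "el w (TO C (TO C E))" "Dom C v = Dom C w" "Dom C v = Dom C h"
    using assms by (auto simp flip: assms(2,3))
  have sq: "T \<rho> \<cdot> v = T (T pr) \<cdot> w"
    using pullback_square[OF prol_pb1, of h] assms(1) unfolding assms(2,3) by simp
  show ?thesis by (rule pullback_eqI[OF prol_pb1]) (use assms(1) vw sq assms(2,3) in simp_all)
qed

lemma tproj_alpha: "tproj C E \<cdot> \<alpha> = \<pi>0" and alpha_lift0: "T \<alpha> \<cdot> prol_lift0 C A \<pi>0 \<pi>1 = tlift C E \<cdot> \<alpha>"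
  using involution_linear0 by (simp_all add: linear_bundle_morphism_def)

lemma T_pr_alpha: "T pr \<cdot> \<alpha> = \<rho> \<cdot> (tproj C E \<cdot> \<pi>1)"
  and alpha_lift1: "T \<alpha> \<cdot> prol_lift1 C A \<pi>0 \<pi>1 = (tflip C E \<cdot> T lam) \<cdot> \<alpha>"
  using involution_linear1 by (simp_all add: linear_bundle_morphism_def)

lemma al_facts [simp]:
  assumes "el v E" "el w (TO C E)" "Dom C v = Dom C w" "\<rho> \<cdot> v = T pr \<cdot> w"
  shows "el (al v w) (TO C E)" "Dom C (al v w) = Dom C v" "tproj C E \<cdot> al v w = v"
    "T pr \<cdot> al v w = \<rho> \<cdot> (tproj C E \<cdot> w)"
proof -
  show "el (al v w) (TO C E)" "Dom C (al v w) = Dom C v" using assms by (simp_all add: al_def)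
  show "tproj C E \<cdot> al v w = v"
    unfolding al_def using comp_eq[OF tproj_alpha, of "prol_pair v w"] assms by simp
  have "T pr \<cdot> (\<alpha> \<cdot> prol_pair v w) = \<rho> \<cdot> ((tproj C E \<cdot> \<pi>1) \<cdot> prol_pair v w)"
    by (rule comp_square[OF T_pr_alpha]) (use assms in simp_all)
  then show "T pr \<cdot> al v w = \<rho> \<cdot> (tproj C E \<cdot> w)" using assms by (simp add: al_def)
qed

lemma al_comp:
  assumes "el v E" "el w (TO C E)" "Dom C v = Dom C w" "\<rho> \<cdot> v = T pr \<cdot> w" "el t (Dom C v)"
  shows "al v w \<cdot> t = al (v \<cdot> t) (w \<cdot> t)"
proof -
  have "prol_pair v w \<in> Arr C" "Cod C (prol_pair v w) = Dom C \<pi>0" using prol_pair_facts[OF assms(1-4)] by (simp_all add: el_def)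
  then show ?thesis unfolding al_def
    using pair_comp[OF prol_pb, of v w t] assms by (simp add: prol_pair_def[symmetric])
qed

lemma Tal_facts [simp]:
  assumes "el v (TO C E)" "el w (TO C (TO C E))" "Dom C v = Dom C w" "T \<rho> \<cdot> v = T (T pr) \<cdot> w"
  shows "el (Tal v w) (TO C (TO C E))" "Dom C (Tal v w) = Dom C v" "T (tproj C E) \<cdot> Tal v w = v"
    "T (T pr) \<cdot> Tal v w = T \<rho> \<cdot> (T (tproj C E) \<cdot> w)"
    "tproj C (TO C E) \<cdot> Tal v w = al (tproj C E \<cdot> v) (tproj C (TO C E) \<cdot> w)"
proof -
  have a: "el \<alpha> (TO C E)" by (simp add: el_def)
  show "el (Tal v w) (TO C (TO C E))" "Dom C (Tal v w) = Dom C v" using assms by (simp_all add: Tal_def)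
  show "T (tproj C E) \<cdot> Tal v w = v"
    unfolding Tal_def using comp_eq[OF TA_eq[OF tproj_alpha], of "T_prol_pair v w"] a assms by simp
  have e: "el (tproj C E \<cdot> \<pi>1) E" by simp
  have "T pr \<cdot> \<alpha> = \<rho> \<cdot> (tproj C E \<cdot> \<pi>1)" by (rule T_pr_alpha)
  then have "T (T pr) \<cdot> (T \<alpha> \<cdot> T_prol_pair v w) = T \<rho> \<cdot> (T (tproj C E \<cdot> \<pi>1) \<cdot> T_prol_pair v w)"
    by (rule TA_square) (use assms in simp_all)
  then show "T (T pr) \<cdot> Tal v w = T \<rho> \<cdot> (T (tproj C E) \<cdot> w)"
    using assms TA_el[OF prol_el(2)] by (simp add: Tal_def)
  have "tproj C (Dom C \<pi>0) \<cdot> T_prol_pair v w = prol_pair (tproj C E \<cdot> v) (tproj C (TO C E) \<cdot> w)"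
  proof (rule prol_pair_eqI)
    show "\<pi>0 \<cdot> (tproj C (Dom C \<pi>0) \<cdot> T_prol_pair v w) = tproj C E \<cdot> v"
      using tproj_natural[of \<pi>0 E "T_prol_pair v w"] assms by simp
    show "\<pi>1 \<cdot> (tproj C (Dom C \<pi>0) \<cdot> T_prol_pair v w) = tproj C (TO C E) \<cdot> w"
      using tproj_natural[of \<pi>1 "TO C E" "T_prol_pair v w"] assms by simp
  qed (use assms in simp)
  then show "tproj C (TO C E) \<cdot> Tal v w = al (tproj C E \<cdot> v) (tproj C (TO C E) \<cdot> w)"
    using tproj_natural[of \<alpha> "TO C E" "T_prol_pair v w"] assms by (simp add: Tal_def al_def)
qed

lemma Tal_plus_t:
  assumes "el v (TO C E)" "el w (TO C (TO C E))" "Dom C v = Dom C w" "T \<rho> \<cdot> v = T (T pr) \<cdot> w"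
    "el v' (TO C E)" "el w' (TO C (TO C E))" "Dom C v' = Dom C v" "Dom C w' = Dom C v" "T \<rho> \<cdot> v' = T (T pr) \<cdot> w'"
    "tproj C E \<cdot> v = tproj C E \<cdot> v'" "tproj C (TO C E) \<cdot> w = tproj C (TO C E) \<cdot> w'"
  shows "Tal (v +[tE] v') (w +[tTE] w') = Tal v w +[tTE] Tal v' w'"
proof -
  let ?D = "Dom C \<pi>0"
  have t: "T \<rho> \<cdot> v' = T (T pr) \<cdot> w'" "Dom C v' = Dom C w'" using assms by simp_all
  note h = T_prol_pair_facts[OF assms(1-4)] T_prol_pair_facts[OF assms(5,6) t(2,1)]
  have p: "tproj C ?D \<cdot> T_prol_pair v w = tproj C ?D \<cdot> T_prol_pair v' w'"
  proof (rule pullback_eqI[OF prol_pb])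
    show "\<pi>0 \<cdot> (tproj C ?D \<cdot> T_prol_pair v w) = \<pi>0 \<cdot> (tproj C ?D \<cdot> T_prol_pair v' w')"
      using tproj_natural[of \<pi>0 E "T_prol_pair v w"] tproj_natural[of \<pi>0 E "T_prol_pair v' w'"] h assms(10) by simp
    show "\<pi>1 \<cdot> (tproj C ?D \<cdot> T_prol_pair v w) = \<pi>1 \<cdot> (tproj C ?D \<cdot> T_prol_pair v' w')"
      using tproj_natural[of \<pi>1 "TO C E" "T_prol_pair v w"] tproj_natural[of \<pi>1 "TO C E" "T_prol_pair v' w'"] h assms(11) by simp
  qed (use h assms(7) in simp_all)
  let ?s = "T_prol_pair v w +[tangent_bundle C ?D] T_prol_pair v' w'"
  have d: "Dom C (T_prol_pair v w) = Dom C (T_prol_pair v' w')" using h assms(7) by simp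
  have "?s = T_prol_pair (v +[tE] v') (w +[tTE] w')"
  proof (rule T_prol_pair_eqI)
    show "T \<pi>0 \<cdot> ?s = v +[tE] v'" using TA_tplus[of \<pi>0 ?D, OF _ _ h(1,5) d p] h by simp
    show "T \<pi>1 \<cdot> ?s = w +[tTE] w'" using TA_tplus[of \<pi>1 ?D, OF _ _ h(1,5) d p] h by simp
    show "el ?s (TO C ?D)" using h(1,5) d p by simp
  qed
  moreover have "T \<alpha> \<cdot> ?s = Tal v w +[tTE] Tal v' w'"
    using TA_tplus[of \<alpha> ?D, OF _ _ h(1,5) d p] by (simp add: Tal_def)
  ultimately show ?thesis by (simp add: Tal_def)
qed

lemma Tal_zero:
  assumes "el v E" "el w (TO C E)" "Dom C v = Dom C w" "\<rho> \<cdot> v = T pr \<cdot> w"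
  shows "Tal (tzero C E \<cdot> v) (tzero C (TO C E) \<cdot> w) = tzero C (TO C E) \<cdot> al v w"
proof -
  have "tzero C (Dom C \<pi>0) \<cdot> prol_pair v w = T_prol_pair (tzero C E \<cdot> v) (tzero C (TO C E) \<cdot> w)"
    by (rule T_prol_pair_eqI) (use assms in simp_all)
  then have "Tal (tzero C E \<cdot> v) (tzero C (TO C E) \<cdot> w) = T \<alpha> \<cdot> (tzero C (Dom C \<pi>0) \<cdot> prol_pair v w)"
    by (simp add: Tal_def)
  also have "\<dots> = tzero C (TO C E) \<cdot> al v w" using assms by (simp add: al_def)
  finally show ?thesis .
qed

text \<open>Linearity of \<open>\<alpha>\<close> for the structure over \<open>\<pi>\<^sub>0\<close>, and in the next lemma for the one over \<open>p\<pi>\<^sub>1\<close>.\<close>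

lemma Tal_lift0:
  assumes "el v E" "el w (TO C E)" "Dom C v = Dom C w" "\<rho> \<cdot> v = T pr \<cdot> w"
  shows "Tal (tzero C E \<cdot> v) (tflip C E \<cdot> (T lam \<cdot> w)) = tlift C E \<cdot> al v w"
proof -
  let ?l = "prol_lift0 C A \<pi>0 \<pi>1"
  have sq: "T \<rho> \<cdot> (tzero C E \<cdot> \<pi>0) = T (T pr) \<cdot> (tflip C E \<cdot> (T lam \<cdot> \<pi>1))"
    using prol_square by simp
  have l: "?l = T_prol_pair (tzero C E \<cdot> \<pi>0) (tflip C E \<cdot> (T lam \<cdot> \<pi>1))"
    by (simp add: prol_lift0_def T_prol_pair_def)
  note f = T_prol_pair_facts[OF _ _ _ sq]
  have la: "?l \<in> Arr C" "Dom C ?l = Dom C \<pi>0" "Cod C ?l = TO C (Dom C \<pi>0)"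
    using f(1,2) unfolding l by (simp_all add: el_def)
  have "?l \<cdot> prol_pair v w = T_prol_pair (tzero C E \<cdot> v) (tflip C E \<cdot> (T lam \<cdot> w))"
  proof (rule T_prol_pair_eqI)
    show "T \<pi>0 \<cdot> (?l \<cdot> prol_pair v w) = tzero C E \<cdot> v"
      using comp_eq[of "T \<pi>0" ?l "tzero C E \<cdot> \<pi>0" "prol_pair v w"] f(3) la assms unfolding l by simp
    show "T \<pi>1 \<cdot> (?l \<cdot> prol_pair v w) = tflip C E \<cdot> (T lam \<cdot> w)"
      using comp_eq[of "T \<pi>1" ?l "tflip C E \<cdot> (T lam \<cdot> \<pi>1)" "prol_pair v w"] f(4) la assms unfolding l by simp
  qed (use la assms in simp)
  then have "Tal (tzero C E \<cdot> v) (tflip C E \<cdot> (T lam \<cdot> w)) = T \<alpha> \<cdot> (?l \<cdot> prol_pair v w)" by (simp add: Tal_def)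
  also have "\<dots> = tlift C E \<cdot> (\<alpha> \<cdot> prol_pair v w)"
    by (rule comp_square[OF alpha_lift0]) (use la assms in simp_all)
  finally show ?thesis by (simp add: al_def)
qed

lemma Tal_lift1:
  assumes "el v E" "el w (TO C E)" "Dom C v = Dom C w" "\<rho> \<cdot> v = T pr \<cdot> w"
  shows "Tal (lam \<cdot> v) (tlift C E \<cdot> w) = tflip C E \<cdot> (T lam \<cdot> al v w)"
proof -
  let ?l = "prol_lift1 C A \<pi>0 \<pi>1"
  have sq: "T \<rho> \<cdot> (lam \<cdot> \<pi>0) = T (T pr) \<cdot> (tlift C E \<cdot> \<pi>1)"
    using prol_square by simp
  have l: "?l = T_prol_pair (lam \<cdot> \<pi>0) (tlift C E \<cdot> \<pi>1)"
    by (simp add: prol_lift1_def T_prol_pair_def)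
  note f = T_prol_pair_facts[OF _ _ _ sq]
  have la: "?l \<in> Arr C" "Dom C ?l = Dom C \<pi>0" "Cod C ?l = TO C (Dom C \<pi>0)"
    using f(1,2) unfolding l by (simp_all add: el_def)
  have "?l \<cdot> prol_pair v w = T_prol_pair (lam \<cdot> v) (tlift C E \<cdot> w)"
  proof (rule T_prol_pair_eqI)
    show "T \<pi>0 \<cdot> (?l \<cdot> prol_pair v w) = lam \<cdot> v"
      using comp_eq[of "T \<pi>0" ?l "lam \<cdot> \<pi>0" "prol_pair v w"] f(3) la assms unfolding l by simp
    show "T \<pi>1 \<cdot> (?l \<cdot> prol_pair v w) = tlift C E \<cdot> w"
      using comp_eq[of "T \<pi>1" ?l "tlift C E \<cdot> \<pi>1" "prol_pair v w"] f(4) la assms unfolding l by simp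
  qed (use la assms in simp)
  then have "Tal (lam \<cdot> v) (tlift C E \<cdot> w) = T \<alpha> \<cdot> (?l \<cdot> prol_pair v w)" by (simp add: Tal_def)
  also have "\<dots> = (tflip C E \<cdot> T lam) \<cdot> (\<alpha> \<cdot> prol_pair v w)"
    by (rule comp_square[OF alpha_lift1]) (use la assms el_arr[of "T lam"] in simp_all)
  finally show ?thesis using assms el_arr[of "T lam"] by (simp add: al_def[symmetric])
qed

lemma al_unit:
  assumes "el b E"
  shows "al (xi \<cdot> (pr \<cdot> b)) (lam \<cdot> b) = lam \<cdot> b"
proof -
  have e: "el lam (TO C E)" "el pr M" by (simp_all add: el_def)
  have sq: "\<rho> \<cdot> (xi \<cdot> pr) = T pr \<cdot> lam"
    using lam_proj(2)[of "Idn C E"] e by simp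
  have "al (xi \<cdot> pr) lam = lam" using involution_unit by (simp add: al_def prol_pair_def)
  then have "lam \<cdot> b = al (xi \<cdot> pr) lam \<cdot> b" by simp
  also have "\<dots> = al (xi \<cdot> (pr \<cdot> b)) (lam \<cdot> b)" using al_comp[of "xi \<cdot> pr" lam b] sq e assms by simp
  finally show ?thesis by simp
qed

lemma al_involutive:
  assumes "el v E" "el w (TO C E)" "Dom C v = Dom C w" "\<rho> \<cdot> v = T pr \<cdot> w"
  shows "al (tproj C E \<cdot> w) (al v w) = w"
proof -
  have a: "el \<alpha> (TO C E)" by (simp add: el_def)
  have "al (tproj C E \<cdot> \<pi>1) \<alpha> = \<pi>1" using involution_involutive by (simp add: al_def prol_pair_def)
  then have "w = al (tproj C E \<cdot> \<pi>1) \<alpha> \<cdot> prol_pair v w" using assms by simp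
  also have "\<dots> = al (tproj C E \<cdot> w) (al v w)"
    using al_comp[of "tproj C E \<cdot> \<pi>1" \<alpha> "prol_pair v w"] a T_pr_alpha assms by (simp add: al_def[of v w, symmetric])
  finally show ?thesis by simp
qed

lemma T_rho_al [simp]:
  assumes "el v E" "el w (TO C E)" "Dom C v = Dom C w" "\<rho> \<cdot> v = T pr \<cdot> w"
  shows "T \<rho> \<cdot> al v w = tflip C M \<cdot> (T \<rho> \<cdot> w)"
proof -
  have "T \<rho> \<cdot> (\<alpha> \<cdot> prol_pair v w) = tflip C M \<cdot> ((T \<rho> \<cdot> \<pi>1) \<cdot> prol_pair v w)"
    by (rule comp_square[OF involution_anchor]) (use assms in simp_all)
  then show ?thesis using assms by (simp add: al_def)
qed

lemma al_flip:
  assumes "el v E" "el w (TO C E)" "el x (TO C (TO C E))" "Dom C w = Dom C v" "Dom C x = Dom C v"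
    "\<rho> \<cdot> v = T pr \<cdot> w" "tflip C M \<cdot> (T (T pr) \<cdot> x) = T \<rho> \<cdot> w"
  shows "Tal (al v w) x = tflip C E \<cdot> Tal (al v (tproj C (TO C E) \<cdot> x)) (tflip C E \<cdot> Tal w (tflip C E \<cdot> x))"
  unfolding al_def Tal_def prol_pair_def T_prol_pair_def
  by (rule involution_flip[of v "Dom C v"]) (use assms in \<open>simp_all add: homset_iff\<close>)

text \<open>The image under \<open>T\<close> of the additivity of \<open>\<alpha>\<close> over \<open>\<pi>\<^sub>0\<close>. It is proved directly rather than by
  applying \<open>T\<close>, since no pullback of \<open>\<pi>\<^sub>0\<close> along itself is given. After composition with the
  monic arrow \<open>T(l)\<close>, linearity turns it into additivity of \<open>T\<^sup>2(\<alpha>)\<close> for \<open>T(p)\<close>.\<close>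

lemma Tal_plus_T:
  assumes u: "el u (TO C E)" and x: "el x (TO C (TO C E))" "el x' (TO C (TO C E))"
    and d: "Dom C x = Dom C u" "Dom C x' = Dom C u"
    and sq: "T \<rho> \<cdot> u = T (T pr) \<cdot> x" "T (T pr) \<cdot> x' = T (T pr) \<cdot> x"
  shows "Tal u (x +[TTB] x') = Tal u x +[TtE] Tal u x'"
proof (rule T_tlift_injective)
  let ?l = "prol_lift0 C A \<pi>0 \<pi>1" and ?D = "Dom C \<pi>0"
  have sq0: "T \<rho> \<cdot> (tzero C E \<cdot> \<pi>0) = T (T pr) \<cdot> (tflip C E \<cdot> (T lam \<cdot> \<pi>1))"
    using prol_square by simp
  have l: "?l = T_prol_pair (tzero C E \<cdot> \<pi>0) (tflip C E \<cdot> (T lam \<cdot> \<pi>1))"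
    by (simp add: prol_lift0_def T_prol_pair_def)
  note f = T_prol_pair_facts[OF _ _ _ sq0, folded l]
  have le: "el ?l (TO C ?D)" "Dom C ?l = ?D" using f(1,2) by simp_all
  have la: "?l \<in> Arr C" "Cod C ?l = TO C ?D" using le by (simp_all add: el_def)
  have l0: "T \<pi>0 \<cdot> ?l = tzero C E \<cdot> \<pi>0" "T \<pi>1 \<cdot> ?l = tflip C E \<cdot> (T lam \<cdot> \<pi>1)"
    using f(3,4) by simp_all
  \<comment> \<open>\<open>k y\<close> is the image of the pair \<open>(u, y)\<close> under \<open>T\<close> of the lift over \<open>\<pi>\<^sub>0\<close>; it is additive in \<open>y\<close>.\<close>
  define k where "k y = T ?l \<cdot> T_prol_pair u y" for y
  have k: "el (k y) (TO C (TO C ?D))" "Dom C (k y) = Dom C u" "T (T \<pi>0) \<cdot> k y = T (tzero C E) \<cdot> u"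
     "T (T \<pi>1) \<cdot> k y = T (tflip C E) \<cdot> (T (T lam) \<cdot> y)"
     "T (T \<alpha>) \<cdot> k y = T (tlift C E) \<cdot> Tal u y"
     "T (tproj C ?D) \<cdot> k y = T_prol_pair u (T (T xi) \<cdot> (T (T pr) \<cdot> y))"
    if y: "el y (TO C (TO C E))" "Dom C y = Dom C u" "T \<rho> \<cdot> u = T (T pr) \<cdot> y" for y
  proof -
    note t = T_prol_pair_facts[OF u y(1) y(2)[symmetric] y(3)]
    show ke: "el (k y) (TO C (TO C ?D))" "Dom C (k y) = Dom C u" using t le la by (simp_all add: k_def)
    have e: "el (tzero C E \<cdot> \<pi>0) (TO C E)" "el (T lam \<cdot> \<pi>1) (TO C (TO C E))" by simp_all
    have "T (T \<pi>0) \<cdot> k y = T (tzero C E \<cdot> \<pi>0) \<cdot> T_prol_pair u y"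
      unfolding k_def by (rule comp_eq[OF TA_eq[OF l0(1)]]) (use t le la in simp_all)
    then show k0: "T (T \<pi>0) \<cdot> k y = T (tzero C E) \<cdot> u"
      using t TA_el[OF prol_el(1)] by simp
    have "T (T \<pi>1) \<cdot> k y = T (tflip C E \<cdot> (T lam \<cdot> \<pi>1)) \<cdot> T_prol_pair u y"
      unfolding k_def by (rule comp_eq[OF TA_eq[OF l0(2)]]) (use t le la in simp_all)
    then show k1: "T (T \<pi>1) \<cdot> k y = T (tflip C E) \<cdot> (T (T lam) \<cdot> y)"
      using t TA_el[OF prol_el(2)] by simp
    show "T (T \<alpha>) \<cdot> k y = T (tlift C E) \<cdot> Tal u y"
      unfolding k_def Tal_def by (rule TA_square[OF alpha_lift0]) (use t la le in simp_all)
    have pf: "T (tproj C (TO C E)) \<cdot> (T (tflip C E) \<cdot> s) = T (T (tproj C E)) \<cdot> s" if "el s (TO C (TO C (TO C E)))" for s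
    proof -
      have "tproj C (TO C E) \<cdot> tflip C E = T (tproj C E)"
        using tproj_flip[of E "Idn C (TO C (TO C E))"] el_arr[of "T (tproj C E)"] by simp
      from comp_eq[OF TA_eq[OF this]] show ?thesis using that by simp
    qed
    have pl: "T (T (tproj C E)) \<cdot> (T (T lam) \<cdot> y) = T (T xi) \<cdot> (T (T pr) \<cdot> y)"
    proof -
      have "T (tproj C E) \<cdot> T lam = T xi \<cdot> T pr"
        using T_proj_T_lam[of "Idn C (TO C E)"] by simp
      then show ?thesis by (rule TA_square) (use y in simp_all)
    qed
    show "T (tproj C ?D) \<cdot> k y = T_prol_pair u (T (T xi) \<cdot> (T (T pr) \<cdot> y))"
    proof (rule T_prol_pair_eqI)
      show "T \<pi>0 \<cdot> (T (tproj C ?D) \<cdot> k y) = u"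
        using T_tproj_natural[of \<pi>0 E "k y"] ke k0 u by simp
      show "T \<pi>1 \<cdot> (T (tproj C ?D) \<cdot> k y) = T (T xi) \<cdot> (T (T pr) \<cdot> y)"
        using T_tproj_natural[of \<pi>1 "TO C E" "k y"] ke k1 y pf[of "T (T lam) \<cdot> y"] pl by simp
    qed (use ke in simp)
  qed
  let ?y = "x +[TTB] x'"
  have y: "el ?y (TO C (TO C E))" "Dom C ?y = Dom C u" "T \<rho> \<cdot> u = T (T pr) \<cdot> ?y"
    using x d sq by simp_all
  have sq': "T \<rho> \<cdot> u = T (T pr) \<cdot> x'" using sq by simp
  note kx = k[OF x(1) d(1) sq(1)] and kx' = k[OF x(2) d(2) sq'] and ky = k[OF y]
  have p: "T (tproj C ?D) \<cdot> k x = T (tproj C ?D) \<cdot> k x'" using kx(6) kx'(6) sq(2) by simp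
  let ?s = "k x +[T_bundle C (tangent_bundle C ?D)] k x'"
  have dd: "Dom C (k x) = Dom C (k x')" using kx(2) kx'(2) by simp
  have s: "el ?s (TO C (TO C ?D))" "Dom C ?s = Dom C u" using kx(1,2) kx'(1) dd p by simp_all
  note ad = TTA_Ttplus[OF _ _ kx(1) kx'(1) dd p]
  have z: "T (tzero C E) \<cdot> u +[TtE] T (tzero C E) \<cdot> u = T (tzero C E) \<cdot> u"
    by (rule fibre_plus_zero) (use u in simp_all)
  have "k ?y = ?s"
  proof (rule pullback_eqI[OF prol_pb2])
    show "T (T \<pi>0) \<cdot> k ?y = T (T \<pi>0) \<cdot> ?s"
      using ad[of \<pi>0] kx(3) kx'(3) ky(3) z by simp
    have e1: "T (T lam) \<cdot> ?y = T (T lam) \<cdot> x +[T_bundle C TtE] T (T lam) \<cdot> x'"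
      using bundle_morphism_plus[OF bundle_morphism_T[OF bundle_morphism_T[OF blift_bzero_additive]], of x x'] x d sq by simp
    have e2: "T (tflip C E) \<cdot> (T (T lam) \<cdot> x +[T_bundle C TtE] T (T lam) \<cdot> x')
       = T (tflip C E) \<cdot> (T (T lam) \<cdot> x) +[T_bundle C tTE] T (tflip C E) \<cdot> (T (T lam) \<cdot> x')"
    proof -
      have "T (T (tproj C E)) \<cdot> (T (T lam) \<cdot> x) = T (T (tproj C E)) \<cdot> (T (T lam) \<cdot> x')"
      proof -
        have "T (tproj C E) \<cdot> T lam = T xi \<cdot> T pr"
          using T_proj_T_lam[of "Idn C (TO C E)"] by simp
        then have "T (T (tproj C E)) \<cdot> (T (T lam) \<cdot> w) = T (T xi) \<cdot> (T (T pr) \<cdot> w)"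
          if "el w (TO C (TO C E))" for w
          by (rule TA_square) (use that in simp_all)
        then show ?thesis using x sq by simp
      qed
      note F = this
      have G: "additive_bundle_morphism C (T_bundle C TtE) (T_bundle C tTE) (T (tflip C E)) (T (Idn C (TO C E)))"
        by (rule bundle_morphism_T[OF tflip_additive[of E]]) simp_all
      show ?thesis
        by (rule bundle_morphism_plus[OF G]) (use x d in \<open>simp_all only: F T_bundle_simps tangent_bundle_simps TA_dom TA_arr tproj_arr
          stable_bundle_T stable_tangent_bundle arr_obj stable_arr stable_A el_comp dom_comp TA_cod TO_Obj lam_arr\<close>)
    qed
    have 1: "T (T \<pi>1) \<cdot> k ?y = T (T \<pi>1) \<cdot> k x +[T_bundle C tTE] T (T \<pi>1) \<cdot> k x'"
      by (simp only: kx(4) kx'(4) ky(4) e1 e2)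
    have 2: "T (T \<pi>1) \<cdot> ?s = T (T \<pi>1) \<cdot> k x +[T_bundle C tTE] T (T \<pi>1) \<cdot> k x'"
      using ad[of \<pi>1] by (simp only: prol_arr simp_thms)
    show "T (T \<pi>1) \<cdot> k ?y = T (T \<pi>1) \<cdot> ?s" by (simp only: 1 2)
  qed (use ky s in simp_all)
  then have "T (tlift C E) \<cdot> Tal u ?y = T (T \<alpha>) \<cdot> ?s" using ky(5) by (simp only:)
  also have "\<dots> = T (tlift C E) \<cdot> Tal u x +[T_bundle C tTE] T (tlift C E) \<cdot> Tal u x'"
    using ad[of \<alpha>] by (simp only: alpha_arr simp_thms kx(5) kx'(5))
  also have "\<dots> = T (tlift C E) \<cdot> (Tal u x +[TtE] Tal u x')"
    using bundle_morphism_plus[OF bundle_morphism_T[OF tlift_additive_t[of E]], of "Tal u x" "Tal u x'"] x u d sq by simp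
  finally show "T (tlift C E) \<cdot> Tal u ?y = T (tlift C E) \<cdot> (Tal u x +[TtE] Tal u x')" .
qed (use assms in simp_all)

text \<open>Additivity over \<open>\<pi>\<^sub>0\<close>, the restriction of the previous lemma along the monic \<open>0\<close>.\<close>

lemma al_plus0:
  assumes v: "el v E" and w: "el w (TO C E)" "el w' (TO C E)" "Dom C w = Dom C v" "Dom C w' = Dom C v"
    and sq: "\<rho> \<cdot> v = T pr \<cdot> w" "T pr \<cdot> w' = T pr \<cdot> w"
  shows "al v (w +[TB] w') = al v w +[tE] al v w'"
proof (rule tzero_injective)
  let ?o = "tzero C (TO C E)"
  have "?o \<cdot> al v (w +[TB] w') = Tal (tzero C E \<cdot> v) (?o \<cdot> (w +[TB] w'))"
    by (rule Tal_zero[symmetric]) (use assms in simp_all)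
  also have "\<dots> = Tal (tzero C E \<cdot> v) (?o \<cdot> w +[TTB] ?o \<cdot> w')"
    using assms by simp
  also have "\<dots> = Tal (tzero C E \<cdot> v) (?o \<cdot> w) +[TtE] Tal (tzero C E \<cdot> v) (?o \<cdot> w')"
    by (rule Tal_plus_T) (use assms in simp_all)
  also have "\<dots> = ?o \<cdot> al v w +[TtE] ?o \<cdot> al v w'"
    using Tal_zero[of v w] Tal_zero[of v w'] assms by simp
  also have "\<dots> = ?o \<cdot> (al v w +[tE] al v w')"
    using assms by simp
  finally show "?o \<cdot> al v (w +[TB] w') = ?o \<cdot> (al v w +[tE] al v w')" .
qed (use assms in simp_all)

text \<open>Additivity over \<open>p\<pi>\<^sub>1\<close>; the arrow \<open>cT(\<lambda>)\<close> is monic.\<close>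

lemma al_plus1:
  assumes v: "el v E" "el v' E" "Dom C v' = Dom C v" and w: "el w (TO C E)" "el w' (TO C E)" "Dom C w = Dom C v" "Dom C w' = Dom C v"
    and sq: "\<rho> \<cdot> v = T pr \<cdot> w" "\<rho> \<cdot> v' = T pr \<cdot> w'" and q: "pr \<cdot> v = pr \<cdot> v'" "tproj C E \<cdot> w = tproj C E \<cdot> w'"
  shows "al (v +[A] v') (w +[tE] w') = al v w +[TB] al v' w'"
proof (rule T_lam_injective, rule flip_eqD[of E])
  have s: "\<rho> \<cdot> (v +[A] v') = T pr \<cdot> (w +[tE] w')" using assms by simp
  have "tflip C E \<cdot> (T lam \<cdot> al (v +[A] v') (w +[tE] w')) = Tal (lam \<cdot> (v +[A] v')) (tlift C E \<cdot> (w +[tE] w'))"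
    by (rule Tal_lift1[symmetric]) (use v w q s in simp_all)
  also have "lam \<cdot> (v +[A] v') = lam \<cdot> v +[tE] lam \<cdot> v'"
    by (rule lam_plus_t[OF is_lift_A]) (use v q in simp_all)
  also have "tlift C E \<cdot> (w +[tE] w') = tlift C E \<cdot> w +[tTE] tlift C E \<cdot> w'"
    using bundle_morphism_plus[OF tlift_additive_t[of E], of w w'] w q by simp
  also have "Tal (lam \<cdot> v +[tE] lam \<cdot> v') (tlift C E \<cdot> w +[tTE] tlift C E \<cdot> w') =
    Tal (lam \<cdot> v) (tlift C E \<cdot> w) +[tTE] Tal (lam \<cdot> v') (tlift C E \<cdot> w')"
    by (rule Tal_plus_t) (use v w sq q in simp_all)
  also have "\<dots> = tflip C E \<cdot> (T lam \<cdot> (al v w)) +[tTE] tflip C E \<cdot> (T lam \<cdot> al v' w')"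
    using Tal_lift1[of v w] Tal_lift1[of v' w'] v w sq by simp
  also have "\<dots> = tflip C E \<cdot> (T lam \<cdot> (al v w +[TB] al v' w'))"
    using v w sq q by simp
  finally show "tflip C E \<cdot> (T lam \<cdot> al (v +[A] v') (w +[tE] w')) = tflip C E \<cdot> (T lam \<cdot> (al v w +[TB] al v' w'))" .
qed (use assms in simp_all)

section \<open>Sections and complete lifts\<close>

abbreviation "sec X \<equiv> X \<in> bundle_sections C A"

lemma sec_facts [simp]:
  assumes "sec X"
  shows "X \<in> Arr C" "Dom C X = M" "Cod C X = E" "el X E" "pr \<cdot> X = Idn C M"
  using assms by (auto simp: bundle_sections_def homset_def el_def)

lemma secI: "\<lbrakk>el X E; Dom C X = M; pr \<cdot> X = Idn C M\<rbrakk> \<Longrightarrow> sec X"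
  unfolding bundle_sections_def homset_iff by blast

lemma sec_pr [simp]: "\<lbrakk>sec X; el a M\<rbrakk> \<Longrightarrow> pr \<cdot> (X \<cdot> a) = a"
  using comp_eq[OF sec_facts(5)[of X], of a] by simp

lemma sec_T_pr [simp]: "\<lbrakk>sec X; el s (TO C M)\<rbrakk> \<Longrightarrow> T pr \<cdot> (T X \<cdot> s) = s"
  using comp_eq[OF TA_eq[OF sec_facts(5)[of X]], of s] by simp

lemma sec_TT_pr [simp]: "\<lbrakk>sec X; el s (TO C (TO C M))\<rbrakk> \<Longrightarrow> T (T pr) \<cdot> (T (T X) \<cdot> s) = s"
  using comp_eq[OF TA_eq[OF TA_eq[OF sec_facts(5)[of X]]], of s] by simp

lemma sec_plus [simp]:
  assumes "sec X" "sec Y" shows "sec (X +[A] Y)"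
  by (rule secI) (use assms in simp_all)

lemma T_sec_plus_el:
  assumes X: "sec X" "sec Y" and s: "el s (TO C M)"
  shows "T (X +[A] Y) \<cdot> s = T X \<cdot> s +[TB] T Y \<cdot> s"
proof -
  have "T (X +[A] Y) = T X +[TB] T Y"
    by (rule TA_plus) (use X in simp_all)
  moreover have "(T X +[TB] T Y) \<cdot> s = T X \<cdot> s +[TB] T Y \<cdot> s"
    by (rule fibre_plus_comp) (use X s sec_T_pr[OF X(1), of "Idn C (TO C M)"] sec_T_pr[OF X(2), of "Idn C (TO C M)"] in simp_all)
  ultimately show ?thesis by simp
qed

text \<open>The complete lift \<open>a \<mapsto> \<alpha>(a, T(X)\<rho>a)\<close> of a section. It is a vector field on \<open>E\<close> and a
  linear bundle morphism from \<open>A\<close> to \<open>T(A)\<close> over \<open>\<rho>X\<close> (\<open>complete_lift_plus\<close>, \<open>T_complete_lift_lam\<close>).\<close>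

definition complete_lift :: "'a \<Rightarrow> 'a" where "complete_lift X = al (Idn C E) (T X \<cdot> \<rho>)"

lemma complete_lift_arr [simp]:
  assumes "sec X" shows "complete_lift X \<in> Arr C" "Dom C (complete_lift X) = E" "Cod C (complete_lift X) = TO C E" "el (complete_lift X) (TO C E)"
proof -
  have "el (complete_lift X) (TO C E)" "Dom C (complete_lift X) = E" unfolding complete_lift_def using assms by simp_all
  then show "complete_lift X \<in> Arr C" "Dom C (complete_lift X) = E" "Cod C (complete_lift X) = TO C E" "el (complete_lift X) (TO C E)" by (simp_all add: el_def)
qed

lemma complete_lift_el:
  assumes "sec X" "el a E" shows "complete_lift X \<cdot> a = al a (T X \<cdot> (\<rho> \<cdot> a))"
  unfolding complete_lift_def using al_comp[of "Idn C E" "T X \<cdot> \<rho>" a] assms by simp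

lemma complete_lift_vector_field [simp]:
  assumes "sec X" shows "vector_field E (complete_lift X)"
proof (rule vector_fieldI)
  show "tproj C E \<cdot> complete_lift X = Idn C E" unfolding complete_lift_def using assms by simp
qed (use assms in simp_all)

lemma T_pr_complete_lift [simp]:
  assumes "sec X" "el a E" shows "T pr \<cdot> (complete_lift X \<cdot> a) = \<rho> \<cdot> (X \<cdot> (pr \<cdot> a))"
  unfolding complete_lift_el[OF assms] using assms by simp

lemma T_complete_lift_el:
  assumes "sec X" "el s (TO C E)" shows "T (complete_lift X) \<cdot> s = Tal s (T (T X) \<cdot> (T \<rho> \<cdot> s))"
proof -
  have p: "el (prol_pair (Idn C E) (T X \<cdot> \<rho>)) (Dom C \<pi>0)" "Dom C (prol_pair (Idn C E) (T X \<cdot> \<rho>)) = E"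
     "\<pi>0 \<cdot> prol_pair (Idn C E) (T X \<cdot> \<rho>) = Idn C E" "\<pi>1 \<cdot> prol_pair (Idn C E) (T X \<cdot> \<rho>) = T X \<cdot> \<rho>"
    using assms by simp_all
  have pa: "prol_pair (Idn C E) (T X \<cdot> \<rho>) \<in> Arr C" "Cod C (prol_pair (Idn C E) (T X \<cdot> \<rho>)) = Dom C \<pi>0"
    using p by (simp_all add: el_def)
  have "T (prol_pair (Idn C E) (T X \<cdot> \<rho>)) \<cdot> s = T_prol_pair s (T (T X) \<cdot> (T \<rho> \<cdot> s))"
  proof (rule T_prol_pair_eqI)
    show "T \<pi>0 \<cdot> (T (prol_pair (Idn C E) (T X \<cdot> \<rho>)) \<cdot> s) = s"
      using comp_eq[OF TA_eq[OF p(3)], of s] p pa assms by simp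
    have "T \<pi>1 \<cdot> (T (prol_pair (Idn C E) (T X \<cdot> \<rho>)) \<cdot> s) = T (T X \<cdot> \<rho>) \<cdot> s"
      by (rule comp_eq[OF TA_eq[OF p(4)]]) (use p pa assms in simp_all)
    then show "T \<pi>1 \<cdot> (T (prol_pair (Idn C E) (T X \<cdot> \<rho>)) \<cdot> s) = T (T X) \<cdot> (T \<rho> \<cdot> s)"
      using assms TA_el[OF rho_el] by simp
  qed (use p pa assms in simp)
  then show ?thesis
    unfolding complete_lift_def al_def Tal_def using p pa assms TA_el[OF p(1)] by simp
qed

lemma complete_lift_plus:
  assumes X: "sec X" and a: "el a E" "el b E" "Dom C a = Dom C b" "pr \<cdot> a = pr \<cdot> b"
  shows "complete_lift X \<cdot> (a +[A] b) = complete_lift X \<cdot> a +[TB] complete_lift X \<cdot> b"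
proof -
  have "complete_lift X \<cdot> (a +[A] b) = al (a +[A] b) (T X \<cdot> (\<rho> \<cdot> (a +[A] b)))"
    by (rule complete_lift_el) (use X a in simp_all)
  also have "T X \<cdot> (\<rho> \<cdot> (a +[A] b)) = T X \<cdot> (\<rho> \<cdot> a) +[tE] T X \<cdot> (\<rho> \<cdot> b)"
    using X a by simp
  also have "al (a +[A] b) \<dots> = al a (T X \<cdot> (\<rho> \<cdot> a)) +[TB] al b (T X \<cdot> (\<rho> \<cdot> b))"
    by (rule al_plus1) (use X a in simp_all)
  finally show ?thesis using X a by (simp add: complete_lift_el)
qed

lemma T_complete_lift_lam:
  assumes "sec X" "el a E" shows "T (complete_lift X) \<cdot> (lam \<cdot> a) = tflip C E \<cdot> (T lam \<cdot> (complete_lift X \<cdot> a))"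
proof -
  have "T (complete_lift X) \<cdot> (lam \<cdot> a) = Tal (lam \<cdot> a) (tlift C E \<cdot> (T X \<cdot> (\<rho> \<cdot> a)))"
    using T_complete_lift_el[OF assms(1), of "lam \<cdot> a"] assms by simp
  also have "\<dots> = tflip C E \<cdot> (T lam \<cdot> (complete_lift X \<cdot> a))"
    unfolding complete_lift_el[OF assms] by (rule Tal_lift1) (use assms in simp_all)
  finally show ?thesis .
qed

lemma complete_lift_morphism:
  assumes X: "sec X"
  shows "additive_bundle_morphism C A TB (complete_lift X) (\<rho> \<cdot> X)"
  by (rule additive_bundle_morphismI) (use X complete_lift_plus[OF X] in simp_all)

lemma T_complete_lift_Tplus:
  assumes X: "sec X" and a: "el s (TO C E)" "el t (TO C E)" "Dom C s = Dom C t" "T pr \<cdot> s = T pr \<cdot> t"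
  shows "T (complete_lift X) \<cdot> (s +[TB] t) = T (complete_lift X) \<cdot> s +[TTB] T (complete_lift X) \<cdot> t"
  using bundle_morphism_plus[OF bundle_morphism_T[OF complete_lift_morphism[OF X]], of s t] a by simp

lemma complete_lift_section_plus:
  assumes X: "sec X" "sec Y" and a: "el a E"
  shows "complete_lift (X +[A] Y) \<cdot> a = complete_lift X \<cdot> a +[tE] complete_lift Y \<cdot> a"
proof -
  have "complete_lift (X +[A] Y) \<cdot> a = al a (T (X +[A] Y) \<cdot> (\<rho> \<cdot> a))"
    by (rule complete_lift_el) (use X a in simp_all)
  also have "T (X +[A] Y) \<cdot> (\<rho> \<cdot> a) = T X \<cdot> (\<rho> \<cdot> a) +[TB] T Y \<cdot> (\<rho> \<cdot> a)"
    by (rule T_sec_plus_el) (use X a in simp_all)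
  also have "al a \<dots> = al a (T X \<cdot> (\<rho> \<cdot> a)) +[tE] al a (T Y \<cdot> (\<rho> \<cdot> a))"
    by (rule al_plus0) (use X a in simp_all)
  finally show ?thesis by (simp only: complete_lift_el[OF X(1) a] complete_lift_el[OF X(2) a])
qed

section \<open>The bracket\<close>

text \<open>The existence half of the universal property of \<open>\<mu>\<close>.\<close>

lemma m_exists:
  assumes d: "el d (TO C E)" "T pr \<cdot> d = tzero C M \<cdot> (pr \<cdot> (tproj C E \<cdot> d))"
  shows "\<exists>b. el b E \<and> Dom C b = Dom C d \<and> pr \<cdot> b = pr \<cdot> (tproj C E \<cdot> d) \<and> d = m (tproj C E \<cdot> d) b"
proof -
  have fs: "bfst A \<in> Arr C" "bsnd A \<in> Arr C" "el (bfst A) E" "el (bsnd A) E" by (simp_all add: el_def)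
  have sq: "pr \<cdot> bfst A = pr \<cdot> bsnd A" by (rule pullback_arr(8)[OF bundle_pullback])
  have ty: "el (tzero C E \<cdot> bfst A) (TO C E)" "el (lam \<cdot> bsnd A) (TO C E)"
    "Dom C (tzero C E \<cdot> bfst A) = Dom C (lam \<cdot> bsnd A)"
    "T pr \<cdot> (tzero C E \<cdot> bfst A) = T pr \<cdot> (lam \<cdot> bsnd A)"
    "Dom C (tzero C E \<cdot> bfst A) = Dom C (bfst A)"
    using fs sq by simp_all
  have mue: "el (bundle_mu C A) (TO C E)" "Dom C (bundle_mu C A) = Dom C (bfst A)"
    unfolding bundle_mu_def using ty by simp_all
  have "is_equaliser C ((T ^^ 0) (T pr)) ((T ^^ 0) (tzero C M \<cdot> pr \<cdot> tproj C E)) ((T ^^ 0) (bundle_mu C A))"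
    using bundle_mu_equaliser unfolding equaliser_preserved_def by blast
  then have e: "is_equaliser C (T pr) (tzero C M \<cdot> pr \<cdot> tproj C E) (bundle_mu C A)" by simp
  have "d \<in> homset C (Dom C d) (Dom C (T pr)) \<and> T pr \<cdot> d = (tzero C M \<cdot> pr \<cdot> tproj C E) \<cdot> d"
    using d by (simp add: homset_iff)
  then obtain h where "h \<in> homset C (Dom C d) (Dom C (bundle_mu C A))" "bundle_mu C A \<cdot> h = d"
    using e unfolding is_equaliser_def by blast
  then have h: "el h (Dom C (bfst A))" "Dom C h = Dom C d" "bundle_mu C A \<cdot> h = d"
    using mue by (simp_all add: homset_iff)
  have q: "pr \<cdot> (bfst A \<cdot> h) = pr \<cdot> (bsnd A \<cdot> h)" by (rule pullback_square[OF bundle_pullback h(1)])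
  have "bundle_mu C A \<cdot> h = (tzero C E \<cdot> bfst A) \<cdot> h +[TB] (lam \<cdot> bsnd A) \<cdot> h"
    unfolding bundle_mu_def by (rule fibre_plus_comp) (use ty h in simp_all)
  then have dm: "d = m (bfst A \<cdot> h) (bsnd A \<cdot> h)" using h fs by (simp add: mu_def)
  have f: "el (bfst A \<cdot> h) E" "el (bsnd A \<cdot> h) E" "Dom C (bfst A \<cdot> h) = Dom C d" "Dom C (bsnd A \<cdot> h) = Dom C d"
    using h fs by simp_all
  have "tproj C E \<cdot> m (bfst A \<cdot> h) (bsnd A \<cdot> h) = bfst A \<cdot> h"
    by (rule m_facts(3)) (use f q in simp_all)
  then have "tproj C E \<cdot> d = bfst A \<cdot> h" using dm by simp
  then show ?thesis using f q dm by metis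
qed

text \<open>The difference defining the bracket is in the image of \<open>\<lambda>\<close>, and the resulting section is
  characterised by an equation without subtraction.\<close>

lemma bracket_exists:
  assumes X: "sec X" "sec Y"
  shows "\<exists>b. sec b \<and> lam \<cdot> b = bracket_difference C A \<rho> \<pi>0 \<pi>1 \<alpha> X Y
    \<and> complete_lift Y \<cdot> X = T X \<cdot> (\<rho> \<cdot> Y) +[tE] m X b"
proof -
  let ?P1 = "complete_lift Y \<cdot> X" and ?P2 = "T X \<cdot> (\<rho> \<cdot> Y)"
  let ?D1 = "bminus C tE ?P1 ?P2"
  let ?D = "bminus C TB ?D1 (tzero C E \<cdot> X)"
  have br: "bracket_difference C A \<rho> \<pi>0 \<pi>1 \<alpha> X Y = ?D"
    using complete_lift_el[of Y X] X by (simp add: bracket_difference_def al_def prol_pair_def)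
  have neg: "\<exists>n. is_negation C tE n" "\<exists>n. is_negation C TB n"
    using stable_tangent_bundle[of E] stable_bundle_T[OF stable_A] unfolding stable_bundle_def[of tE] stable_bundle_def[of TB] by simp_all
  have P: "el ?P1 (TO C E)" "el ?P2 (TO C E)" "Dom C ?P1 = M" "Dom C ?P2 = M" "tproj C E \<cdot> ?P1 = X" "tproj C E \<cdot> ?P2 = X"
    "T pr \<cdot> ?P1 = \<rho> \<cdot> Y" "T pr \<cdot> ?P2 = \<rho> \<cdot> Y"
    using X by simp_all
  note D1 = minus_plus[OF stable_additive[OF stable_tangent_bundle[of E]] neg(1), of ?P1 ?P2, simplified]
  have D1: "el ?D1 (TO C E)" "Dom C ?D1 = M" "tproj C E \<cdot> ?D1 = X" "?D1 +[tE] ?P2 = ?P1"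
    using D1 P by simp_all
  have o: "el (tzero C M) (TO C M)" by simp
  \<comment> \<open>\<open>T(\<pi>)\<close> is additive for \<open>p\<close> and takes the same value on both terms of the difference.\<close>
  have T1: "T pr \<cdot> ?D1 = tzero C M"
  proof (rule fibre_plus_cancel_right[of "tangent_bundle C M" _ _ "\<rho> \<cdot> Y"])
    have "T pr \<cdot> ?D1 +[tangent_bundle C M] \<rho> \<cdot> Y = T pr \<cdot> (?D1 +[tE] ?P2)"
      using TA_tplus[of pr E ?D1 ?P2] D1(1-3) P by simp
    also have "\<dots> = \<rho> \<cdot> Y" unfolding D1(4) by (rule P(7))
    also have "\<dots> = tzero C M +[tangent_bundle C M] \<rho> \<cdot> Y"
      using fibre_zero_plus[of "tangent_bundle C M" "tzero C M" "\<rho> \<cdot> Y" "Idn C M"] X by simp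
    finally show "T pr \<cdot> ?D1 +[tangent_bundle C M] \<rho> \<cdot> Y = tzero C M +[tangent_bundle C M] \<rho> \<cdot> Y" .
    show "bproj (tangent_bundle C M) \<cdot> (T pr \<cdot> ?D1) = bproj (tangent_bundle C M) \<cdot> (\<rho> \<cdot> Y)"
      using tproj_natural[of pr M ?D1] D1 X by simp
  qed (use D1(1,2) X in simp_all)
  obtain b where b: "el b E" "Dom C b = M" "pr \<cdot> b = Idn C M" "?D1 = m X b"
    using m_exists[of ?D1] D1 T1 X by auto
  have sb: "sec b" by (rule secI) (use b in simp_all)
  have "lam \<cdot> b = ?D"
  proof (rule fibre_plus_cancel_right[of TB _ _ "tzero C E \<cdot> X"])
    note D = minus_plus[OF stable_additive[OF stable_bundle_T[OF stable_A]] neg(2), of ?D1 "tzero C E \<cdot> X", simplified]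
    have t: "T pr \<cdot> ?D1 = tzero C M \<cdot> Idn C M" using T1 by simp
    have D: "el ?D (TO C E)" "Dom C ?D = M" "T pr \<cdot> ?D = tzero C M" "?D +[TB] tzero C E \<cdot> X = ?D1"
      using D D1(1,2) T1 X by simp_all
    show "el ?D (Dom C (bproj TB))" "Dom C ?D = Dom C (tzero C E \<cdot> X)" "bproj TB \<cdot> ?D = bproj TB \<cdot> (tzero C E \<cdot> X)"
      using D X by simp_all
    have "lam \<cdot> b +[TB] tzero C E \<cdot> X = m X b"
      unfolding mu_def by (rule fibre_plus_commute) (use sb X in simp_all)
    then show "lam \<cdot> b +[TB] tzero C E \<cdot> X = ?D +[TB] tzero C E \<cdot> X" using b(4) D(4) by simp
  qed (use sb X in simp_all)
  moreover have "?P1 = ?P2 +[tE] m X b"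
    using fibre_plus_commute[of tE ?D1 ?P2] D1 P b(4) by simp
  ultimately show ?thesis using sb br by auto
qed

lemma lam_injective: "\<lbrakk>lam \<cdot> u = lam \<cdot> v; el u E; el v E; Dom C u = Dom C v\<rbrakk> \<Longrightarrow> u = v"
  by (rule lift_inj[OF is_lift_A])

lemma bracket_exists_unique:
  assumes X: "sec X" "sec Y"
  shows "\<exists>!Z. sec Z \<and> lam \<cdot> Z = bracket_difference C A \<rho> \<pi>0 \<pi>1 \<alpha> X Y"
proof -
  obtain b where b: "sec b" "lam \<cdot> b = bracket_difference C A \<rho> \<pi>0 \<pi>1 \<alpha> X Y"
    using bracket_exists[OF assms] by blast
  show ?thesis
  proof (rule ex1I[of _ b])
    fix Z assume Z: "sec Z \<and> lam \<cdot> Z = bracket_difference C A \<rho> \<pi>0 \<pi>1 \<alpha> X Y"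
    show "Z = b" by (rule lam_injective) (use Z b in simp_all)
  qed (use b in simp)
qed

abbreviation "br X Y \<equiv> algebroid_bracket C A \<rho> \<pi>0 \<pi>1 \<alpha> X Y"

lemma bracket_section [simp]: "\<lbrakk>sec X; sec Y\<rbrakk> \<Longrightarrow> sec (br X Y)"
  and bracket_eq: "\<lbrakk>sec X; sec Y\<rbrakk> \<Longrightarrow> complete_lift Y \<cdot> X = T X \<cdot> (\<rho> \<cdot> Y) +[tE] m X (br X Y)"
proof -
  assume X: "sec X" "sec Y"
  obtain b where b: "sec b" "lam \<cdot> b = bracket_difference C A \<rho> \<pi>0 \<pi>1 \<alpha> X Y"
    "complete_lift Y \<cdot> X = T X \<cdot> (\<rho> \<cdot> Y) +[tE] m X b"
    using bracket_exists[OF X] by blast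
  have "br X Y = b"
    unfolding algebroid_bracket_def by (rule the1_equality[OF bracket_exists_unique[OF X]]) (use b in simp)
  then show "sec (br X Y)" "complete_lift Y \<cdot> X = T X \<cdot> (\<rho> \<cdot> Y) +[tE] m X (br X Y)" using b by simp_all
qed

lemma bracket_eqI:
  assumes X: "sec X" "sec Y" "sec Z" and eq: "complete_lift Y \<cdot> X = T X \<cdot> (\<rho> \<cdot> Y) +[tE] m X Z"
  shows "br X Y = Z"
proof (rule mu_inj[OF is_lift_A])
  show "m X (br X Y) = m X Z"
    by (rule fibre_plus_cancel_left[of tE _ _ "T X \<cdot> (\<rho> \<cdot> Y)"])
      (use X eq bracket_eq[OF X(1,2)] bracket_section[OF X(1,2)] in simp_all)
qed (use X bracket_section[OF X(1,2)] in simp_all)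

lemma bracket_eq_el:
  assumes X: "sec X" "sec Y" and a: "el a M"
  shows "complete_lift Y \<cdot> (X \<cdot> a) = T X \<cdot> (\<rho> \<cdot> (Y \<cdot> a)) +[tE] m (X \<cdot> a) (br X Y \<cdot> a)"
proof -
  note b = bracket_section[OF X]
  have "complete_lift Y \<cdot> (X \<cdot> a) = (complete_lift Y \<cdot> X) \<cdot> a" using X a by simp
  also have "\<dots> = (T X \<cdot> (\<rho> \<cdot> Y)) \<cdot> a +[tE] m X (br X Y) \<cdot> a"
    unfolding bracket_eq[OF X] by (rule fibre_plus_comp) (use X a b in simp_all)
  also have "m X (br X Y) \<cdot> a = m (X \<cdot> a) (br X Y \<cdot> a)"
    by (rule mu_comp[OF is_lift_A]) (use X a b in simp_all)
  finally show ?thesis using X a by simp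
qed

section \<open>Additivity and antisymmetry of the bracket\<close>

lemma bracket_plus_left:
  assumes X: "sec X" "sec X'" "sec Y"
  shows "br (X +[A] X') Y = br X Y +[A] br X' Y"
proof (rule bracket_eqI)
  let ?s = "T X \<cdot> (\<rho> \<cdot> Y)" and ?s' = "T X' \<cdot> (\<rho> \<cdot> Y)"
  note b = bracket_section[OF X(1,3)] bracket_section[OF X(2,3)]
  have "complete_lift Y \<cdot> (X +[A] X') = complete_lift Y \<cdot> X +[TB] complete_lift Y \<cdot> X'"
    by (rule complete_lift_plus) (use X in simp_all)
  also have "\<dots> = (?s +[tE] m X (br X Y)) +[TB] (?s' +[tE] m X' (br X' Y))"
    by (simp only: bracket_eq[OF X(1,3)] bracket_eq[OF X(2,3)])
  also have "\<dots> = (?s +[TB] ?s') +[tE] (m X (br X Y) +[TB] m X' (br X' Y))"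
    by (rule interchange[symmetric]) (use X b in simp_all)
  also have "m X (br X Y) +[TB] m X' (br X' Y) = m (X +[A] X') (br X Y +[A] br X' Y)"
    by (rule mu_plus_plus[OF is_lift_A, symmetric]) (use X b in simp_all)
  also have "?s +[TB] ?s' = T (X +[A] X') \<cdot> (\<rho> \<cdot> Y)"
    by (rule T_sec_plus_el[symmetric]) (use X in simp_all)
  finally show "complete_lift Y \<cdot> (X +[A] X') = T (X +[A] X') \<cdot> (\<rho> \<cdot> Y) +[tE] m (X +[A] X') (br X Y +[A] br X' Y)" .
qed (use X in simp_all)

lemma bracket_plus_right:
  assumes X: "sec X" "sec Y" "sec Y'"
  shows "br X (Y +[A] Y') = br X Y +[A] br X Y'"
proof (rule bracket_eqI)
  let ?s = "T X \<cdot> (\<rho> \<cdot> Y)" and ?s' = "T X \<cdot> (\<rho> \<cdot> Y')"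
  note b = bracket_section[OF X(1,2)] bracket_section[OF X(1,3)]
  have "complete_lift (Y +[A] Y') \<cdot> X = complete_lift Y \<cdot> X +[tE] complete_lift Y' \<cdot> X"
    by (rule complete_lift_section_plus) (use X in simp_all)
  also have "\<dots> = (?s +[tE] m X (br X Y)) +[tE] (?s' +[tE] m X (br X Y'))"
    by (simp only: bracket_eq[OF X(1,2)] bracket_eq[OF X(1,3)])
  also have "\<dots> = (?s +[tE] ?s') +[tE] (m X (br X Y) +[tE] m X (br X Y'))"
    by (rule fibre_plus_exchange) (use X b in simp_all)
  also have "m X (br X Y) +[tE] m X (br X Y') = m X (br X Y +[A] br X Y')"
    by (rule mu_plus[OF is_lift_A, symmetric]) (use X b in simp_all)
  also have "?s +[tE] ?s' = T X \<cdot> (\<rho> \<cdot> (Y +[A] Y'))"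
    using X by simp
  finally show "complete_lift (Y +[A] Y') \<cdot> X = T X \<cdot> (\<rho> \<cdot> (Y +[A] Y')) +[tE] m X (br X Y +[A] br X Y')" .
qed (use X in simp_all)

lemma bracket_antisymmetric:
  assumes X: "sec X" "sec Y"
  shows "br X Y +[A] br Y X = xi"
proof -
  let ?B = "br X Y" and ?B' = "br Y X"
  let ?s = "T Y \<cdot> (\<rho> \<cdot> X)" and ?t = "T X \<cdot> (\<rho> \<cdot> Y)"
  note b = bracket_section[OF X] bracket_section[OF X(2,1)]
  have cY: "complete_lift Y \<cdot> X = al X ?s" and cX: "complete_lift X \<cdot> Y = al Y ?t" using complete_lift_el[of Y X] complete_lift_el[of X Y] X by simp_all
  have x: "el xi E" "\<rho> \<cdot> xi = tzero C M" using rho_zero[of "Idn C M"] by simp_all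
  have u1: "al xi (lam \<cdot> ?B) = lam \<cdot> ?B" using al_unit[of ?B] b by simp
  \<comment> \<open>The pair \<open>(\<xi>, 0X)\<close> is a zero of the prolongation over \<open>p\<pi>\<^sub>1\<close>, so its image is idempotent.\<close>
  have u0: "al xi (tzero C E \<cdot> X) = T xi \<cdot> (\<rho> \<cdot> X)"
  proof (rule fibre_plus_cancel_right[of TB _ _ "al xi (tzero C E \<cdot> X)"])
    have "xi +[A] xi = xi" using fibre_plus_zero[of A xi xi "Idn C M"] by simp
    moreover have "tzero C E \<cdot> X +[tE] tzero C E \<cdot> X = tzero C E \<cdot> X"
      by (rule fibre_plus_zero) (use X in simp_all)
    moreover have "al (xi +[A] xi) (tzero C E \<cdot> X +[tE] tzero C E \<cdot> X) = al xi (tzero C E \<cdot> X) +[TB] al xi (tzero C E \<cdot> X)"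
      by (rule al_plus1) (use X x in simp_all)
    ultimately have "al xi (tzero C E \<cdot> X) +[TB] al xi (tzero C E \<cdot> X) = al xi (tzero C E \<cdot> X)" by simp
    moreover have "T xi \<cdot> (\<rho> \<cdot> X) +[TB] al xi (tzero C E \<cdot> X) = al xi (tzero C E \<cdot> X)"
      by (rule fibre_zero_plus) (use X x in simp_all)
    ultimately show "al xi (tzero C E \<cdot> X) +[TB] al xi (tzero C E \<cdot> X) = T xi \<cdot> (\<rho> \<cdot> X) +[TB] al xi (tzero C E \<cdot> X)" by simp
  qed (use X x in simp_all)
  \<comment> \<open>Inserting the equation for \<open>[X, Y]\<close> and then the one for \<open>[Y, X]\<close> shows that \<open>[Y, X] + [X, Y]\<close> contributes nothing to \<open>?s\<close>.\<close>
  have "al Y (al X ?s) = ?s"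
    using al_involutive[of X ?s] X by simp
  then have "?s = al Y (?t +[tE] m X ?B)"
    using bracket_eq[OF X] cY by simp
  also have "\<dots> = al (Y +[A] xi) (?t +[tE] m X ?B)"
    using fibre_plus_zero[of A xi Y "Idn C M"] X by simp
  also have "\<dots> = al Y ?t +[TB] al xi (m X ?B)"
    by (rule al_plus1) (use X b x in simp_all)
  also have "al xi (m X ?B) = al xi (tzero C E \<cdot> X) +[tE] al xi (lam \<cdot> ?B)"
    unfolding mu_def by (rule al_plus0) (use X b x in simp_all)
  also have "\<dots> = T xi \<cdot> (\<rho> \<cdot> X) +[tE] lam \<cdot> ?B" unfolding u0 u1 ..
  also have "al Y ?t +[TB] \<dots> = al Y ?t +[tE] m Y ?B"
    by (rule plus_lam_shift[OF is_lift_A]) (use X b in simp_all)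
  also have "al Y ?t = ?s +[tE] m Y ?B'" unfolding cX[symmetric] by (rule bracket_eq[OF X(2,1)])
  also have "(?s +[tE] m Y ?B') +[tE] m Y ?B = ?s +[tE] (m Y ?B' +[tE] m Y ?B)"
    by (rule fibre_plus_assoc) (use X b in simp_all)
  also have "m Y ?B' +[tE] m Y ?B = m Y (?B' +[A] ?B)"
    by (rule mu_plus[OF is_lift_A, symmetric]) (use X b in simp_all)
  finally have e: "?s = ?s +[tE] m Y (?B' +[A] ?B)" .
  have zero: "m Y xi = tzero C E \<cdot> Y" using mu_zero[OF is_lift_A, of Y] X by simp
  have "?s +[tE] m Y xi = ?s" unfolding zero by (rule fibre_plus_zero) (use X in simp_all)
  then have "?s +[tE] m Y (?B' +[A] ?B) = ?s +[tE] m Y xi" using e by simp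
  then have "m Y (?B' +[A] ?B) = m Y xi"
    by (rule fibre_plus_cancel_left[rotated -1]) (use X b x in simp_all)
  then have "?B' +[A] ?B = xi"
    by (rule mu_inj[OF is_lift_A]) (use X b x in simp_all)
  moreover have "?B' +[A] ?B = ?B +[A] ?B'" by (rule fibre_plus_commute) (use b in simp_all)
  ultimately show ?thesis by simp
qed

section \<open>Vertical lifts and translations\<close>

text \<open>The vertical lift \<open>a \<mapsto> \<mu>(a, W\<pi>a)\<close> of a section, a vector field on \<open>E\<close>.\<close>

definition vertical_lift :: "'a \<Rightarrow> 'a" where "vertical_lift W = m (Idn C E) (W \<cdot> pr)"

text \<open>The translation \<open>a \<mapsto> a + Z\<pi>a\<close>.\<close>

definition translation :: "'a \<Rightarrow> 'a" where "translation Z = Idn C E +[A] (Z \<cdot> pr)"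

lemma vertical_lift_arr [simp]:
  assumes "sec W" shows "vertical_lift W \<in> Arr C" "Dom C (vertical_lift W) = E" "Cod C (vertical_lift W) = TO C E" "el (vertical_lift W) (TO C E)"
proof -
  have "el (vertical_lift W) (TO C E)" "Dom C (vertical_lift W) = E" unfolding vertical_lift_def using assms by simp_all
  then show "vertical_lift W \<in> Arr C" "Dom C (vertical_lift W) = E" "Cod C (vertical_lift W) = TO C E" "el (vertical_lift W) (TO C E)" by (simp_all add: el_def)
qed

lemma vertical_lift_el:
  assumes "sec W" "el a E" shows "vertical_lift W \<cdot> a = m a (W \<cdot> (pr \<cdot> a))"
  unfolding vertical_lift_def using mu_comp[OF is_lift_A, of "Idn C E" "W \<cdot> pr" a] assms by simp

lemma vertical_lift_vector_field [simp]:
  assumes "sec W" shows "vector_field E (vertical_lift W)"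
proof (rule vector_fieldI)
  show "tproj C E \<cdot> vertical_lift W = Idn C E" unfolding vertical_lift_def using assms by simp
qed (use assms in simp_all)

lemma T_pr_vertical_lift [simp]:
  assumes "sec W" "el a E" shows "T pr \<cdot> (vertical_lift W \<cdot> a) = tzero C M \<cdot> (pr \<cdot> a)"
  unfolding vertical_lift_el[OF assms] using assms by simp

lemma T_vertical_lift_el:
  assumes W: "sec W" and t: "el t (TO C E)"
  shows "T (vertical_lift W) \<cdot> t = T (tzero C E) \<cdot> t +[TTB] T lam \<cdot> (T W \<cdot> (T pr \<cdot> t))"
proof -
  have q: "T pr \<cdot> tzero C E = T pr \<cdot> (lam \<cdot> (W \<cdot> pr))"
    using tzero_natural[of pr E "Idn C E"] W by simp
  have "T (vertical_lift W) = T (tzero C E +[TB] lam \<cdot> (W \<cdot> pr))"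
    by (simp add: vertical_lift_def mu_def)
  also have "\<dots> = T (tzero C E) +[TTB] T (lam \<cdot> (W \<cdot> pr))"
    by (rule TA_plus) (use W q in simp_all)
  finally have eq: "T (vertical_lift W) = T (tzero C E) +[TTB] T (lam \<cdot> (W \<cdot> pr))" .
  have q': "T (T pr) \<cdot> T (tzero C E) = T (T pr) \<cdot> T (lam \<cdot> (W \<cdot> pr))"
    by (rule TA_cong[OF q]) (use W in simp_all)
  have "T (vertical_lift W) \<cdot> t = T (tzero C E) \<cdot> t +[TTB] T (lam \<cdot> (W \<cdot> pr)) \<cdot> t"
    unfolding eq by (rule fibre_plus_comp) (use W t q' TA_el[OF tstr_el(2)[of E]] TA_el[OF pr_el(1)] in simp_all)
  then show ?thesis using W t TA_el[OF pr_el(1)] by simp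
qed

lemma translation_arr [simp]:
  assumes "sec Z" shows "translation Z \<in> Arr C" "Dom C (translation Z) = E" "Cod C (translation Z) = E" "el (translation Z) E"
proof -
  have "el (translation Z) E" "Dom C (translation Z) = E" unfolding translation_def using assms by simp_all
  then show "translation Z \<in> Arr C" "Dom C (translation Z) = E" "Cod C (translation Z) = E" "el (translation Z) E" by (simp_all add: el_def)
qed

lemma translation_el:
  assumes "sec Z" "el a E" shows "translation Z \<cdot> a = a +[A] Z \<cdot> (pr \<cdot> a)"
proof -
  have "translation Z \<cdot> a = Idn C E \<cdot> a +[A] (Z \<cdot> pr) \<cdot> a"
    unfolding translation_def by (rule fibre_plus_comp) (use assms in simp_all)
  then show ?thesis using assms by simp
qed

lemma T_translation_el:
  assumes "sec Z" "el s (TO C E)" shows "T (translation Z) \<cdot> s = s +[TB] T Z \<cdot> (T pr \<cdot> s)"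
proof -
  have "T (translation Z) = T (Idn C E) +[TB] T (Z \<cdot> pr)"
    unfolding translation_def by (rule TA_plus) (use assms in simp_all)
  then have eq: "T (translation Z) = Idn C (TO C E) +[TB] (T Z \<cdot> T pr)" using assms by simp
  have "T (translation Z) \<cdot> s = Idn C (TO C E) \<cdot> s +[TB] (T Z \<cdot> T pr) \<cdot> s"
    unfolding eq by (rule fibre_plus_comp) (use assms TA_el[OF pr_el(1)] in simp_all)
  then show ?thesis using assms TA_el[OF pr_el(1)] by simp
qed

text \<open>A translation preserves a complete lift up to the vertical lift of a bracket.\<close>

lemma has_defect_complete_lift:
  assumes X: "sec X" "sec Z"
  shows "has_defect E (complete_lift X) (translation Z) (vertical_lift (br Z X))"
proof -
  let ?B = "br Z X"
  note b = bracket_section[OF X(2,1)]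
  have "complete_lift X \<cdot> (translation Z \<cdot> a) = T (translation Z) \<cdot> (complete_lift X \<cdot> a) +[tE] vertical_lift ?B \<cdot> (translation Z \<cdot> a)" if a: "el a E" for a
  proof -
    let ?z = "Z \<cdot> (pr \<cdot> a)" and ?s = "T Z \<cdot> (\<rho> \<cdot> (X \<cdot> (pr \<cdot> a)))" and ?b = "?B \<cdot> (pr \<cdot> a)"
    have "complete_lift X \<cdot> (translation Z \<cdot> a) = complete_lift X \<cdot> a +[TB] complete_lift X \<cdot> ?z"
      unfolding translation_el[OF X(2) a] by (rule complete_lift_plus) (use X a in simp_all)
    also have "\<dots> = complete_lift X \<cdot> a +[TB] (?s +[tE] m ?z ?b)"
      using bracket_eq_el[OF X(2,1), of "pr \<cdot> a"] a by simp
    also have "\<dots> = (complete_lift X \<cdot> a +[TB] ?s) +[tE] m (a +[A] ?z) ?b"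
      by (rule plus_mu_shift[OF is_lift_A]) (use X a b in simp_all)
    also have "complete_lift X \<cdot> a +[TB] ?s = T (translation Z) \<cdot> (complete_lift X \<cdot> a)"
      using T_translation_el[OF X(2), of "complete_lift X \<cdot> a"] X a by simp
    also have "m (a +[A] ?z) ?b = vertical_lift ?B \<cdot> (translation Z \<cdot> a)"
      unfolding translation_el[OF X(2) a] using vertical_lift_el[OF b, of "a +[A] ?z"] X a by simp
    finally show ?thesis .
  qed
  from this[of "Idn C E"] show ?thesis unfolding has_defect_def[OF E_obj]
    using X b by simp
qed

text \<open>Linearity of the complete lift moves it inside the vertical lift, where the
  equation for \<open>[W, Y]\<close> applies.\<close>

lemma has_commutator_vertical_lift:
  assumes X: "sec Y" "sec W"
  shows "has_commutator E (complete_lift Y) (vertical_lift W) (vertical_lift (br W Y))"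
  unfolding has_commutator_def[OF E_obj]
proof (intro allI impI)
  fix a assume a: "el a E"
  let ?B = "br W Y" and ?c = "tflip C E" and ?oo = "tzero C (TO C E) \<cdot> (tzero C E \<cdot> a)"
  note b = bracket_section[OF X(2,1)]
  let ?w = "W \<cdot> (pr \<cdot> a)" and ?b = "?B \<cdot> (pr \<cdot> a)" and ?y = "complete_lift Y \<cdot> a" and ?s = "T W \<cdot> (\<rho> \<cdot> (Y \<cdot> (pr \<cdot> a)))"
  let ?S = "?c \<cdot> (T lam \<cdot> ?s)" and ?K = "?c \<cdot> (T lam \<cdot> m ?w ?b)" and ?Y = "tzero C (TO C E) \<cdot> ?y"
  have oo: "?oo +[TtE] ?oo = ?oo"
    using fibre_plus_zero[of TtE "T (tzero C E)" ?oo "tzero C E \<cdot> a"] a by simp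
  \<comment> \<open>The term with the bracket is, up to \<open>c\<close>, the value of \<open>\<mu>\<close> on vertical lifts.\<close>
  have 1: "?oo +[TTB] ?K = ?c \<cdot> mu tE (tlift C E) (vertical_lift W \<cdot> a) (vertical_lift ?B \<cdot> a)"
  proof -
    have e: "T lam \<cdot> m ?w ?b = tzero C (TO C E) \<cdot> (lam \<cdot> ?w) +[TtE] tlift C E \<cdot> (lam \<cdot> ?b)"
      unfolding mu_def using X a b by simp
    have cK: "?c \<cdot> ?K = T lam \<cdot> m ?w ?b" by (rule flip_flip) (use X a b in simp_all)
    have "?c \<cdot> (?oo +[TTB] ?K) = ?c \<cdot> ?oo +[TTB] ?c \<cdot> ?K"
      by (rule flip_TTplus) (use X a b in simp_all)
    also have "?c \<cdot> ?oo = ?oo" using a by simp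
    also have "?c \<cdot> ?K = T lam \<cdot> m ?w ?b" by (rule cK)
    also have "?oo +[TTB] T lam \<cdot> m ?w ?b = (?oo +[TtE] ?oo) +[TTB] (tzero C (TO C E) \<cdot> (lam \<cdot> ?w) +[TtE] tlift C E \<cdot> (lam \<cdot> ?b))"
      by (simp only: oo e)
    also have "\<dots> = (?oo +[TTB] tzero C (TO C E) \<cdot> (lam \<cdot> ?w)) +[TtE] (?oo +[TTB] tlift C E \<cdot> (lam \<cdot> ?b))"
      by (rule T_interchange[symmetric]) (use X a b in simp_all)
    also have "\<dots> = mu tE (tlift C E) (vertical_lift W \<cdot> a) (vertical_lift ?B \<cdot> a)"
      unfolding vertical_lift_el[OF X(2) a] vertical_lift_el[OF b a] mu_def using X a b by simp
    finally have "?c \<cdot> (?oo +[TTB] ?K) = mu tE (tlift C E) (vertical_lift W \<cdot> a) (vertical_lift ?B \<cdot> a)" .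
    then have "?c \<cdot> (?c \<cdot> (?oo +[TTB] ?K)) = ?c \<cdot> mu tE (tlift C E) (vertical_lift W \<cdot> a) (vertical_lift ?B \<cdot> a)" by (simp only:)
    moreover have "?c \<cdot> (?c \<cdot> (?oo +[TTB] ?K)) = ?oo +[TTB] ?K"
      by (rule flip_flip) (use X a b in simp_all)
    ultimately show ?thesis by (simp only:)
  qed
  have "T (complete_lift Y) \<cdot> (vertical_lift W \<cdot> a) = T (complete_lift Y) \<cdot> (tzero C E \<cdot> a +[TB] lam \<cdot> ?w)"
    unfolding vertical_lift_el[OF X(2) a] mu_def ..
  also have "\<dots> = T (complete_lift Y) \<cdot> (tzero C E \<cdot> a) +[TTB] T (complete_lift Y) \<cdot> (lam \<cdot> ?w)"
    by (rule T_complete_lift_Tplus) (use X a in simp_all)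
  also have "\<dots> = ?Y +[TTB] ?c \<cdot> (T lam \<cdot> (complete_lift Y \<cdot> ?w))"
    using T_complete_lift_lam[OF X(1), of ?w] X a by simp
  also have "\<dots> = ?Y +[TTB] (?S +[TtE] ?K)"
    using bracket_eq_el[OF X(2,1), of "pr \<cdot> a"] X a b by simp
  also have "\<dots> = (?Y +[TtE] ?oo) +[TTB] (?S +[TtE] ?K)"
    using fibre_plus_zero[of TtE "T (tzero C E)" ?Y "tzero C E \<cdot> a"] X a by simp
  also have "\<dots> = (?Y +[TTB] ?S) +[TtE] (?oo +[TTB] ?K)"
    by (rule T_interchange[symmetric]) (use X a b in simp_all)
  also have "?Y +[TTB] ?S = ?c \<cdot> (T (vertical_lift W) \<cdot> ?y)"
    using T_vertical_lift_el[OF X(2), of ?y] X a by simp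
  also have "?c \<cdot> (T (vertical_lift W) \<cdot> ?y) +[TtE] (?oo +[TTB] ?K)
    = ?c \<cdot> (T (vertical_lift W) \<cdot> ?y +[tTE] mu tE (tlift C E) (vertical_lift W \<cdot> a) (vertical_lift ?B \<cdot> a))"
    unfolding 1 by (rule flip_tplus[symmetric]) (use X a b in simp_all)
  finally show "T (complete_lift Y) \<cdot> (vertical_lift W \<cdot> a) = ?c \<cdot> (T (vertical_lift W) \<cdot> (complete_lift Y \<cdot> a) +[tTE] mu tE (tlift C E) (vertical_lift W \<cdot> a) (vertical_lift ?B \<cdot> a))" .
qed

text \<open>The flip equation for \<open>\<alpha>\<close> expresses \<open>T(X\<^sup>c)Y\<^sup>c\<close> through \<open>T(\<alpha>)\<close> and \<open>X\<^sup>cY\<close>. The equation for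
  \<open>[Y, X]\<close> splits \<open>X\<^sup>cY\<close> into two summands, and by additivity of \<open>T(\<alpha>)\<close> the first contributes
  \<open>T(Y\<^sup>c)X\<^sup>c\<close> and the second \<open>\<mu>(Y\<^sup>c, [Y, X]\<^sup>c)\<close>.\<close>

lemma has_commutator_complete_lift:
  assumes X: "sec X" "sec Y"
  shows "has_commutator E (complete_lift X) (complete_lift Y) (complete_lift (br Y X))"
  unfolding has_commutator_def[OF E_obj]
proof (intro allI impI)
  fix a assume a: "el a E"
  let ?W = "br Y X" and ?c = "tflip C E"
  note b = bracket_section[OF X(2,1)]
  let ?s = "\<rho> \<cdot> a" and ?w = "T Y \<cdot> (\<rho> \<cdot> a)"
  let ?x = "?c \<cdot> (T (T X) \<cdot> (T \<rho> \<cdot> ?w))"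
  let ?x' = "?c \<cdot> (T (T Y) \<cdot> (T \<rho> \<cdot> (T X \<cdot> ?s)))"
  let ?y' = "tzero C (TO C E) \<cdot> ?w +[TTB] ?c \<cdot> (T lam \<cdot> (T ?W \<cdot> ?s))"
  let ?n = "T (tzero C E) \<cdot> ?w +[TTB] T lam \<cdot> (T ?W \<cdot> ?s)"
  have n: "el ?n (TO C (TO C E))" "Dom C ?n = Dom C a" using X a b by simp_all
  have "T (tproj C E) \<cdot> ?n = ?w +[TB] T xi \<cdot> ?s" using X a b by simp
  also have "\<dots> = ?w" by (rule fibre_plus_zero) (use X a in simp_all)
  finally have Tn: "T (tproj C E) \<cdot> ?n = ?w" .
  have cn: "?c \<cdot> ?n = ?y'" using X a b by simp
  have "tproj C (TO C E) \<cdot> (?c \<cdot> ?n) = T (tproj C E) \<cdot> ?n" by (rule tproj_flip) (use n in simp_all)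
  then have Py: "tproj C (TO C E) \<cdot> ?y' = ?w" unfolding cn Tn .
  have T: "?c \<cdot> (T (complete_lift X) \<cdot> ?w) = ?x' +[tTE] ?y'"
  proof -
    have id: "T pr \<cdot> T Y = Idn C (TO C M)" "T pr \<cdot> T ?W = Idn C (TO C M)"
      using sec_T_pr[OF X(2), of "Idn C (TO C M)"] sec_T_pr[OF b, of "Idn C (TO C M)"] X b by simp_all
    have q: "T pr \<cdot> (tzero C E \<cdot> Y) = T pr \<cdot> (lam \<cdot> ?W)" using X b by simp
    have q': "T (T pr) \<cdot> (T (tzero C E) \<cdot> T Y) = T (T pr) \<cdot> (T lam \<cdot> T ?W)"
      using TA_cong[OF q] X b by simp
    have e1: "T (m Y ?W) = T (tzero C E) \<cdot> T Y +[TTB] T lam \<cdot> T ?W"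
    proof -
      have "T (m Y ?W) = T (tzero C E \<cdot> Y) +[TTB] T (lam \<cdot> ?W)"
        unfolding mu_def by (rule TA_plus) (use X b in simp_all)
      then show ?thesis using X b by simp
    qed
    have e2: "T (m Y ?W) \<cdot> ?s = T (tzero C E) \<cdot> ?w +[TTB] T lam \<cdot> (T ?W \<cdot> ?s)"
    proof -
      have "T (m Y ?W) \<cdot> ?s = (T (tzero C E) \<cdot> T Y) \<cdot> ?s +[TTB] (T lam \<cdot> T ?W) \<cdot> ?s"
        unfolding e1 by (rule fibre_plus_comp) (use X b a q' in simp_all)
      then show ?thesis using X b a by simp
    qed
    have p: "el (T Y \<cdot> (\<rho> \<cdot> X)) (TO C E)" "el (m Y ?W) (TO C E)" "Dom C (T Y \<cdot> (\<rho> \<cdot> X)) = M" "Dom C (m Y ?W) = M"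
      "tproj C E \<cdot> (T Y \<cdot> (\<rho> \<cdot> X)) = tproj C E \<cdot> m Y ?W"
      using X b by simp_all
    have "T (complete_lift X) \<cdot> T Y = T (complete_lift X \<cdot> Y)" using X by simp
    also have "\<dots> = T (T Y \<cdot> (\<rho> \<cdot> X)) +[TtE] T (m Y ?W)"
      unfolding bracket_eq[OF X(2,1)] by (rule TA_plus) (use p in simp_all)
    finally have e3: "T (complete_lift X) \<cdot> T Y = T (T Y \<cdot> (\<rho> \<cdot> X)) +[TtE] T (m Y ?W)" .
    have p': "T (tproj C E) \<cdot> T (T Y \<cdot> (\<rho> \<cdot> X)) = T (tproj C E) \<cdot> T (m Y ?W)"
      by (rule TA_cong[OF p(5)]) (use p in simp_all)
    have pa: "T Y \<cdot> (\<rho> \<cdot> X) \<in> Arr C" "m Y ?W \<in> Arr C" using p(1,2) by (simp_all add: el_def)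
    have "T (complete_lift X) \<cdot> ?w = (T (complete_lift X) \<cdot> T Y) \<cdot> ?s" using X a by simp
    also have "\<dots> = T (T Y \<cdot> (\<rho> \<cdot> X)) \<cdot> ?s +[TtE] T (m Y ?W) \<cdot> ?s"
      unfolding e3 by (rule fibre_plus_comp) (use p pa p' a TA_el[OF p(1)] TA_el[OF p(2)] TA_dom[OF pa(1)] TA_dom[OF pa(2)] in \<open>simp_all del: TA_Comp\<close>)
    also have "T (T Y \<cdot> (\<rho> \<cdot> X)) \<cdot> ?s = T (T Y) \<cdot> (T \<rho> \<cdot> (T X \<cdot> ?s))"
      using X a by simp
    finally have "T (complete_lift X) \<cdot> ?w = T (T Y) \<cdot> (T \<rho> \<cdot> (T X \<cdot> ?s))
      +[TtE] ?n" unfolding e2 .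
    then have "?c \<cdot> (T (complete_lift X) \<cdot> ?w) = ?c \<cdot> (T (T Y) \<cdot> (T \<rho> \<cdot> (T X \<cdot> ?s)) +[TtE] ?n)"
      by (simp only:)
    also have "\<dots> = ?x' +[tTE] ?c \<cdot> ?n"
      by (rule flip_Ttplus) (use X a n Tn in \<open>simp_all del: T_tproj_TTplus\<close>)
    finally show ?thesis unfolding cn .
  qed
  have "T (complete_lift X) \<cdot> (complete_lift Y \<cdot> a) = Tal (al a ?w) ?x"
    using T_complete_lift_el[OF X(1), of "complete_lift Y \<cdot> a"] complete_lift_el[OF X(2) a] X a by simp
  also have "\<dots> = ?c \<cdot> Tal (al a (tproj C (TO C E) \<cdot> ?x)) (?c \<cdot> Tal ?w (?c \<cdot> ?x))"
    by (rule al_flip) (use X a in simp_all)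
  also have "al a (tproj C (TO C E) \<cdot> ?x) = complete_lift X \<cdot> a"
    using complete_lift_el[OF X(1) a] X a by simp
  also have "Tal ?w (?c \<cdot> ?x) = T (complete_lift X) \<cdot> ?w"
    using T_complete_lift_el[OF X(1), of ?w] X a by simp
  also have "?c \<cdot> (T (complete_lift X) \<cdot> ?w) = ?x' +[tTE] ?y'" by (rule T)
  also have "Tal (complete_lift X \<cdot> a) (?x' +[tTE] ?y') = T (complete_lift Y) \<cdot> (complete_lift X \<cdot> a) +[tTE] mu tE (tlift C E) (complete_lift Y \<cdot> a) (complete_lift ?W \<cdot> a)"
  proof -
    have cX: "complete_lift X \<cdot> a +[tE] tzero C E \<cdot> a = complete_lift X \<cdot> a"
      by (rule fibre_plus_zero) (use X a in simp_all)
    have rX: "T \<rho> \<cdot> (complete_lift X \<cdot> a) = tflip C M \<cdot> (T \<rho> \<cdot> (T X \<cdot> ?s))"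
      unfolding complete_lift_el[OF X(1) a] using X a by simp
    have "Tal (complete_lift X \<cdot> a +[tE] tzero C E \<cdot> a) (?x' +[tTE] ?y') = Tal (complete_lift X \<cdot> a) ?x' +[tTE] Tal (tzero C E \<cdot> a) ?y'"
      by (rule Tal_plus_t) (use X a b rX Py in \<open>simp_all del: tproj_Tplus\<close>)
    also have "Tal (complete_lift X \<cdot> a) ?x' = T (complete_lift Y) \<cdot> (complete_lift X \<cdot> a)"
      using T_complete_lift_el[OF X(2), of "complete_lift X \<cdot> a"] X a rX by simp
    also have "Tal (tzero C E \<cdot> a) ?y' = Tal (tzero C E \<cdot> a) (tzero C (TO C E) \<cdot> ?w) +[TtE] Tal (tzero C E \<cdot> a) (?c \<cdot> (T lam \<cdot> (T ?W \<cdot> ?s)))"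
      by (rule Tal_plus_T) (use X a b in simp_all)
    also have "Tal (tzero C E \<cdot> a) (tzero C (TO C E) \<cdot> ?w) = tzero C (TO C E) \<cdot> (complete_lift Y \<cdot> a)"
      unfolding complete_lift_el[OF X(2) a] by (rule Tal_zero) (use X a in simp_all)
    also have "Tal (tzero C E \<cdot> a) (?c \<cdot> (T lam \<cdot> (T ?W \<cdot> ?s))) = tlift C E \<cdot> (complete_lift ?W \<cdot> a)"
      unfolding complete_lift_el[OF b a] by (rule Tal_lift0) (use b a in simp_all)
    finally show ?thesis unfolding cX by (simp add: mu_def)
  qed
  finally show "T (complete_lift X) \<cdot> (complete_lift Y \<cdot> a) = ?c \<cdot> (T (complete_lift Y) \<cdot> (complete_lift X \<cdot> a) +[tTE] mu tE (tlift C E) (complete_lift Y \<cdot> a) (complete_lift ?W \<cdot> a))" .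
qed

section \<open>The Jacobi identity\<close>

lemma vertical_lift_commute:
  assumes X: "sec V" "sec W" and a: "el a E"
  shows "T (vertical_lift V) \<cdot> (vertical_lift W \<cdot> a) = tflip C E \<cdot> (T (vertical_lift W) \<cdot> (vertical_lift V \<cdot> a))"
proof -
  let ?c = "tflip C E" and ?oo = "tzero C (TO C E) \<cdot> (tzero C E \<cdot> a)"
  let ?u = "\<lambda>V. tzero C (TO C E) \<cdot> (lam \<cdot> (V \<cdot> (pr \<cdot> a)))" and ?t = "\<lambda>V. T (tzero C E) \<cdot> (lam \<cdot> (V \<cdot> (pr \<cdot> a)))"
  have m: "additive_bundle_morphism C A TB (tzero C E) (tzero C M)"
    by (rule additive_bundle_morphismI) simp_all
  have T: "T (vertical_lift V) \<cdot> (vertical_lift W \<cdot> a) = (?oo +[TTB] ?t W) +[TTB] ?u V" if X: "sec V" "sec W" for V W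
  proof -
    have "T (vertical_lift V) \<cdot> (vertical_lift W \<cdot> a) = T (tzero C E) \<cdot> (vertical_lift W \<cdot> a) +[TTB] ?u V"
      using T_vertical_lift_el[OF X(1), of "vertical_lift W \<cdot> a"] X a by simp
    also have "T (tzero C E) \<cdot> (vertical_lift W \<cdot> a) = ?oo +[TTB] ?t W"
      unfolding vertical_lift_el[OF X(2) a] mu_def
      using bundle_morphism_plus[OF bundle_morphism_T[OF m], of "tzero C E \<cdot> a" "lam \<cdot> (W \<cdot> (pr \<cdot> a))"] X a by simp
    finally show ?thesis .
  qed
  have "?c \<cdot> (T (vertical_lift W) \<cdot> (vertical_lift V \<cdot> a)) = (?oo +[TTB] ?u V) +[TTB] ?t W"
    unfolding T[OF X(2,1)] using X a by simp
  also have "\<dots> = (?oo +[TTB] ?t W) +[TTB] ?u V"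
    by (rule fibre_plus_swap) (use X a in simp_all)
  finally show ?thesis unfolding T[OF X] by simp
qed

text \<open>The identity for the flows of the complete lifts of \<open>X\<close> and \<open>Y\<close> and the translation by
  \<open>Z\<close>, evaluated at the zero section: \<open>\<xi>\<close> is translated to \<open>Z\<close>, and \<open>\<mu>(Z, -)\<close> is monic.\<close>

lemma bracket_leibniz:
  assumes X: "sec X" "sec Y" "sec Z"
  shows "br (br Z X) Y +[A] br Z (br Y X) = br (br Z Y) X"
proof -
  note s = X bracket_section
  have tz: "translation Z \<cdot> xi = Z"
  proof -
    have "translation Z \<cdot> xi = xi +[A] Z" using translation_el[OF X(3), of xi] X by simp
    then show ?thesis using fibre_zero_plus[of A xi Z "Idn C M"] X by simp
  qed
  have "vertical_lift (br (br Z X) Y) \<cdot> (translation Z \<cdot> xi) +[tE] vertical_lift (br Z (br Y X)) \<cdot> (translation Z \<cdot> xi) = vertical_lift (br (br Z Y) X) \<cdot> (translation Z \<cdot> xi)"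
  proof (rule vector_field_jacobi[OF E_obj])
    show "has_commutator E (complete_lift X) (complete_lift Y) (complete_lift (br Y X))" by (rule has_commutator_complete_lift) (use s in simp_all)
    show "has_commutator E (complete_lift Y) (vertical_lift (br Z X)) (vertical_lift (br (br Z X) Y))" by (rule has_commutator_vertical_lift) (use s in simp_all)
    show "has_commutator E (complete_lift X) (vertical_lift (br Z Y)) (vertical_lift (br (br Z Y) X))" by (rule has_commutator_vertical_lift) (use s in simp_all)
    show "has_defect E (complete_lift X) (translation Z) (vertical_lift (br Z X))" by (rule has_defect_complete_lift) (use s in simp_all)
    show "has_defect E (complete_lift Y) (translation Z) (vertical_lift (br Z Y))" by (rule has_defect_complete_lift) (use s in simp_all)
    show "has_defect E (complete_lift (br Y X)) (translation Z) (vertical_lift (br Z (br Y X)))" by (rule has_defect_complete_lift) (use s in simp_all)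
    show "inner_flow E (vertical_lift (br Z X)) (outer_flow E (vertical_lift (br Z Y)) w) = outer_flow E (vertical_lift (br Z Y)) (inner_flow E (vertical_lift (br Z X)) w)"
      if "el w (TO C (TO C E))" for w
      by (rule inner_outer_commute[OF E_obj _ _ vertical_lift_commute that]) (use s in simp_all)
  qed (use s in simp_all)
  then have "m Z (br (br Z X) Y) +[tE] m Z (br Z (br Y X)) = m Z (br (br Z Y) X)"
    unfolding tz using s by (simp add: vertical_lift_el)
  moreover have "m Z (br (br Z X) Y +[A] br Z (br Y X)) = m Z (br (br Z X) Y) +[tE] m Z (br Z (br Y X))"
    by (rule mu_plus[OF is_lift_A]) (use s in simp_all)
  ultimately have "m Z (br (br Z X) Y +[A] br Z (br Y X)) = m Z (br (br Z Y) X)" by simp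
  then show ?thesis by (rule mu_inj[OF is_lift_A]) (use s in simp_all)
qed

lemma section_group_comm_group: "comm_group (section_group C A)"
proof (rule comm_groupI)
  fix X assume "X \<in> carrier (section_group C A)"
  then have X: "sec X" by (simp add: section_group_def)
  obtain n where n: "is_negation C A n" using stable_A unfolding stable_bundle_def by blast
  note nX = plus_negation[OF stable_additive[OF stable_A] n sec_facts(4)[OF X]]
  have sn: "sec (n \<cdot> X)" by (rule secI) (use nX(1-3) X in simp_all)
  have "(n \<cdot> X) +[A] X = xi"
    using fibre_plus_commute[of A "n \<cdot> X" X] nX X by simp
  then show "\<exists>Y\<in>carrier (section_group C A). Y \<otimes>\<^bsub>section_group C A\<^esub> X = \<one>\<^bsub>section_group C A\<^esub>"
    using sn by (auto simp: section_group_def)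
next
  fix X Y assume "X \<in> carrier (section_group C A)" "Y \<in> carrier (section_group C A)"
  then have "sec X" "sec Y" by (simp_all add: section_group_def)
  then show "X \<otimes>\<^bsub>section_group C A\<^esub> Y = Y \<otimes>\<^bsub>section_group C A\<^esub> X"
    unfolding section_group_def monoid.simps by (intro fibre_plus_commute) simp_all
next
  fix X Y Z assume "X \<in> carrier (section_group C A)" "Y \<in> carrier (section_group C A)" "Z \<in> carrier (section_group C A)"
  then have "sec X" "sec Y" "sec Z" by (simp_all add: section_group_def)
  then show "X \<otimes>\<^bsub>section_group C A\<^esub> Y \<otimes>\<^bsub>section_group C A\<^esub> Z = X \<otimes>\<^bsub>section_group C A\<^esub> (Y \<otimes>\<^bsub>section_group C A\<^esub> Z)"
    unfolding section_group_def monoid.simps by (intro fibre_plus_assoc) simp_all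
next
  fix X assume "X \<in> carrier (section_group C A)"
  then have X: "sec X" by (simp add: section_group_def)
  then show "\<one>\<^bsub>section_group C A\<^esub> \<otimes>\<^bsub>section_group C A\<^esub> X = X"
    using fibre_zero_plus[of A xi X "Idn C M"] by (simp add: section_group_def)
next
  show "\<one>\<^bsub>section_group C A\<^esub> \<in> carrier (section_group C A)"
    unfolding section_group_def by simp (rule secI, simp_all)
qed (simp add: section_group_def)

lemma section_bracket_lie: "lie_bracket (section_group C A) (algebroid_bracket C A \<rho> \<pi>0 \<pi>1 \<alpha>)"
proof -
  let ?G = "section_group C A"
  interpret G: comm_group ?G by (rule section_group_comm_group)
  have car: "carrier ?G = bundle_sections C A" and mul: "\<And>x y. x \<otimes>\<^bsub>?G\<^esub> y = x +[A] y" and one: "\<one>\<^bsub>?G\<^esub> = xi"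
    by (simp_all add: section_group_def)
  have closed: "br x y \<in> carrier ?G" if "x \<in> carrier ?G" "y \<in> carrier ?G" for x y
    using that unfolding car by (rule bracket_section)
  have addl: "br (x \<otimes>\<^bsub>?G\<^esub> y) z = br x z \<otimes>\<^bsub>?G\<^esub> br y z" if "x \<in> carrier ?G" "y \<in> carrier ?G" "z \<in> carrier ?G" for x y z
    using that unfolding car mul by (rule bracket_plus_left)
  have addr: "br x (y \<otimes>\<^bsub>?G\<^esub> z) = br x y \<otimes>\<^bsub>?G\<^esub> br x z" if "x \<in> carrier ?G" "y \<in> carrier ?G" "z \<in> carrier ?G" for x y z
    using that unfolding car mul by (rule bracket_plus_right)
  have sum0: "br x y \<otimes>\<^bsub>?G\<^esub> br y x = \<one>\<^bsub>?G\<^esub>" if "x \<in> carrier ?G" "y \<in> carrier ?G" for x y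
    using that unfolding car mul one by (rule bracket_antisymmetric)
  have anti: "br x y = inv\<^bsub>?G\<^esub> br y x" if "x \<in> carrier ?G" "y \<in> carrier ?G" for x y
    using G.inv_equality[OF sum0[OF that]] that closed by simp
  have br1: "br x \<one>\<^bsub>?G\<^esub> = \<one>\<^bsub>?G\<^esub>" if x: "x \<in> carrier ?G" for x
    using addr[OF x G.one_closed G.one_closed] closed[OF x G.one_closed] G.l_cancel_one' by simp
  have brinv: "br x (inv\<^bsub>?G\<^esub> y) = inv\<^bsub>?G\<^esub> (br x y)" if x: "x \<in> carrier ?G" and y: "y \<in> carrier ?G" for x y
  proof (rule G.inv_equality[symmetric])
    show "br x (inv\<^bsub>?G\<^esub> y) \<otimes>\<^bsub>?G\<^esub> br x y = \<one>\<^bsub>?G\<^esub>"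
      using addr[OF x G.inv_closed[OF y] y] br1[OF x] G.l_inv[OF y] by simp
  qed (use closed x y in simp_all)
  show ?thesis
  proof (unfold_locales, goal_cases)
    case (1 x y) then show ?case by (rule closed)
  next
    case (2 x y z) then show ?case by (rule addl)
  next
    case (3 x y z) then show ?case by (rule addr)
  next
    case (4 x y) then show ?case by (rule anti)
  next
    case (5 x y z)
    let ?a = "br x (br y z)" and ?b = "br z (br x y)" and ?c = "br y (br z x)"
    have c: "?a \<in> carrier ?G" "?b \<in> carrier ?G" "?c \<in> carrier ?G" using 5 closed by simp_all
    have "br (br z x) y \<otimes>\<^bsub>?G\<^esub> br z (br y x) = br (br z y) x"
      using 5 unfolding car mul by (intro bracket_leibniz)
    moreover have "br (br z x) y = inv\<^bsub>?G\<^esub> ?c" using 5 closed by (intro anti) simp_all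
    moreover have "br z (br y x) = inv\<^bsub>?G\<^esub> ?b" using anti[of y x] brinv[of z "br x y"] 5 closed by simp
    moreover have "br (br z y) x = ?a"
    proof -
      have "br (br z y) x = inv\<^bsub>?G\<^esub> (br x (br z y))" using 5 closed by (intro anti) simp_all
      also have "br x (br z y) = inv\<^bsub>?G\<^esub> ?a" using anti[of z y] brinv[of x "br y z"] 5 closed by simp
      finally show ?thesis using c by simp
    qed
    ultimately have "inv\<^bsub>?G\<^esub> ?c \<otimes>\<^bsub>?G\<^esub> inv\<^bsub>?G\<^esub> ?b = ?a" by simp
    then have a: "?a = inv\<^bsub>?G\<^esub> (?b \<otimes>\<^bsub>?G\<^esub> ?c)" using G.inv_mult_group c by simp
    have "?a \<otimes>\<^bsub>?G\<^esub> ?b \<otimes>\<^bsub>?G\<^esub> ?c = ?a \<otimes>\<^bsub>?G\<^esub> (?b \<otimes>\<^bsub>?G\<^esub> ?c)" using c by (simp add: G.m_assoc)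
    also have "\<dots> = \<one>\<^bsub>?G\<^esub>" unfolding a using c by simp
    finally show ?case .
  qed
qed

end

theorem theorem4p2p2p6:
  fixes C :: "('o, 'a) tangent_data"
    and A :: "'a differential_bundle_data"
    and \<rho> \<pi>0 \<pi>1 \<alpha> :: 'a
  assumes "tangent_category_with_negatives C"
    and "involution_algebroid C A \<rho> \<pi>0 \<pi>1 \<alpha>"
  shows "(\<forall>X \<in> bundle_sections C A. \<forall>Y \<in> bundle_sections C A.
            \<exists>!Z. Z \<in> bundle_sections C A
              \<and> blift A \<cdot>\<^bsub>C\<^esub> Z = bracket_difference C A \<rho> \<pi>0 \<pi>1 \<alpha> X Y)
         \<and> lie_bracket (section_group C A) (algebroid_bracket C A \<rho> \<pi>0 \<pi>1 \<alpha>)"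
proof -
  interpret involution_algebroid_with_negatives C A \<rho> \<pi>0 \<pi>1 \<alpha>
    using assms by (simp add: involution_algebroid_with_negatives_def)
  show ?thesis using bracket_exists_unique section_bracket_lie by blast
qed

end
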